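(* Let $A$, $B$ be two monoids in a locally presentable braided monoidal closed category $\mathcal{V}$ and let $X$ be an object of $\mathcal{V}$. There is a bijection between: (1) Algebra structures on $X$ for the monad $(A\otimes -)$ on the Kleisli category $\mathcal{V}_B$; explicitly, morphisms $\psi\colon A\otimes X\to X\otimes B$ in $\mathcal{V}$ such that $$(X\otimes\mu_B)\cdot(\psi\otimes B)\cdot(A\otimes\psi)=\psi\cdot(\mu_A\otimes X)\quad\text{and}\quad \psi\cdot(\iota_A\otimes X)=X\otimes\iota_B.$$ (2) Monoid morphisms $A\to\mathcal{V}_B(X,X)=[X,X\otimes B]$. (3) Algebra structures on $X\otimes B$ for the monad $(A\otimes -)$ on $\mathcal{V}^B$. (4) Monoid morphisms $A\to\mathcal{V}^B(X\otimes B,X\otimes B)$. If $X$ has a dual, then the data in (1), (2), (3) and (4) are equivalent to: (5) Right $P(A,B)$-comodule structures on $X$.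
   Context: $[X,-]$ denotes the right adjoint of $-\otimes X$. Multiplications and units of monoids are denoted $\mu,\iota$. For a monoid $B$, $(-\otimes B)$ is a $\mathcal{V}$-enriched monad on $\mathcal{V}$. $\mathcal{V}_B$ is its Kleisli $\mathcal{V}$-category: it has the objects of $\mathcal{V}$, hom-objects $\mathcal{V}_B(X,Y)=[X,Y\otimes B]$, and Kleisli composition. $\mathcal{V}^B$ is its $\mathcal{V}$-category of Eilenberg–Moore algebras (right $B$-modules), with hom-objects given by the usual equalisers of $[M,N]\rightrightarrows[M\otimes B,N]$. The objects $\mathcal{V}_B(X,X)$ and $\mathcal{V}^B(X\otimes B,X\otimes B)$ (with $X\otimes B$ the free right $B$-module) are monoids under composition. Via the isomorphism $(A\otimes X)\otimes B\cong A\otimes(X\otimes B)$, the monad $(A\otimes-)$ on $\mathcal{V}$ extends to a monad on $\mathcal{V}_B$ and lifts to a monad on $\mathcal{V}^B$. For a comonoid $C$ and a monoid $B$, $[C,B]$ has the convolution monoid structure. $P(A,B)$, the universal measuring comonoid, is the comonoid with natural bijections $\mathbf{Mon}(\mathcal{V})(A,[C,B])\cong\mathbf{Comon}(\mathcal{V})(C,P(A,B))$ for comonoids $C$, where $\mathbf{Mon}(\mathcal{V})$ and $\mathbf{Comon}(\mathcal{V})$ are the categories of monoids and comonoids in $\mathcal{V}$; it exists whenever $\mathcal{V}$ is a locally presentable braided monoidal closed category. *)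

theory Defs
  imports Main
begin

section \<open>Categories\<close>

record ('o, 'm) cat =
  Obj :: "'o set"
  Mor :: "'m set"
  Dom :: "'m \<Rightarrow> 'o"
  Cod :: "'m \<Rightarrow> 'o"
  Ide :: "'o \<Rightarrow> 'm"
  Cmp :: "'m \<Rightarrow> 'm \<Rightarrow> 'm"  (infixr "\<cdot>\<index>" 55)

definition hom :: "('o, 'm, 'z) cat_scheme \<Rightarrow> 'o \<Rightarrow> 'o \<Rightarrow> 'm set" where
  "hom C X Y = {f \<in> Mor C. Dom C f = X \<and> Cod C f = Y}"

locale category =
  fixes C :: "('o, 'm, 'z) cat_scheme" (structure)
  assumes Dom_in: "f \<in> Mor C \<Longrightarrow> Dom C f \<in> Obj C"
    and Cod_in: "f \<in> Mor C \<Longrightarrow> Cod C f \<in> Obj C"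
    and Ide_in: "X \<in> Obj C \<Longrightarrow> Ide C X \<in> hom C X X"
    and Cmp_in: "f \<in> hom C X Y \<Longrightarrow> g \<in> hom C Y Z \<Longrightarrow> g \<cdot> f \<in> hom C X Z"
    and Cmp_Ide: "f \<in> hom C X Y \<Longrightarrow> f \<cdot> Ide C X = f"
    and Ide_Cmp: "f \<in> hom C X Y \<Longrightarrow> Ide C Y \<cdot> f = f"
    and Cmp_assoc: "f \<in> hom C W X \<Longrightarrow> g \<in> hom C X Y \<Longrightarrow> h \<in> hom C Y Z \<Longrightarrow>
      (h \<cdot> g) \<cdot> f = h \<cdot> (g \<cdot> f)"

definition is_inverse :: "('o, 'm, 'z) cat_scheme \<Rightarrow> 'm \<Rightarrow> 'm \<Rightarrow> bool" where
  "is_inverse C f g \<longleftrightarrow> g \<in> hom C (Cod C f) (Dom C f) \<and>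
     g \<cdot>\<^bsub>C\<^esub> f = Ide C (Dom C f) \<and> f \<cdot>\<^bsub>C\<^esub> g = Ide C (Cod C f)"

definition iso :: "('o, 'm, 'z) cat_scheme \<Rightarrow> 'm \<Rightarrow> bool" where
  "iso C f \<longleftrightarrow> f \<in> Mor C \<and> (\<exists>g. is_inverse C f g)"

definition inverse_of :: "('o, 'm, 'z) cat_scheme \<Rightarrow> 'm \<Rightarrow> 'm" where
  "inverse_of C f = (THE g. is_inverse C f g)"

definition is_equaliser ::
  "('o, 'm, 'z) cat_scheme \<Rightarrow> 'o \<Rightarrow> 'm \<Rightarrow> 'm \<Rightarrow> 'm \<Rightarrow> bool" where
  "is_equaliser C E e f g \<longleftrightarrow>
     e \<in> hom C E (Dom C f) \<and> f \<cdot>\<^bsub>C\<^esub> e = g \<cdot>\<^bsub>C\<^esub> e \<and>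
     (\<forall>W \<in> Obj C. \<forall>h \<in> hom C W (Dom C f). f \<cdot>\<^bsub>C\<^esub> h = g \<cdot>\<^bsub>C\<^esub> h \<longrightarrow>
        (\<exists>!k. k \<in> hom C W E \<and> e \<cdot>\<^bsub>C\<^esub> k = h))"

text \<open>The factorisation of \<open>h\<close> through a monomorphism \<open>e\<close>.\<close>

definition lift_through :: "('o, 'm, 'z) cat_scheme \<Rightarrow> 'm \<Rightarrow> 'm \<Rightarrow> 'm" where
  "lift_through C e h = (THE k. k \<in> hom C (Dom C h) (Dom C e) \<and> e \<cdot>\<^bsub>C\<^esub> k = h)"


section \<open>Monads and their algebras\<close>

record ('o, 'm) monad_data =
  TObj :: "'o \<Rightarrow> 'o"
  TMor :: "'m \<Rightarrow> 'm"
  Eta :: "'o \<Rightarrow> 'm"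
  Mu :: "'o \<Rightarrow> 'm"

definition algebra_structures ::
  "('o, 'm, 'z) cat_scheme \<Rightarrow> ('o, 'm) monad_data \<Rightarrow> 'o \<Rightarrow> 'm set" where
  "algebra_structures C T X = {a \<in> hom C (TObj T X) X.
     a \<cdot>\<^bsub>C\<^esub> Mu T X = a \<cdot>\<^bsub>C\<^esub> TMor T a \<and> a \<cdot>\<^bsub>C\<^esub> Eta T X = Ide C X}"


section \<open>Locally presentable categories\<close>

unbundle cardinal_syntax

text \<open>
  The universe of small sets is represented by an uncountable regular cardinal \<open>\<kappa>\<close>: a set is
  small when its cardinality is below \<open>\<kappa>\<close>. A Grothendieck universe is the case of a strongly
  inaccessible \<open>\<kappa>\<close>; nothing below needs \<open>\<kappa>\<close> to be a strong limit. Every small category has an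
  isomorphic copy whose objects and arrows are elements of the carrier type of \<open>\<kappa>\<close>, so it is
  enough to let diagrams be indexed by such categories.
\<close>

definition regular_cardinal :: "'k rel \<Rightarrow> bool" where
  "regular_cardinal r \<longleftrightarrow> Card_order r \<and> infinite (Field r) \<and> regularCard r"

definition universe_cardinal :: "'k rel \<Rightarrow> bool" where
  "universe_cardinal \<kappa> \<longleftrightarrow> regular_cardinal \<kappa> \<and> natLeq <o \<kappa>"

definition small :: "'k rel \<Rightarrow> 'a set \<Rightarrow> bool" where
  "small \<kappa> S \<longleftrightarrow> |S| <o \<kappa>"

definition small_category :: "'k rel \<Rightarrow> ('k, 'k) cat \<Rightarrow> bool" where
  "small_category \<kappa> J \<longleftrightarrow> category J \<and> small \<kappa> (Obj J) \<and> small \<kappa> (Mor J)"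

text \<open>A category that is a poset in which every subset of cardinality below \<open>r\<close> has an upper
  bound.\<close>

definition directed_poset :: "'k rel \<Rightarrow> ('k, 'k) cat \<Rightarrow> bool" where
  "directed_poset r J \<longleftrightarrow> category J \<and>
     (\<forall>i \<in> Obj J. \<forall>j \<in> Obj J. \<forall>u \<in> hom J i j. \<forall>v \<in> hom J i j. u = v) \<and>
     (\<forall>i \<in> Obj J. \<forall>j \<in> Obj J. hom J i j \<noteq> {} \<and> hom J j i \<noteq> {} \<longrightarrow> i = j) \<and>
     (\<forall>S \<subseteq> Obj J. |S| <o r \<longrightarrow> (\<exists>b \<in> Obj J. \<forall>i \<in> S. hom J i b \<noteq> {}))"

record ('k, 'o, 'm) diagram =
  Shape :: "('k, 'k) cat"
  DObj :: "'k \<Rightarrow> 'o"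
  DMor :: "'k \<Rightarrow> 'm"

definition diagram_in :: "('o, 'm, 'z) cat_scheme \<Rightarrow> ('k, 'o, 'm) diagram \<Rightarrow> bool" where
  "diagram_in C D \<longleftrightarrow>
     (\<forall>i \<in> Obj (Shape D). DObj D i \<in> Obj C \<and>
        DMor D (Ide (Shape D) i) = Ide C (DObj D i)) \<and>
     (\<forall>i \<in> Obj (Shape D). \<forall>j \<in> Obj (Shape D). \<forall>u \<in> hom (Shape D) i j.
        DMor D u \<in> hom C (DObj D i) (DObj D j)) \<and>
     (\<forall>i \<in> Obj (Shape D). \<forall>j \<in> Obj (Shape D). \<forall>k \<in> Obj (Shape D).
        \<forall>u \<in> hom (Shape D) i j. \<forall>v \<in> hom (Shape D) j k.
        DMor D (v \<cdot>\<^bsub>Shape D\<^esub> u) = DMor D v \<cdot>\<^bsub>C\<^esub> DMor D u)"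

definition cocone ::
  "('o, 'm, 'z) cat_scheme \<Rightarrow> ('k, 'o, 'm) diagram \<Rightarrow> 'o \<Rightarrow> ('k \<Rightarrow> 'm) \<Rightarrow> bool" where
  "cocone C D c t \<longleftrightarrow> c \<in> Obj C \<and>
     (\<forall>i \<in> Obj (Shape D). t i \<in> hom C (DObj D i) c) \<and>
     (\<forall>i \<in> Obj (Shape D). \<forall>j \<in> Obj (Shape D). \<forall>u \<in> hom (Shape D) i j.
        t j \<cdot>\<^bsub>C\<^esub> DMor D u = t i)"

definition colimit ::
  "('o, 'm, 'z) cat_scheme \<Rightarrow> ('k, 'o, 'm) diagram \<Rightarrow> 'o \<Rightarrow> ('k \<Rightarrow> 'm) \<Rightarrow> bool" where
  "colimit C D c t \<longleftrightarrow> cocone C D c t \<and>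
     (\<forall>c' t'. cocone C D c' t' \<longrightarrow>
        (\<exists>!h. h \<in> hom C c c' \<and> (\<forall>i \<in> Obj (Shape D). h \<cdot>\<^bsub>C\<^esub> t i = t' i)))"

definition cocomplete :: "'k rel \<Rightarrow> ('o, 'm, 'z) cat_scheme \<Rightarrow> bool" where
  "cocomplete \<kappa> C \<longleftrightarrow> (\<forall>D :: ('k, 'o, 'm) diagram.
     small_category \<kappa> (Shape D) \<and> diagram_in C D \<longrightarrow> (\<exists>c t. colimit C D c t))"

text \<open>
  \<open>hom C X\<close> preserves the colimit \<open>(c, t)\<close> of an \<open>r\<close>-directed diagram exactly when every arrow
  from \<open>X\<close> to \<open>c\<close> factors, essentially uniquely, through the diagram.
\<close>

definition presentable ::
  "'k rel \<Rightarrow> 'k rel \<Rightarrow> ('o, 'm, 'z) cat_scheme \<Rightarrow> 'o \<Rightarrow> bool" where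
  "presentable \<kappa> r C X \<longleftrightarrow> X \<in> Obj C \<and>
     (\<forall>(D :: ('k, 'o, 'm) diagram) c t.
        small_category \<kappa> (Shape D) \<and> directed_poset r (Shape D) \<and> diagram_in C D \<and>
        colimit C D c t \<longrightarrow>
        (\<forall>f \<in> hom C X c. \<exists>i \<in> Obj (Shape D). \<exists>g \<in> hom C X (DObj D i). f = t i \<cdot>\<^bsub>C\<^esub> g) \<and>
        (\<forall>i \<in> Obj (Shape D). \<forall>g \<in> hom C X (DObj D i). \<forall>g' \<in> hom C X (DObj D i).
           t i \<cdot>\<^bsub>C\<^esub> g = t i \<cdot>\<^bsub>C\<^esub> g' \<longrightarrow>
           (\<exists>j \<in> Obj (Shape D). \<exists>u \<in> hom (Shape D) i j.
              DMor D u \<cdot>\<^bsub>C\<^esub> g = DMor D u \<cdot>\<^bsub>C\<^esub> g')))"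

definition locally_presentable :: "'k rel \<Rightarrow> ('o, 'm, 'z) cat_scheme \<Rightarrow> bool" where
  "locally_presentable \<kappa> C \<longleftrightarrow> category C \<and>
     (\<forall>X \<in> Obj C. \<forall>Y \<in> Obj C. small \<kappa> (hom C X Y)) \<and>
     cocomplete \<kappa> C \<and>
     (\<exists>(r :: 'k rel) G. regular_cardinal r \<and> r <o \<kappa> \<and> small \<kappa> G \<and>
        (\<forall>X \<in> G. presentable \<kappa> r C X) \<and>
        (\<forall>c \<in> Obj C. \<exists>(D :: ('k, 'o, 'm) diagram) t.
           small_category \<kappa> (Shape D) \<and> directed_poset r (Shape D) \<and> diagram_in C D \<and>
           (\<forall>i \<in> Obj (Shape D). DObj D i \<in> G) \<and> colimit C D c t))"


section \<open>Braided monoidal closed categories\<close>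

text \<open>\<open>IHom X Y\<close> is \<open>[X, Y]\<close>, with \<open>[X, -]\<close> right adjoint to \<open>- \<otimes> X\<close> and counit \<open>Ev X Y\<close>.\<close>

record ('o, 'm) bmc = "('o, 'm) cat" +
  TensO :: "'o \<Rightarrow> 'o \<Rightarrow> 'o"  (infixr "\<otimes>\<index>" 70)
  TensM :: "'m \<Rightarrow> 'm \<Rightarrow> 'm"  (infixr "\<boxtimes>\<index>" 70)
  Unit :: "'o"  ("\<one>\<index>")
  Assoc :: "'o \<Rightarrow> 'o \<Rightarrow> 'o \<Rightarrow> 'm"
  LUnit :: "'o \<Rightarrow> 'm"
  RUnit :: "'o \<Rightarrow> 'm"
  Braid :: "'o \<Rightarrow> 'o \<Rightarrow> 'm"
  IHom :: "'o \<Rightarrow> 'o \<Rightarrow> 'o"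
  Ev :: "'o \<Rightarrow> 'o \<Rightarrow> 'm"

locale braided_monoidal_closed = category V
  for V :: "('o, 'm, 'z) bmc_scheme" (structure) +
  assumes TensO_in: "X \<in> Obj V \<Longrightarrow> Y \<in> Obj V \<Longrightarrow> X \<otimes> Y \<in> Obj V"
    and Unit_in: "\<one> \<in> Obj V"
    and TensM_in: "f \<in> hom V X X' \<Longrightarrow> g \<in> hom V Y Y' \<Longrightarrow>
      f \<boxtimes> g \<in> hom V (X \<otimes> Y) (X' \<otimes> Y')"
    and TensM_Ide: "X \<in> Obj V \<Longrightarrow> Y \<in> Obj V \<Longrightarrow>
      Ide V X \<boxtimes> Ide V Y = Ide V (X \<otimes> Y)"
    and TensM_Cmp: "f \<in> hom V X X' \<Longrightarrow> f' \<in> hom V X' X'' \<Longrightarrow>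
      g \<in> hom V Y Y' \<Longrightarrow> g' \<in> hom V Y' Y'' \<Longrightarrow>
      (f' \<cdot> f) \<boxtimes> (g' \<cdot> g) = (f' \<boxtimes> g') \<cdot> (f \<boxtimes> g)"
    and Assoc_in: "X \<in> Obj V \<Longrightarrow> Y \<in> Obj V \<Longrightarrow> Z \<in> Obj V \<Longrightarrow>
      Assoc V X Y Z \<in> hom V ((X \<otimes> Y) \<otimes> Z) (X \<otimes> (Y \<otimes> Z))"
    and Assoc_iso: "X \<in> Obj V \<Longrightarrow> Y \<in> Obj V \<Longrightarrow> Z \<in> Obj V \<Longrightarrow> iso V (Assoc V X Y Z)"
    and Assoc_natural: "f \<in> hom V X X' \<Longrightarrow> g \<in> hom V Y Y' \<Longrightarrow> h \<in> hom V Z Z' \<Longrightarrow>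
      Assoc V X' Y' Z' \<cdot> ((f \<boxtimes> g) \<boxtimes> h) = (f \<boxtimes> (g \<boxtimes> h)) \<cdot> Assoc V X Y Z"
    and LUnit_in: "X \<in> Obj V \<Longrightarrow> LUnit V X \<in> hom V (\<one> \<otimes> X) X"
    and LUnit_iso: "X \<in> Obj V \<Longrightarrow> iso V (LUnit V X)"
    and LUnit_natural: "f \<in> hom V X X' \<Longrightarrow>
      LUnit V X' \<cdot> (Ide V \<one> \<boxtimes> f) = f \<cdot> LUnit V X"
    and RUnit_in: "X \<in> Obj V \<Longrightarrow> RUnit V X \<in> hom V (X \<otimes> \<one>) X"
    and RUnit_iso: "X \<in> Obj V \<Longrightarrow> iso V (RUnit V X)"
    and RUnit_natural: "f \<in> hom V X X' \<Longrightarrow>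
      RUnit V X' \<cdot> (f \<boxtimes> Ide V \<one>) = f \<cdot> RUnit V X"
    and pentagon: "W \<in> Obj V \<Longrightarrow> X \<in> Obj V \<Longrightarrow> Y \<in> Obj V \<Longrightarrow> Z \<in> Obj V \<Longrightarrow>
      Assoc V W X (Y \<otimes> Z) \<cdot> Assoc V (W \<otimes> X) Y Z =
      (Ide V W \<boxtimes> Assoc V X Y Z) \<cdot> Assoc V W (X \<otimes> Y) Z \<cdot> (Assoc V W X Y \<boxtimes> Ide V Z)"
    and triangle: "X \<in> Obj V \<Longrightarrow> Y \<in> Obj V \<Longrightarrow>
      (Ide V X \<boxtimes> LUnit V Y) \<cdot> Assoc V X \<one> Y = RUnit V X \<boxtimes> Ide V Y"
    and Braid_in: "X \<in> Obj V \<Longrightarrow> Y \<in> Obj V \<Longrightarrow> Braid V X Y \<in> hom V (X \<otimes> Y) (Y \<otimes> X)"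
    and Braid_iso: "X \<in> Obj V \<Longrightarrow> Y \<in> Obj V \<Longrightarrow> iso V (Braid V X Y)"
    and Braid_natural: "f \<in> hom V X X' \<Longrightarrow> g \<in> hom V Y Y' \<Longrightarrow>
      Braid V X' Y' \<cdot> (f \<boxtimes> g) = (g \<boxtimes> f) \<cdot> Braid V X Y"
    and hexagon1: "X \<in> Obj V \<Longrightarrow> Y \<in> Obj V \<Longrightarrow> Z \<in> Obj V \<Longrightarrow>
      Assoc V Y Z X \<cdot> Braid V X (Y \<otimes> Z) \<cdot> Assoc V X Y Z =
      (Ide V Y \<boxtimes> Braid V X Z) \<cdot> Assoc V Y X Z \<cdot> (Braid V X Y \<boxtimes> Ide V Z)"
    and hexagon2: "X \<in> Obj V \<Longrightarrow> Y \<in> Obj V \<Longrightarrow> Z \<in> Obj V \<Longrightarrow>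
      inverse_of V (Assoc V Z X Y) \<cdot> Braid V (X \<otimes> Y) Z \<cdot> inverse_of V (Assoc V X Y Z) =
      (Braid V X Z \<boxtimes> Ide V Y) \<cdot> inverse_of V (Assoc V X Z Y) \<cdot> (Ide V X \<boxtimes> Braid V Y Z)"
    and IHom_in: "X \<in> Obj V \<Longrightarrow> Y \<in> Obj V \<Longrightarrow> IHom V X Y \<in> Obj V"
    and Ev_in: "X \<in> Obj V \<Longrightarrow> Y \<in> Obj V \<Longrightarrow> Ev V X Y \<in> hom V (IHom V X Y \<otimes> X) Y"
    and Ev_universal: "X \<in> Obj V \<Longrightarrow> Y \<in> Obj V \<Longrightarrow> Z \<in> Obj V \<Longrightarrow>
      f \<in> hom V (Z \<otimes> X) Y \<Longrightarrow>
      \<exists>!g. g \<in> hom V Z (IHom V X Y) \<and> Ev V X Y \<cdot> (g \<boxtimes> Ide V X) = f"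

record ('o, 'm) mon =
  MCar :: "'o"
  Mul :: "'m"
  Uni :: "'m"

record ('o, 'm) comon =
  CCar :: "'o"
  Comul :: "'m"
  Couni :: "'m"

context
  fixes V :: "('o, 'm, 'z) bmc_scheme" (structure)
begin

text \<open>The transpose of \<open>f\<close> from \<open>Z \<otimes> X\<close> to \<open>Y\<close>.\<close>

definition curry_arrow :: "'o \<Rightarrow> 'o \<Rightarrow> 'o \<Rightarrow> 'm \<Rightarrow> 'm" where
  "curry_arrow Z X Y f =
     (THE g. g \<in> hom V Z (IHom V X Y) \<and> Ev V X Y \<cdot> (g \<boxtimes> Ide V X) = f)"

text \<open>The arrow \<open>[f, Y]\<close> induced by \<open>f\<close> from \<open>X'\<close> to \<open>X\<close>.\<close>

definition precomp :: "'m \<Rightarrow> 'o \<Rightarrow> 'm" where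
  "precomp f Y = (let X = Cod V f; X' = Dom V f in
     curry_arrow (IHom V X Y) X' Y (Ev V X Y \<cdot> (Ide V (IHom V X Y) \<boxtimes> f)))"

text \<open>Composition \<open>[Y, Z] \<otimes> [X, Y] \<rightarrow> [X, Z]\<close> and identities of \<open>V\<close> enriched in itself.\<close>

definition icomp :: "'o \<Rightarrow> 'o \<Rightarrow> 'o \<Rightarrow> 'm" where
  "icomp X Y Z = curry_arrow (IHom V Y Z \<otimes> IHom V X Y) X Z
     (Ev V Y Z \<cdot> (Ide V (IHom V Y Z) \<boxtimes> Ev V X Y) \<cdot> Assoc V (IHom V Y Z) (IHom V X Y) X)"

definition iident :: "'o \<Rightarrow> 'm" where
  "iident X = curry_arrow \<one> X X (LUnit V X)"

text \<open>The interchange \<open>(W \<otimes> X) \<otimes> (Y \<otimes> Z) \<rightarrow> (W \<otimes> Y) \<otimes> (X \<otimes> Z)\<close> by the braiding of \<open>X\<close>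
  with \<open>Y\<close>.\<close>

definition interchange :: "'o \<Rightarrow> 'o \<Rightarrow> 'o \<Rightarrow> 'o \<Rightarrow> 'm" where
  "interchange W X Y Z =
     inverse_of V (Assoc V W Y (X \<otimes> Z)) \<cdot>
     (Ide V W \<boxtimes> (Assoc V Y X Z \<cdot> (Braid V X Y \<boxtimes> Ide V Z) \<cdot> inverse_of V (Assoc V X Y Z))) \<cdot>
     Assoc V W X (Y \<otimes> Z)"


subsection \<open>Monoids, comonoids, comodules, duals\<close>

definition monoid_in :: "('o, 'm) mon \<Rightarrow> bool" where
  "monoid_in A \<longleftrightarrow> MCar A \<in> Obj V \<and>
     Mul A \<in> hom V (MCar A \<otimes> MCar A) (MCar A) \<and> Uni A \<in> hom V \<one> (MCar A) \<and>
     Mul A \<cdot> (Mul A \<boxtimes> Ide V (MCar A)) =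
       Mul A \<cdot> (Ide V (MCar A) \<boxtimes> Mul A) \<cdot> Assoc V (MCar A) (MCar A) (MCar A) \<and>
     Mul A \<cdot> (Uni A \<boxtimes> Ide V (MCar A)) = LUnit V (MCar A) \<and>
     Mul A \<cdot> (Ide V (MCar A) \<boxtimes> Uni A) = RUnit V (MCar A)"

definition monoid_hom :: "('o, 'm) mon \<Rightarrow> ('o, 'm) mon \<Rightarrow> 'm set" where
  "monoid_hom A A' = {f \<in> hom V (MCar A) (MCar A').
     f \<cdot> Mul A = Mul A' \<cdot> (f \<boxtimes> f) \<and> f \<cdot> Uni A = Uni A'}"

definition comonoid_in :: "('o, 'm) comon \<Rightarrow> bool" where
  "comonoid_in C \<longleftrightarrow> CCar C \<in> Obj V \<and>
     Comul C \<in> hom V (CCar C) (CCar C \<otimes> CCar C) \<and> Couni C \<in> hom V (CCar C) \<one> \<and>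
     Assoc V (CCar C) (CCar C) (CCar C) \<cdot> (Comul C \<boxtimes> Ide V (CCar C)) \<cdot> Comul C =
       (Ide V (CCar C) \<boxtimes> Comul C) \<cdot> Comul C \<and>
     LUnit V (CCar C) \<cdot> (Couni C \<boxtimes> Ide V (CCar C)) \<cdot> Comul C = Ide V (CCar C) \<and>
     RUnit V (CCar C) \<cdot> (Ide V (CCar C) \<boxtimes> Couni C) \<cdot> Comul C = Ide V (CCar C)"

definition comonoid_hom :: "('o, 'm) comon \<Rightarrow> ('o, 'm) comon \<Rightarrow> 'm set" where
  "comonoid_hom C C' = {f \<in> hom V (CCar C) (CCar C').
     Comul C' \<cdot> f = (f \<boxtimes> f) \<cdot> Comul C \<and> Couni C' \<cdot> f = Couni C}"

definition comodule_structures :: "('o, 'm) comon \<Rightarrow> 'o \<Rightarrow> 'm set" where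
  "comodule_structures P X = {\<rho> \<in> hom V X (X \<otimes> CCar P).
     Assoc V X (CCar P) (CCar P) \<cdot> (\<rho> \<boxtimes> Ide V (CCar P)) \<cdot> \<rho> =
       (Ide V X \<boxtimes> Comul P) \<cdot> \<rho> \<and>
     RUnit V X \<cdot> (Ide V X \<boxtimes> Couni P) \<cdot> \<rho> = Ide V X}"

text \<open>By the braiding, left duals and right duals coincide.\<close>

definition has_dual :: "'o \<Rightarrow> bool" where
  "has_dual X \<longleftrightarrow> (\<exists>Y \<in> Obj V. \<exists>d \<in> hom V (Y \<otimes> X) \<one>. \<exists>n \<in> hom V \<one> (X \<otimes> Y).
     RUnit V X \<cdot> (Ide V X \<boxtimes> d) \<cdot> Assoc V X Y X \<cdot> (n \<boxtimes> Ide V X) \<cdot> inverse_of V (LUnit V X)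
       = Ide V X \<and>
     LUnit V Y \<cdot> (d \<boxtimes> Ide V Y) \<cdot> inverse_of V (Assoc V Y X Y) \<cdot> (Ide V Y \<boxtimes> n) \<cdot>
       inverse_of V (RUnit V Y) = Ide V Y)"


subsection \<open>Convolution and the universal measuring comonoid\<close>

definition convolution :: "('o, 'm) comon \<Rightarrow> ('o, 'm) mon \<Rightarrow> ('o, 'm) mon" where
  "convolution C B = (let H = IHom V (CCar C) (MCar B); e = Ev V (CCar C) (MCar B) in
     \<lparr>MCar = H,
      Mul = curry_arrow (H \<otimes> H) (CCar C) (MCar B)
        (Mul B \<cdot> (e \<boxtimes> e) \<cdot> interchange H H (CCar C) (CCar C) \<cdot> (Ide V (H \<otimes> H) \<boxtimes> Comul C)),
      Uni = curry_arrow \<one> (CCar C) (MCar B) (Uni B \<cdot> Couni C \<cdot> LUnit V (CCar C))\<rparr>)"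

text \<open>
  \<open>P\<close> is a universal measuring comonoid \<open>P(A, B)\<close>, with \<open>\<Phi> C\<close> the natural bijection from
  comonoid morphisms \<open>C \<rightarrow> P\<close> to monoid morphisms \<open>A \<rightarrow> [C, B]\<close>.
\<close>

definition universal_measuring ::
  "('o, 'm) mon \<Rightarrow> ('o, 'm) mon \<Rightarrow> ('o, 'm) comon \<Rightarrow> (('o, 'm) comon \<Rightarrow> 'm \<Rightarrow> 'm) \<Rightarrow> bool" where
  "universal_measuring A B P \<Phi> \<longleftrightarrow> comonoid_in P \<and>
     (\<forall>C. comonoid_in C \<longrightarrow>
        bij_betw (\<Phi> C) (comonoid_hom C P) (monoid_hom A (convolution C B))) \<and>
     (\<forall>C C'. comonoid_in C \<longrightarrow> comonoid_in C' \<longrightarrow>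
        (\<forall>f \<in> comonoid_hom C P. \<forall>g \<in> comonoid_hom C' C.
           \<Phi> C' (f \<cdot> g) = precomp g (MCar B) \<cdot> \<Phi> C f))"

text \<open>The universal measuring \<open>A \<otimes> P(A, B) \<rightarrow> B\<close>.\<close>

definition measuring ::
  "('o, 'm) mon \<Rightarrow> ('o, 'm) comon \<Rightarrow> (('o, 'm) comon \<Rightarrow> 'm \<Rightarrow> 'm) \<Rightarrow> 'm" where
  "measuring B P \<Phi> =
     Ev V (CCar P) (MCar B) \<cdot> (\<Phi> P (Ide V (CCar P)) \<boxtimes> Ide V (CCar P))"


subsection \<open>The Kleisli category of \<open>- \<otimes> B\<close>\<close>

text \<open>An arrow \<open>X \<rightarrow> Y\<close> is a triple \<open>(X, f, Y)\<close> with \<open>f : X \<rightarrow> Y \<otimes> B\<close>.\<close>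

definition kleisli :: "('o, 'm) mon \<Rightarrow> ('o, 'o \<times> 'm \<times> 'o) cat" where
  "kleisli B = \<lparr>Obj = Obj V,
     Mor = {(X, f, Y). X \<in> Obj V \<and> Y \<in> Obj V \<and> f \<in> hom V X (Y \<otimes> MCar B)},
     Dom = (\<lambda>(X, f, Y). X),
     Cod = (\<lambda>(X, f, Y). Y),
     Ide = (\<lambda>X. (X, (Ide V X \<boxtimes> Uni B) \<cdot> inverse_of V (RUnit V X), X)),
     Cmp = (\<lambda>(Y', g, Z) (X, f, Y).
       (X, (Ide V Z \<boxtimes> Mul B) \<cdot> Assoc V Z (MCar B) (MCar B) \<cdot> (g \<boxtimes> Ide V (MCar B)) \<cdot> f, Z))\<rparr>"

text \<open>The identity-on-objects functor from \<open>V\<close> to the Kleisli category.\<close>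

definition kleisli_free :: "('o, 'm) mon \<Rightarrow> 'm \<Rightarrow> 'o \<times> 'm \<times> 'o" where
  "kleisli_free B f = (Dom V f,
     (Ide V (Cod V f) \<boxtimes> Uni B) \<cdot> inverse_of V (RUnit V (Cod V f)) \<cdot> f, Cod V f)"

definition kleisli_monad ::
  "('o, 'm) mon \<Rightarrow> ('o, 'm) mon \<Rightarrow> ('o, 'o \<times> 'm \<times> 'o) monad_data" where
  "kleisli_monad A B = \<lparr>
     TObj = (\<lambda>X. MCar A \<otimes> X),
     TMor = (\<lambda>(X, f, Y). (MCar A \<otimes> X,
       inverse_of V (Assoc V (MCar A) Y (MCar B)) \<cdot> (Ide V (MCar A) \<boxtimes> f), MCar A \<otimes> Y)),
     Eta = (\<lambda>X. kleisli_free B ((Uni A \<boxtimes> Ide V X) \<cdot> inverse_of V (LUnit V X))),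
     Mu = (\<lambda>X. kleisli_free B
       ((Mul A \<boxtimes> Ide V X) \<cdot> inverse_of V (Assoc V (MCar A) (MCar A) X)))\<rparr>"

text \<open>The morphisms \<open>\<psi> : A \<otimes> X \<rightarrow> X \<otimes> B\<close> of the explicit description.\<close>

definition twisted_actions :: "('o, 'm) mon \<Rightarrow> ('o, 'm) mon \<Rightarrow> 'o \<Rightarrow> 'm set" where
  "twisted_actions A B X = {\<psi> \<in> hom V (MCar A \<otimes> X) (X \<otimes> MCar B).
     (Ide V X \<boxtimes> Mul B) \<cdot> Assoc V X (MCar B) (MCar B) \<cdot> (\<psi> \<boxtimes> Ide V (MCar B)) \<cdot>
       inverse_of V (Assoc V (MCar A) X (MCar B)) \<cdot> (Ide V (MCar A) \<boxtimes> \<psi>) \<cdot>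
       Assoc V (MCar A) (MCar A) X
     = \<psi> \<cdot> (Mul A \<boxtimes> Ide V X) \<and>
     \<psi> \<cdot> (Uni A \<boxtimes> Ide V X) \<cdot> inverse_of V (LUnit V X) =
       (Ide V X \<boxtimes> Uni B) \<cdot> inverse_of V (RUnit V X)}"

text \<open>
  The enriched structure of the Kleisli category: the composition
  \<open>[Y, Z \<otimes> B] \<otimes> [X, Y \<otimes> B] \<rightarrow> [X, Z \<otimes> B]\<close> is the transpose of
  \<open>[Y, Z \<otimes> B] \<otimes> [X, Y \<otimes> B] \<otimes> X \<rightarrow> [Y, Z \<otimes> B] \<otimes> Y \<otimes> B \<rightarrow> Z \<otimes> B \<otimes> B \<rightarrow> Z \<otimes> B\<close>.
\<close>

definition kleisli_ihom :: "('o, 'm) mon \<Rightarrow> 'o \<Rightarrow> 'o \<Rightarrow> 'o" where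
  "kleisli_ihom B X Y = IHom V X (Y \<otimes> MCar B)"

definition kleisli_icomp :: "('o, 'm) mon \<Rightarrow> 'o \<Rightarrow> 'o \<Rightarrow> 'o \<Rightarrow> 'm" where
  "kleisli_icomp B X Y Z = (let H = kleisli_ihom B Y Z; K = kleisli_ihom B X Y in
     curry_arrow (H \<otimes> K) X (Z \<otimes> MCar B)
       ((Ide V Z \<boxtimes> Mul B) \<cdot> Assoc V Z (MCar B) (MCar B) \<cdot>
        (Ev V Y (Z \<otimes> MCar B) \<boxtimes> Ide V (MCar B)) \<cdot> inverse_of V (Assoc V H Y (MCar B)) \<cdot>
        (Ide V H \<boxtimes> Ev V X (Y \<otimes> MCar B)) \<cdot> Assoc V H K X))"

definition kleisli_iident :: "('o, 'm) mon \<Rightarrow> 'o \<Rightarrow> 'm" where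
  "kleisli_iident B X = curry_arrow \<one> X (X \<otimes> MCar B)
     ((Ide V X \<boxtimes> Uni B) \<cdot> inverse_of V (RUnit V X) \<cdot> LUnit V X)"

definition kleisli_endo :: "('o, 'm) mon \<Rightarrow> 'o \<Rightarrow> ('o, 'm) mon" where
  "kleisli_endo B X =
     \<lparr>MCar = kleisli_ihom B X X, Mul = kleisli_icomp B X X X, Uni = kleisli_iident B X\<rparr>"


subsection \<open>The category of right \<open>B\<close>-modules\<close>

text \<open>A module is a pair \<open>(M, m)\<close> with \<open>m : M \<otimes> B \<rightarrow> M\<close>.\<close>

definition right_module :: "('o, 'm) mon \<Rightarrow> 'o \<times> 'm \<Rightarrow> bool" where
  "right_module B = (\<lambda>(M, m). M \<in> Obj V \<and> m \<in> hom V (M \<otimes> MCar B) M \<and>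
     m \<cdot> (m \<boxtimes> Ide V (MCar B)) =
       m \<cdot> (Ide V M \<boxtimes> Mul B) \<cdot> Assoc V M (MCar B) (MCar B) \<and>
     m \<cdot> (Ide V M \<boxtimes> Uni B) = RUnit V M)"

definition modules ::
  "('o, 'm) mon \<Rightarrow> ('o \<times> 'm, ('o \<times> 'm) \<times> 'm \<times> ('o \<times> 'm)) cat" where
  "modules B = \<lparr>Obj = Collect (right_module B),
     Mor = {((M, m), f, (N, n)). right_module B (M, m) \<and> right_module B (N, n) \<and>
       f \<in> hom V M N \<and> f \<cdot> m = n \<cdot> (f \<boxtimes> Ide V (MCar B))},
     Dom = (\<lambda>(M, f, N). M),
     Cod = (\<lambda>(M, f, N). N),
     Ide = (\<lambda>M. (M, Ide V (fst M), M)),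
     Cmp = (\<lambda>(N', g, K) (M, f, N). (M, g \<cdot> f, K))\<rparr>"

definition free_module :: "('o, 'm) mon \<Rightarrow> 'o \<Rightarrow> 'o \<times> 'm" where
  "free_module B X =
     (X \<otimes> MCar B, (Ide V X \<boxtimes> Mul B) \<cdot> Assoc V X (MCar B) (MCar B))"

definition tensor_module :: "('o, 'm) mon \<Rightarrow> 'o \<Rightarrow> 'o \<times> 'm \<Rightarrow> 'o \<times> 'm" where
  "tensor_module B Y = (\<lambda>(M, m). (Y \<otimes> M, (Ide V Y \<boxtimes> m) \<cdot> Assoc V Y M (MCar B)))"

definition module_monad ::
  "('o, 'm) mon \<Rightarrow> ('o, 'm) mon \<Rightarrow> ('o \<times> 'm, ('o \<times> 'm) \<times> 'm \<times> ('o \<times> 'm)) monad_data" where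
  "module_monad A B = (let T = tensor_module B (MCar A) in \<lparr>
     TObj = T,
     TMor = (\<lambda>(M, f, N). (T M, Ide V (MCar A) \<boxtimes> f, T N)),
     Eta = (\<lambda>M. (M, (Uni A \<boxtimes> Ide V (fst M)) \<cdot> inverse_of V (LUnit V (fst M)), T M)),
     Mu = (\<lambda>M. (T (T M),
       (Mul A \<boxtimes> Ide V (fst M)) \<cdot> inverse_of V (Assoc V (MCar A) (MCar A) (fst M)), T M))\<rparr>)"

text \<open>
  The hom-object of modules \<open>(M, m)\<close> and \<open>(N, n)\<close>: an equaliser of \<open>[m, N]\<close> and
  \<open>[M, N] \<rightarrow> [M \<otimes> B, N \<otimes> B] \<rightarrow> [M \<otimes> B, N]\<close>, the second arrow being \<open>[M \<otimes> B, n]\<close>.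
\<close>

definition is_module_ihom :: "('o, 'm) mon \<Rightarrow> 'o \<times> 'm \<Rightarrow> 'o \<times> 'm \<Rightarrow> 'o \<Rightarrow> 'm \<Rightarrow> bool" where
  "is_module_ihom B = (\<lambda>(M, m) (N, n) E e.
     is_equaliser V E e
       (precomp m N)
       (curry_arrow (IHom V M N) (M \<otimes> MCar B) N
          (n \<cdot> (Ev V M N \<boxtimes> Ide V (MCar B)) \<cdot>
           inverse_of V (Assoc V (IHom V M N) M (MCar B)))))"

text \<open>Composition and identity of a module hom-object are those of \<open>[M, M]\<close>, factored through
  \<open>e\<close>.\<close>

definition module_endo :: "'o \<Rightarrow> 'o \<Rightarrow> 'm \<Rightarrow> ('o, 'm) mon" where
  "module_endo M E e = \<lparr>MCar = E,
     Mul = lift_through V e (icomp M M M \<cdot> (e \<boxtimes> e)),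
     Uni = lift_through V e (iident M)\<rparr>"


subsection \<open>The comparison maps\<close>

text \<open>The module morphism \<open>A \<otimes> (X \<otimes> B) \<rightarrow> X \<otimes> B\<close> extending \<open>\<psi> : A \<otimes> X \<rightarrow> X \<otimes> B\<close>.\<close>

definition extend_to_free :: "('o, 'm) mon \<Rightarrow> ('o, 'm) mon \<Rightarrow> 'o \<Rightarrow> 'm \<Rightarrow> 'm" where
  "extend_to_free A B X \<psi> = (Ide V X \<boxtimes> Mul B) \<cdot> Assoc V X (MCar B) (MCar B) \<cdot>
     (\<psi> \<boxtimes> Ide V (MCar B)) \<cdot> inverse_of V (Assoc V (MCar A) X (MCar B))"

text \<open>The composite \<open>A \<otimes> X \<rightarrow> A \<otimes> X \<otimes> P \<rightarrow> X \<otimes> A \<otimes> P \<rightarrow> X \<otimes> B\<close> of a coaction \<open>\<rho>\<close>, the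
  braiding and a measuring \<open>\<theta> : A \<otimes> P \<rightarrow> B\<close>.\<close>

definition coaction_to_twisted ::
  "('o, 'm) mon \<Rightarrow> ('o, 'm) comon \<Rightarrow> 'm \<Rightarrow> 'o \<Rightarrow> 'm \<Rightarrow> 'm" where
  "coaction_to_twisted A P \<theta> X \<rho> =
     (Ide V X \<boxtimes> \<theta>) \<cdot> Assoc V X (MCar A) (CCar P) \<cdot>
     (Braid V (MCar A) X \<boxtimes> Ide V (CCar P)) \<cdot>
     inverse_of V (Assoc V (MCar A) X (CCar P)) \<cdot> (Ide V (MCar A) \<boxtimes> \<rho>)"

end

end

theory Submission
  imports Defs
begin

text \<open>
  A morphism \<open>\<psi> : A \<otimes> X \<rightarrow> X \<otimes> B\<close> is the same as its transpose \<open>A \<rightarrow> [X, X \<otimes> B]\<close>, and the same as the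
  module morphism \<open>\<phi> : A \<otimes> (X \<otimes> B) \<rightarrow> X \<otimes> B\<close> extending it along the free module; restricting \<open>\<phi>\<close>
  along the unit of \<open>B\<close> recovers \<open>\<psi>\<close>. In each case the two axioms on \<open>\<psi>\<close> become the axioms of a
  monoid morphism or of an algebra.

  If \<open>X\<close> has a dual \<open>Y\<close>, then \<open>Y \<otimes> X\<close> is a comonoid. Its morphisms to \<open>P\<close> are the transposes of the
  \<open>P\<close>-coactions on \<open>X\<close>, while measurings \<open>A \<otimes> (Y \<otimes> X) \<rightarrow> B\<close> are the transposes of the twisted
  actions \<open>A \<otimes> X \<rightarrow> X \<otimes> B\<close>, so the universal property of \<open>P(A, B)\<close> at \<open>Y \<otimes> X\<close> links the two.

  Equations in the non-strict category \<open>V\<close> are reduced to strict ones by letting every arrow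
  \<open>f : X\<^sub>1 \<otimes> \<dots> \<otimes> X\<^sub>m \<rightarrow> Y\<^sub>1 \<otimes> \<dots> \<otimes> Y\<^sub>n\<close>, however bracketed, act on right-nested tensor products
  \<open>X\<^sub>1 \<otimes> (X\<^sub>2 \<otimes> \<dots> (X\<^sub>m \<otimes> Z))\<close>, naturally in \<open>Z\<close>. The associativity and unit isomorphisms act as
  identities, and the action is faithful.
\<close>

section \<open>Categories\<close>

text \<open>Most correspondences start from a bijection between full hom-sets (a transposition or a
  mate), and each axiom on one side is shown equivalent to one axiom on the other;
  \<open>bij_betw_restrict\<close> then cuts the bijection down. The exceptions concern modules,
  where only the linear arrows correspond and invertibility is checked directly on them. Although
  the tail \<one> alone recovers an arrow, the tail has to vary: a factor of a tensor product acts
  with everything to its right as its tail, so the interchange law becomes naturality in the tail.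
  Among the structural isomorphisms only the braiding does not act as an identity. The hexagons let
  it cross one factor at a time, and its triviality at \<one>, which is derived and not assumed,
  lets it cross the unit and counit of a duality. In (5) the required map is written with the
  measuring A \<otimes> P \<rightarrow> B, whereas the universal property only offers an abstract
  natural bijection; evaluating that bijection at the identity of P identifies the two.\<close>

lemma bij_betw_restrict:
  assumes "bij_betw f H K" "S \<subseteq> H" "T \<subseteq> K" "\<And>x. x \<in> H \<Longrightarrow> f x \<in> T \<longleftrightarrow> x \<in> S"
  shows "bij_betw f S T"
proof -
  have "f ` S = T"
    using assms(2-) bij_betw_imp_surj_on[OF assms(1)] by blast
  then show ?thesis
    using bij_betw_subset[OF assms(1,2)] by simp
qed

section \<open>Composition, inverses and equalisers\<close>

context category
begin

lemma hom_iff: "f \<in> hom C X Y \<longleftrightarrow> f \<in> Mor C \<and> Dom C f = X \<and> Cod C f = Y"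
  by (simp add: hom_def)

lemma Mor_Ide [simp]: "X \<in> Obj C \<Longrightarrow> Ide C X \<in> Mor C"
  and Dom_Ide [simp]: "X \<in> Obj C \<Longrightarrow> Dom C (Ide C X) = X"
  and Cod_Ide [simp]: "X \<in> Obj C \<Longrightarrow> Cod C (Ide C X) = X"
  using Ide_in by (auto simp: hom_iff)

text \<open>Typing is phrased with separate conditions on \<open>Mor\<close>, \<open>Dom\<close> and
  \<open>Cod\<close>: the simplifier can compute the domain of a composite, but could not guess the
  intermediate object of a \<open>hom\<close> premise.\<close>

lemma Mor_Cmp [simp]:
    "f \<in> Mor C \<Longrightarrow> g \<in> Mor C \<Longrightarrow> Dom C g = Cod C f \<Longrightarrow> g \<cdot> f \<in> Mor C"
  and Dom_Cmp [simp]: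
    "f \<in> Mor C \<Longrightarrow> g \<in> Mor C \<Longrightarrow> Dom C g = Cod C f \<Longrightarrow> Dom C (g \<cdot> f) = Dom C f"
  and Cod_Cmp [simp]:
    "f \<in> Mor C \<Longrightarrow> g \<in> Mor C \<Longrightarrow> Dom C g = Cod C f \<Longrightarrow> Cod C (g \<cdot> f) = Cod C g"
  using Cmp_in[of f "Dom C f" "Cod C f" g "Cod C g"] by (auto simp: hom_iff)

lemma Obj_Dom [simp]: "f \<in> Mor C \<Longrightarrow> Dom C f \<in> Obj C"
  and Obj_Cod [simp]: "f \<in> Mor C \<Longrightarrow> Cod C f \<in> Obj C"
  by (auto intro: Dom_in Cod_in)

lemma Cmp_Ide_right [simp]: "f \<in> Mor C \<Longrightarrow> Dom C f = X \<Longrightarrow> f \<cdot> Ide C X = f"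
  and Cmp_Ide_left [simp]: "f \<in> Mor C \<Longrightarrow> Cod C f = X \<Longrightarrow> Ide C X \<cdot> f = f"
  using Cmp_Ide Ide_Cmp by (auto simp: hom_iff)

lemma Cmp_Cmp [simp]:
  "f \<in> Mor C \<Longrightarrow> g \<in> Mor C \<Longrightarrow> h \<in> Mor C \<Longrightarrow> Dom C g = Cod C f \<Longrightarrow> Dom C h = Cod C g \<Longrightarrow>
    (h \<cdot> g) \<cdot> f = h \<cdot> (g \<cdot> f)"
  using Cmp_assoc by (auto simp: hom_iff)

text \<open>Composites are normalised to the right, so an equation for \<open>g \<cdot> f\<close> no
  longer matches inside a longer composite. This form, with a trailing \<open>w\<close>,
  does.\<close>

lemma Cmp_eq:
  assumes "g \<cdot> f = k" "f \<in> Mor C" "g \<in> Mor C" "Dom C g = Cod C f" "w \<in> Mor C" "Dom C f = Cod C w"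
  shows "g \<cdot> (f \<cdot> w) = k \<cdot> w"
  using assms Cmp_Cmp by metis

lemma is_inverse_unique:
  assumes "f \<in> Mor C" "is_inverse C f g" "is_inverse C f h"
  shows "g = h"
proof -
  have "g = g \<cdot> (f \<cdot> h)"
    using assms by (simp add: is_inverse_def hom_iff)
  also have "\<dots> = (g \<cdot> f) \<cdot> h"
    using assms by (subst Cmp_Cmp) (auto simp: is_inverse_def hom_iff)
  also have "\<dots> = h"
    using assms by (simp add: is_inverse_def hom_iff)
  finally show ?thesis .
qed

lemma is_inverse_inverse_of: "iso C f \<Longrightarrow> is_inverse C f (inverse_of C f)"
  unfolding iso_def inverse_of_def by (metis is_inverse_unique theI)

lemma Mor_inverse_of: "iso C f \<Longrightarrow> inverse_of C f \<in> Mor C"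
  and Dom_inverse_of: "iso C f \<Longrightarrow> Dom C (inverse_of C f) = Cod C f"
  and Cod_inverse_of: "iso C f \<Longrightarrow> Cod C (inverse_of C f) = Dom C f"
  and inverse_of_Cmp: "iso C f \<Longrightarrow> inverse_of C f \<cdot> f = Ide C (Dom C f)"
  and Cmp_inverse_of: "iso C f \<Longrightarrow> f \<cdot> inverse_of C f = Ide C (Cod C f)"
  using is_inverse_inverse_of[of f] by (auto simp: is_inverse_def hom_iff)

lemma iso_Cmp:
  assumes "iso C f" "iso C g" "Dom C g = Cod C f"
  shows "iso C (g \<cdot> f)"
proof -
  let ?f' = "inverse_of C f" and ?g' = "inverse_of C g"
  note [simp] = Mor_inverse_of Dom_inverse_of Cod_inverse_of inverse_of_Cmp Cmp_inverse_of
  have [simp]: "f \<in> Mor C" "g \<in> Mor C"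
    using assms by (simp_all add: iso_def)
  have "is_inverse C (g \<cdot> f) (?f' \<cdot> ?g')"
    using assms Cmp_eq[of ?g' g "Ide C (Cod C f)" f] Cmp_eq[of f ?f' "Ide C (Cod C f)" ?g']
    by (simp add: is_inverse_def hom_iff)
  then show ?thesis
    using assms by (auto simp: iso_def)
qed

lemma iso_Mor: "iso C f \<Longrightarrow> f \<in> Mor C"
  by (simp add: iso_def)

lemma iso_cancel_right:
  assumes "iso C f" "g \<in> Mor C" "h \<in> Mor C" "Dom C g = Cod C f" "Dom C h = Cod C f"
    and "g \<cdot> f = h \<cdot> f"
  shows "g = h"
proof -
  have "g \<cdot> (f \<cdot> inverse_of C f) = h \<cdot> (f \<cdot> inverse_of C f)"
    using assms by (metis Cmp_Cmp Cod_inverse_of Mor_inverse_of iso_Mor)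
  then show ?thesis
    using assms by (simp add: Cmp_inverse_of)
qed

lemma iso_cancel_left:
  assumes "iso C f" "g \<in> Mor C" "h \<in> Mor C" "Cod C g = Dom C f" "Cod C h = Dom C f"
    and "f \<cdot> g = f \<cdot> h"
  shows "g = h"
proof -
  have "(inverse_of C f \<cdot> f) \<cdot> g = (inverse_of C f \<cdot> f) \<cdot> h"
    using assms by (simp add: iso_Mor Mor_inverse_of Dom_inverse_of del: inverse_of_Cmp)
  then show ?thesis
    using assms by (simp add: inverse_of_Cmp)
qed

text \<open>Uniqueness in the equaliser property makes the \<open>THE\<close> meaningful.
  \<open>lift_through\<close> reads its source and target off \<open>Dom C h\<close> and
  \<open>Dom C e\<close>, so these are identified with \<open>W\<close> and
  \<open>E\<close>.\<close>

lemma lift_through: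
  assumes "is_equaliser C E e f g" "W \<in> Obj C" "h \<in> hom C W (Dom C f)" "f \<cdot> h = g \<cdot> h"
  shows "lift_through C e h \<in> hom C W E"
    and "e \<cdot> lift_through C e h = h"
proof -
  have "\<exists>!k. k \<in> hom C W E \<and> e \<cdot> k = h"
    using assms unfolding is_equaliser_def by blast
  moreover have "Dom C h = W" "Dom C e = E"
    using assms by (auto simp: is_equaliser_def hom_iff)
  ultimately have "lift_through C e h \<in> hom C W E \<and> e \<cdot> lift_through C e h = h"
    using theI'[of "\<lambda>k. k \<in> hom C W E \<and> e \<cdot> k = h"] by (simp add: lift_through_def)
  then show "lift_through C e h \<in> hom C W E" "e \<cdot> lift_through C e h = h"
    by auto
qed

lemma equaliser_Cmp:
  assumes "is_equaliser C E e f g" "k \<in> hom C W E" "f \<in> Mor C" "g \<in> Mor C" "Dom C g = Dom C f"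
  shows "f \<cdot> (e \<cdot> k) = g \<cdot> (e \<cdot> k)"
proof -
  have e: "e \<in> Mor C" "Dom C e = E" "Cod C e = Dom C f" "f \<cdot> e = g \<cdot> e"
    using assms by (auto simp: is_equaliser_def hom_iff)
  have k: "k \<in> Mor C" "Cod C k = E"
    using assms by (auto simp: hom_iff)
  have "(f \<cdot> e) \<cdot> k = (g \<cdot> e) \<cdot> k"
    using e by simp
  then show ?thesis
    using assms e(1-3) k by simp
qed

lemma equaliser_mono:
  assumes eq: "is_equaliser C E e f g" "k \<in> hom C W E" "k' \<in> hom C W E" "e \<cdot> k = e \<cdot> k'"
    and fg: "f \<in> Mor C" "g \<in> Mor C" "Dom C g = Dom C f"
  shows "k = k'"
proof -
  have "e \<in> hom C E (Dom C f)" "W \<in> Obj C"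
    using eq Dom_in by (auto simp: is_equaliser_def hom_iff)
  then have "e \<cdot> k \<in> hom C W (Dom C f)"
    using eq Cmp_in by blast
  then show ?thesis
    using eq equaliser_Cmp[OF eq(1,2) fg] \<open>W \<in> Obj C\<close> unfolding is_equaliser_def by metis
qed

end

section \<open>Coherence\<close>

text \<open>
  A tree is a bracketed tensor product. Since \<open>V\<close> need not have injective tensor products, a box
  carries the bracketings of its domain and codomain explicitly.
\<close>

datatype 'o tree = Leaf 'o  ("\<langle>_\<rangle>") | Nul | Node "'o tree" "'o tree"  (infixr "\<odot>" 70)

datatype ('o, 'm) diag =
    Box "'o tree" 'm "'o tree"
  | Id "'o tree"
  | Seq "('o, 'm) diag" "('o, 'm) diag"  (infixr "\<bullet>" 55)
  | Par "('o, 'm) diag" "('o, 'm) diag"  (infixr "\<parallel>" 70)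
  | Asc "'o tree" "'o tree" "'o tree"
  | AscI "'o tree" "'o tree" "'o tree"
  | LU "'o tree"
  | LUI "'o tree"
  | RU "'o tree"
  | RUI "'o tree"

primrec src :: "('o, 'm) diag \<Rightarrow> 'o tree" where
  "src (Box s f t) = s"
| "src (Id t) = t"
| "src (g \<bullet> f) = src f"
| "src (f \<parallel> g) = Node (src f) (src g)"
| "src (Asc s t u) = Node (Node s t) u"
| "src (AscI s t u) = Node s (Node t u)"
| "src (LU t) = Node Nul t"
| "src (LUI t) = t"
| "src (RU t) = Node t Nul"
| "src (RUI t) = t"

primrec tgt :: "('o, 'm) diag \<Rightarrow> 'o tree" where
  "tgt (Box s f t) = t"
| "tgt (Id t) = t"
| "tgt (g \<bullet> f) = tgt g"
| "tgt (f \<parallel> g) = Node (tgt f) (tgt g)"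
| "tgt (Asc s t u) = Node s (Node t u)"
| "tgt (AscI s t u) = Node (Node s t) u"
| "tgt (LU t) = t"
| "tgt (LUI t) = Node Nul t"
| "tgt (RU t) = t"
| "tgt (RUI t) = Node t Nul"

section \<open>Naturality and cancellation for the tensor product\<close>

context braided_monoidal_closed
begin

abbreviation "AssocI X Y Z \<equiv> inverse_of V (Assoc V X Y Z)"
abbreviation "LUnitI X \<equiv> inverse_of V (LUnit V X)"
abbreviation "RUnitI X \<equiv> inverse_of V (RUnit V X)"

lemmas [simp] = TensO_in Unit_in IHom_in

lemma TensM_simps [simp]:
  "f \<in> Mor V \<Longrightarrow> g \<in> Mor V \<Longrightarrow> f \<boxtimes> g \<in> Mor V"
  "f \<in> Mor V \<Longrightarrow> g \<in> Mor V \<Longrightarrow> Dom V (f \<boxtimes> g) = Dom V f \<otimes> Dom V g"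
  "f \<in> Mor V \<Longrightarrow> g \<in> Mor V \<Longrightarrow> Cod V (f \<boxtimes> g) = Cod V f \<otimes> Cod V g"
  using TensM_in[of f "Dom V f" "Cod V f" g "Dom V g" "Cod V g"] by (auto simp: hom_iff)

lemma Assoc_simps [simp]:
  assumes "X \<in> Obj V" "Y \<in> Obj V" "Z \<in> Obj V"
  shows "Assoc V X Y Z \<in> Mor V" "Dom V (Assoc V X Y Z) = (X \<otimes> Y) \<otimes> Z"
    "Cod V (Assoc V X Y Z) = X \<otimes> (Y \<otimes> Z)"
    "AssocI X Y Z \<in> Mor V" "Dom V (AssocI X Y Z) = X \<otimes> (Y \<otimes> Z)"
    "Cod V (AssocI X Y Z) = (X \<otimes> Y) \<otimes> Z"
    "Assoc V X Y Z \<cdot> AssocI X Y Z = Ide V (X \<otimes> (Y \<otimes> Z))"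
    "AssocI X Y Z \<cdot> Assoc V X Y Z = Ide V ((X \<otimes> Y) \<otimes> Z)"
  using assms Assoc_in[of X Y Z] Assoc_iso[of X Y Z]
  by (auto simp: hom_iff Mor_inverse_of Dom_inverse_of Cod_inverse_of inverse_of_Cmp Cmp_inverse_of)

lemma Unit_simps [simp]:
  assumes "X \<in> Obj V"
  shows "LUnit V X \<in> Mor V" "Dom V (LUnit V X) = \<one> \<otimes> X" "Cod V (LUnit V X) = X"
    "LUnitI X \<in> Mor V" "Dom V (LUnitI X) = X" "Cod V (LUnitI X) = \<one> \<otimes> X"
    "LUnit V X \<cdot> LUnitI X = Ide V X" "LUnitI X \<cdot> LUnit V X = Ide V (\<one> \<otimes> X)"
    "RUnit V X \<in> Mor V" "Dom V (RUnit V X) = X \<otimes> \<one>" "Cod V (RUnit V X) = X"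
    "RUnitI X \<in> Mor V" "Dom V (RUnitI X) = X" "Cod V (RUnitI X) = X \<otimes> \<one>"
    "RUnit V X \<cdot> RUnitI X = Ide V X" "RUnitI X \<cdot> RUnit V X = Ide V (X \<otimes> \<one>)"
  using assms LUnit_in[of X] LUnit_iso[of X] RUnit_in[of X] RUnit_iso[of X]
  by (auto simp: hom_iff Mor_inverse_of Dom_inverse_of Cod_inverse_of inverse_of_Cmp Cmp_inverse_of)

lemma Braid_simps [simp]:
  assumes "X \<in> Obj V" "Y \<in> Obj V"
  shows "Braid V X Y \<in> Mor V" "Dom V (Braid V X Y) = X \<otimes> Y" "Cod V (Braid V X Y) = Y \<otimes> X"
  using assms Braid_in[of X Y] by (auto simp: hom_iff)

lemma Ev_simps [simp]:
  assumes "X \<in> Obj V" "Y \<in> Obj V"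
  shows "Ev V X Y \<in> Mor V" "Dom V (Ev V X Y) = IHom V X Y \<otimes> X" "Cod V (Ev V X Y) = Y"
  using assms Ev_in[of X Y] by (auto simp: hom_iff)

lemma TensM_Cmp':
  assumes "f \<in> Mor V" "f' \<in> Mor V" "g \<in> Mor V" "g' \<in> Mor V"
    "Dom V f' = Cod V f" "Dom V g' = Cod V g"
  shows "(f' \<boxtimes> g') \<cdot> (f \<boxtimes> g) = (f' \<cdot> f) \<boxtimes> (g' \<cdot> g)"
  using assms TensM_Cmp[of f "Dom V f" "Cod V f" f' "Cod V f'" g "Dom V g" "Cod V g" g' "Cod V g'"]
  by (simp add: hom_iff)

text \<open>Whiskering by an object is functorial. Used left to right, this splits a whiskered
  composite into a chain that associativity can regroup; flipped, it collects the chain so that a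
  law for the unwhiskered composite applies.\<close>

lemma Ide_TensM_Cmp:
  assumes "f \<in> Mor V" "g \<in> Mor V" "Dom V g = Cod V f" "X \<in> Obj V"
  shows "Ide V X \<boxtimes> (g \<cdot> f) = (Ide V X \<boxtimes> g) \<cdot> (Ide V X \<boxtimes> f)"
    and "(g \<cdot> f) \<boxtimes> Ide V X = (g \<boxtimes> Ide V X) \<cdot> (f \<boxtimes> Ide V X)"
  using assms by (simp_all add: TensM_Cmp')

lemma TensM_Ide_Ide [simp]:
  "X \<in> Obj V \<Longrightarrow> Y \<in> Obj V \<Longrightarrow> Ide V X \<boxtimes> Ide V Y = Ide V (X \<otimes> Y)"
  by (rule TensM_Ide)

lemma Assoc_nat:
  assumes "f \<in> Mor V" "g \<in> Mor V" "h \<in> Mor V" "X = Cod V f" "Y = Cod V g" "Z = Cod V h"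
  shows "Assoc V X Y Z \<cdot> ((f \<boxtimes> g) \<boxtimes> h) =
    (f \<boxtimes> (g \<boxtimes> h)) \<cdot> Assoc V (Dom V f) (Dom V g) (Dom V h)"
  using assms Assoc_natural[of f "Dom V f" "Cod V f" g "Dom V g" "Cod V g" h "Dom V h" "Cod V h"]
  by (simp add: hom_iff)

lemma LUnit_nat: "f \<in> Mor V \<Longrightarrow> X = Cod V f \<Longrightarrow>
    LUnit V X \<cdot> (Ide V \<one> \<boxtimes> f) = f \<cdot> LUnit V (Dom V f)"
  and RUnit_nat: "f \<in> Mor V \<Longrightarrow> X = Cod V f \<Longrightarrow>
    RUnit V X \<cdot> (f \<boxtimes> Ide V \<one>) = f \<cdot> RUnit V (Dom V f)"
  using LUnit_natural[of f "Dom V f"] RUnit_natural[of f "Dom V f"] by (auto simp: hom_iff)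

lemma Braid_nat:
  assumes "f \<in> Mor V" "g \<in> Mor V" "X = Cod V f" "Y = Cod V g"
  shows "Braid V X Y \<cdot> (f \<boxtimes> g) = (g \<boxtimes> f) \<cdot> Braid V (Dom V f) (Dom V g)"
  using assms Braid_natural[of f "Dom V f" "Cod V f" g "Dom V g" "Cod V g"]
  by (simp add: hom_iff)

lemma iso_TensM_Ide:
  assumes "iso V f" "X \<in> Obj V"
  shows "iso V (f \<boxtimes> Ide V X)"
proof -
  have "is_inverse V (f \<boxtimes> Ide V X) (inverse_of V f \<boxtimes> Ide V X)"
    using assms unfolding is_inverse_def hom_iff
    by (simp add: iso_Mor TensM_Cmp' Mor_inverse_of Dom_inverse_of Cod_inverse_of
        inverse_of_Cmp Cmp_inverse_of)
  then show ?thesis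
    using assms by (auto simp: iso_def)
qed

text \<open>The unit constraints make tensoring with \<one> on either side naturally isomorphic to
  the identity functor, hence faithful.\<close>

lemma TensM_Ide_Unit_cancel:
  assumes f: "f \<in> Mor V" "g \<in> Mor V" "Dom V f = Dom V g" "Cod V f = Cod V g"
  shows "Ide V \<one> \<boxtimes> f = Ide V \<one> \<boxtimes> g \<Longrightarrow> f = g"
    and "f \<boxtimes> Ide V \<one> = g \<boxtimes> Ide V \<one> \<Longrightarrow> f = g"
proof -
  assume "Ide V \<one> \<boxtimes> f = Ide V \<one> \<boxtimes> g"
  then have "f \<cdot> LUnit V (Dom V f) = g \<cdot> LUnit V (Dom V g)"
    using f by (metis LUnit_nat)
  then show "f = g"
    using f by (intro iso_cancel_right[of "LUnit V (Dom V f)" f g]) (simp_all add: LUnit_iso)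
next
  assume "f \<boxtimes> Ide V \<one> = g \<boxtimes> Ide V \<one>"
  then have "f \<cdot> RUnit V (Dom V f) = g \<cdot> RUnit V (Dom V g)"
    using f by (metis RUnit_nat)
  then show "f = g"
    using f by (intro iso_cancel_right[of "RUnit V (Dom V f)" f g]) (simp_all add: RUnit_iso)
qed

text \<open>Kelly's argument: the pentagon and the triangle give the equation after tensoring with \<open>\<one>\<close>,
  which is faithful.\<close>

lemma LUnit_TensO:
  assumes X: "X \<in> Obj V" and Z: "Z \<in> Obj V"
  shows "LUnit V (X \<otimes> Z) \<cdot> Assoc V \<one> X Z = LUnit V X \<boxtimes> Ide V Z"
proof (rule TensM_Ide_Unit_cancel(1))
  let ?w = "Assoc V \<one> (\<one> \<otimes> X) Z \<cdot> (Assoc V \<one> \<one> X \<boxtimes> Ide V Z)"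
  have "(Ide V \<one> \<boxtimes> (LUnit V (X \<otimes> Z) \<cdot> Assoc V \<one> X Z)) \<cdot> ?w
      = (Ide V \<one> \<boxtimes> LUnit V (X \<otimes> Z)) \<cdot> Assoc V \<one> \<one> (X \<otimes> Z) \<cdot> Assoc V (\<one> \<otimes> \<one>) X Z"
    using X Z by (simp add: Ide_TensM_Cmp pentagon)
  also have "\<dots> = (RUnit V \<one> \<boxtimes> Ide V (X \<otimes> Z)) \<cdot> Assoc V (\<one> \<otimes> \<one>) X Z"
    using X Z by (simp add: Cmp_eq[OF triangle])
  also have "\<dots> = Assoc V \<one> X Z \<cdot> ((RUnit V \<one> \<boxtimes> Ide V X) \<boxtimes> Ide V Z)"
    using X Z by (simp add: Assoc_nat)
  also have "\<dots> = Assoc V \<one> X Z \<cdot> ((Ide V \<one> \<boxtimes> LUnit V X) \<boxtimes> Ide V Z) \<cdot> (Assoc V \<one> \<one> X \<boxtimes> Ide V Z)"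
    using X Z by (simp add: Ide_TensM_Cmp flip: triangle)
  also have "\<dots> = (Ide V \<one> \<boxtimes> (LUnit V X \<boxtimes> Ide V Z)) \<cdot> ?w"
    using X Z by (simp add: Cmp_eq[OF Assoc_nat])
  finally have "(Ide V \<one> \<boxtimes> (LUnit V (X \<otimes> Z) \<cdot> Assoc V \<one> X Z)) \<cdot> ?w = \<dots>" .
  moreover have "iso V ?w"
    using X Z by (simp add: iso_Cmp iso_TensM_Ide Assoc_iso)
  ultimately show "Ide V \<one> \<boxtimes> (LUnit V (X \<otimes> Z) \<cdot> Assoc V \<one> X Z) =
      Ide V \<one> \<boxtimes> (LUnit V X \<boxtimes> Ide V Z)"
    using X Z by (rule_tac iso_cancel_right[of ?w]) simp_all
qed (use X Z in simp_all)

section \<open>Flattening of bracketed tensor products\<close>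

primrec obj :: "'o tree \<Rightarrow> 'o" where
  "obj (Leaf X) = X"
| "obj Nul = \<one>"
| "obj (Node s t) = obj s \<otimes> obj t"

text \<open>
  \<open>stack t Z\<close> is the right-nested tensor product of the leaves of \<open>t\<close> and of \<open>Z\<close>, and \<open>flat t Z\<close> is the
  canonical isomorphism to it from \<open>obj t \<otimes> Z\<close>. Conjugating \<open>f \<otimes> Z\<close> by it gives \<open>hat s f t Z\<close>.
\<close>

primrec stack :: "'o tree \<Rightarrow> 'o \<Rightarrow> 'o" where
  "stack (Leaf X) = (\<lambda>Z. X \<otimes> Z)"
| "stack Nul = (\<lambda>Z. Z)"
| "stack (Node s t) = (\<lambda>Z. stack s (stack t Z))"

primrec stackM :: "'o tree \<Rightarrow> 'm \<Rightarrow> 'm" where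
  "stackM (Leaf X) = (\<lambda>h. Ide V X \<boxtimes> h)"
| "stackM Nul = (\<lambda>h. h)"
| "stackM (Node s t) = (\<lambda>h. stackM s (stackM t h))"

primrec flat :: "'o tree \<Rightarrow> 'o \<Rightarrow> 'm" where
  "flat (Leaf X) = (\<lambda>Z. Ide V (X \<otimes> Z))"
| "flat Nul = (\<lambda>Z. LUnit V Z)"
| "flat (Node s t) = (\<lambda>Z. flat s (stack t Z) \<cdot> (Ide V (obj s) \<boxtimes> flat t Z) \<cdot> Assoc V (obj s) (obj t) Z)"

definition hat :: "'o tree \<Rightarrow> 'm \<Rightarrow> 'o tree \<Rightarrow> 'o \<Rightarrow> 'm" where
  "hat s f t Z = flat t Z \<cdot> (f \<boxtimes> Ide V Z) \<cdot> inverse_of V (flat s Z)"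

primrec leaves_in :: "'o tree \<Rightarrow> bool" where
  "leaves_in (Leaf X) \<longleftrightarrow> X \<in> Obj V"
| "leaves_in Nul \<longleftrightarrow> True"
| "leaves_in (Node s t) \<longleftrightarrow> leaves_in s \<and> leaves_in t"

primrec well_typed :: "('o, 'm) diag \<Rightarrow> bool" where
  "well_typed (Box s f t) \<longleftrightarrow> leaves_in s \<and> leaves_in t \<and> f \<in> hom V (obj s) (obj t)"
| "well_typed (Id t) \<longleftrightarrow> leaves_in t"
| "well_typed (g \<bullet> f) \<longleftrightarrow> well_typed f \<and> well_typed g \<and> src g = tgt f"
| "well_typed (f \<parallel> g) \<longleftrightarrow> well_typed f \<and> well_typed g"
| "well_typed (Asc s t u) \<longleftrightarrow> leaves_in s \<and> leaves_in t \<and> leaves_in u"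
| "well_typed (AscI s t u) \<longleftrightarrow> leaves_in s \<and> leaves_in t \<and> leaves_in u"
| "well_typed (LU t) \<longleftrightarrow> leaves_in t"
| "well_typed (LUI t) \<longleftrightarrow> leaves_in t"
| "well_typed (RU t) \<longleftrightarrow> leaves_in t"
| "well_typed (RUI t) \<longleftrightarrow> leaves_in t"

primrec eval :: "('o, 'm) diag \<Rightarrow> 'm" where
  "eval (Box s f t) = f"
| "eval (Id t) = Ide V (obj t)"
| "eval (g \<bullet> f) = eval g \<cdot> eval f"
| "eval (f \<parallel> g) = eval f \<boxtimes> eval g"
| "eval (Asc s t u) = Assoc V (obj s) (obj t) (obj u)"
| "eval (AscI s t u) = AssocI (obj s) (obj t) (obj u)"
| "eval (LU t) = LUnit V (obj t)"
| "eval (LUI t) = LUnitI (obj t)"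
| "eval (RU t) = RUnit V (obj t)"
| "eval (RUI t) = RUnitI (obj t)"

text \<open>The strict semantics. For \<open>f \<parallel> g\<close> the right factor acts first,
  underneath the leaves of \<open>src f\<close>, and then \<open>f\<close> acts with
  \<open>tgt g\<close> in its tail; this is one of two orders that naturality in the tail
  identifies.\<close>

primrec interp :: "('o, 'm) diag \<Rightarrow> 'o \<Rightarrow> 'm" where
  "interp (Box s f t) = (\<lambda>Z. hat s f t Z)"
| "interp (Id t) = (\<lambda>Z. Ide V (stack t Z))"
| "interp (g \<bullet> f) = (\<lambda>Z. interp g Z \<cdot> interp f Z)"
| "interp (f \<parallel> g) = (\<lambda>Z. interp f (stack (tgt g) Z) \<cdot> stackM (src f) (interp g Z))"
| "interp (Asc s t u) = (\<lambda>Z. Ide V (stack s (stack t (stack u Z))))"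
| "interp (AscI s t u) = (\<lambda>Z. Ide V (stack s (stack t (stack u Z))))"
| "interp (LU t) = (\<lambda>Z. Ide V (stack t Z))"
| "interp (LUI t) = (\<lambda>Z. Ide V (stack t Z))"
| "interp (RU t) = (\<lambda>Z. Ide V (stack t Z))"
| "interp (RUI t) = (\<lambda>Z. Ide V (stack t Z))"

lemma obj_in [simp]: "leaves_in t \<Longrightarrow> obj t \<in> Obj V"
  by (induction t) auto

lemma stack_in [simp]: "leaves_in t \<Longrightarrow> Z \<in> Obj V \<Longrightarrow> stack t Z \<in> Obj V"
  by (induction t arbitrary: Z) auto

lemma stackM_simps [simp]:
  assumes "leaves_in t" "h \<in> Mor V"
  shows "stackM t h \<in> Mor V" "Dom V (stackM t h) = stack t (Dom V h)"
    "Cod V (stackM t h) = stack t (Cod V h)"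
  using assms by (induction t arbitrary: h) auto

lemma stackM_Ide [simp]: "leaves_in t \<Longrightarrow> Z \<in> Obj V \<Longrightarrow> stackM t (Ide V Z) = Ide V (stack t Z)"
  by (induction t arbitrary: Z) auto

lemma iso_Ide_TensM: "iso V f \<Longrightarrow> X \<in> Obj V \<Longrightarrow> iso V (Ide V X \<boxtimes> f)"
proof -
  assume *: "iso V f" "X \<in> Obj V"
  then have "is_inverse V (Ide V X \<boxtimes> f) (Ide V X \<boxtimes> inverse_of V f)"
    unfolding is_inverse_def hom_iff
    by (simp add: iso_Mor TensM_Cmp' Mor_inverse_of Dom_inverse_of Cod_inverse_of
        inverse_of_Cmp Cmp_inverse_of)
  then show ?thesis
    using * by (auto simp: iso_def)
qed

lemma iso_Ide: "X \<in> Obj V \<Longrightarrow> iso V (Ide V X)"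
  unfolding iso_def is_inverse_def hom_iff by (rule conjI, simp, rule exI[of _ "Ide V X"], simp)

lemma flat_props:
  "leaves_in t \<Longrightarrow> Z \<in> Obj V \<Longrightarrow>
    flat t Z \<in> Mor V \<and> Dom V (flat t Z) = obj t \<otimes> Z \<and> Cod V (flat t Z) = stack t Z \<and> iso V (flat t Z)"
  by (induction t arbitrary: Z)
    (simp_all add: iso_Ide LUnit_iso iso_Cmp iso_Ide_TensM Assoc_iso)

lemma flat_simps [simp]:
  assumes "leaves_in t" "Z \<in> Obj V"
  shows "flat t Z \<in> Mor V" "Dom V (flat t Z) = obj t \<otimes> Z" "Cod V (flat t Z) = stack t Z"
    "iso V (flat t Z)" "inverse_of V (flat t Z) \<in> Mor V"
    "Dom V (inverse_of V (flat t Z)) = stack t Z" "Cod V (inverse_of V (flat t Z)) = obj t \<otimes> Z"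
    "flat t Z \<cdot> inverse_of V (flat t Z) = Ide V (stack t Z)"
    "inverse_of V (flat t Z) \<cdot> flat t Z = Ide V (obj t \<otimes> Z)"
  using flat_props[OF assms]
  by (auto simp: Mor_inverse_of Dom_inverse_of Cod_inverse_of inverse_of_Cmp Cmp_inverse_of)

text \<open>At a node, \<open>Assoc_nat\<close> moves \<open>h\<close> past the rebracketing; then
  the induction hypotheses apply, for \<open>t\<close> to \<open>h\<close> and for \<open>s\<close>
  to \<open>stackM t h\<close>.\<close>

lemma flat_natural:
  "leaves_in t \<Longrightarrow> h \<in> Mor V \<Longrightarrow>
    flat t (Cod V h) \<cdot> (Ide V (obj t) \<boxtimes> h) = stackM t h \<cdot> flat t (Dom V h)"
proof (induction t arbitrary: h)
  case (Node s t)
  have "flat (Node s t) (Cod V h) \<cdot> (Ide V (obj (Node s t)) \<boxtimes> h)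
      = flat s (stack t (Cod V h)) \<cdot> (Ide V (obj s) \<boxtimes> flat t (Cod V h)) \<cdot>
          Assoc V (obj s) (obj t) (Cod V h) \<cdot> ((Ide V (obj s) \<boxtimes> Ide V (obj t)) \<boxtimes> h)"
    using Node.prems by simp
  also have "\<dots> = flat s (stack t (Cod V h)) \<cdot> (Ide V (obj s) \<boxtimes> flat t (Cod V h)) \<cdot>
          (Ide V (obj s) \<boxtimes> (Ide V (obj t) \<boxtimes> h)) \<cdot> Assoc V (obj s) (obj t) (Dom V h)"
    using Node.prems by (subst Assoc_nat) simp_all
  also have "\<dots> = flat s (stack t (Cod V h)) \<cdot> (Ide V (obj s) \<boxtimes> (stackM t h \<cdot> flat t (Dom V h))) \<cdot>
          Assoc V (obj s) (obj t) (Dom V h)"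
    using Node.prems by (simp add: Cmp_eq[OF TensM_Cmp'] Node.IH)
  also have "\<dots> = (flat s (Cod V (stackM t h)) \<cdot> (Ide V (obj s) \<boxtimes> stackM t h)) \<cdot>
          (Ide V (obj s) \<boxtimes> flat t (Dom V h)) \<cdot> Assoc V (obj s) (obj t) (Dom V h)"
    using Node.prems by (simp add: Ide_TensM_Cmp)
  also have "\<dots> = stackM (Node s t) h \<cdot> flat (Node s t) (Dom V h)"
    using Node.prems by (subst Node.IH) simp_all
  finally show ?case .
qed (simp_all add: LUnit_nat)

lemma hat_simps [simp]:
  assumes "leaves_in s" "leaves_in t" "f \<in> hom V (obj s) (obj t)" "Z \<in> Obj V"
  shows "hat s f t Z \<in> Mor V" "Dom V (hat s f t Z) = stack s Z" "Cod V (hat s f t Z) = stack t Z"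
  using assms by (simp_all add: hat_def hom_iff)

lemma hat_flat:
  assumes "leaves_in s" "leaves_in t" "f \<in> hom V (obj s) (obj t)" "Z \<in> Obj V"
  shows "hat s f t Z \<cdot> flat s Z = flat t Z \<cdot> (f \<boxtimes> Ide V Z)"
  using assms by (simp add: hat_def hom_iff)

lemma well_typed_props:
  "well_typed d \<Longrightarrow> leaves_in (src d) \<and> leaves_in (tgt d) \<and>
    eval d \<in> Mor V \<and> Dom V (eval d) = obj (src d) \<and> Cod V (eval d) = obj (tgt d)"
  by (induction d) (auto simp: hom_iff)

lemma well_typed_simps [simp]:
  assumes "well_typed d"
  shows "leaves_in (src d)" "leaves_in (tgt d)" "eval d \<in> Mor V"
    "Dom V (eval d) = obj (src d)" "Cod V (eval d) = obj (tgt d)"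
  using well_typed_props[OF assms] by auto

lemma interp_props:
  "well_typed d \<Longrightarrow> Z \<in> Obj V \<Longrightarrow> interp d Z \<in> Mor V \<and> Dom V (interp d Z) = stack (src d) Z \<and>
    Cod V (interp d Z) = stack (tgt d) Z"
  by (induction d arbitrary: Z) simp_all

lemma interp_simps [simp]:
  assumes "well_typed d" "Z \<in> Obj V"
  shows "interp d Z \<in> Mor V" "Dom V (interp d Z) = stack (src d) Z"
    "Cod V (interp d Z) = stack (tgt d) Z"
  using interp_props[OF assms] by auto

text \<open>This is the pentagon: rebracketing the leaves and then flattening is the same as
  flattening, so that the associator acts as an identity.\<close>

lemma flat_Assoc:
  assumes "leaves_in s" "leaves_in t" "leaves_in u" "Z \<in> Obj V"
  shows "flat (Node s (Node t u)) Z \<cdot> (Assoc V (obj s) (obj t) (obj u) \<boxtimes> Ide V Z) =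
    flat (Node (Node s t) u) Z"
proof -
  let ?S = "obj s" and ?T = "obj t" and ?U = "obj u" and ?W = "stack u Z"
  have "flat (Node s (Node t u)) Z \<cdot> (Assoc V ?S ?T ?U \<boxtimes> Ide V Z)
      = flat s (stack t ?W) \<cdot> (Ide V ?S \<boxtimes> flat t ?W) \<cdot> (Ide V ?S \<boxtimes> (Ide V ?T \<boxtimes> flat u Z)) \<cdot>
        (Ide V ?S \<boxtimes> Assoc V ?T ?U Z) \<cdot> Assoc V ?S (?T \<otimes> ?U) Z \<cdot> (Assoc V ?S ?T ?U \<boxtimes> Ide V Z)"
    using assms by (simp add: Ide_TensM_Cmp)
  also have "\<dots> = flat s (stack t ?W) \<cdot> (Ide V ?S \<boxtimes> flat t ?W) \<cdot> (Ide V ?S \<boxtimes> (Ide V ?T \<boxtimes> flat u Z)) \<cdot>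
        Assoc V ?S ?T (?U \<otimes> Z) \<cdot> Assoc V (?S \<otimes> ?T) ?U Z"
    using assms by (simp add: pentagon)
  also have "\<dots> = flat s (stack t ?W) \<cdot> (Ide V ?S \<boxtimes> flat t ?W) \<cdot>
        ((Ide V ?S \<boxtimes> (Ide V ?T \<boxtimes> flat u Z)) \<cdot> Assoc V ?S ?T (?U \<otimes> Z)) \<cdot> Assoc V (?S \<otimes> ?T) ?U Z"
    using assms by simp
  also have "\<dots> = flat s (stack t ?W) \<cdot> (Ide V ?S \<boxtimes> flat t ?W) \<cdot>
        (Assoc V ?S ?T ?W \<cdot> (Ide V (?S \<otimes> ?T) \<boxtimes> flat u Z)) \<cdot> Assoc V (?S \<otimes> ?T) ?U Z"
    using assms Assoc_nat[of "Ide V ?S" "Ide V ?T" "flat u Z" ?S ?T ?W] by simp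
  also have "\<dots> = flat (Node (Node s t) u) Z"
    using assms by simp
  finally show ?thesis .
qed

text \<open>Kelly's equation \<open>LUnit_TensO\<close> is what makes the left unitor disappear
  here; the rest is its naturality.\<close>

lemma flat_LUnit:
  assumes "leaves_in t" "Z \<in> Obj V"
  shows "flat t Z \<cdot> (LUnit V (obj t) \<boxtimes> Ide V Z) = flat (Node Nul t) Z"
proof -
  have "flat t Z \<cdot> (LUnit V (obj t) \<boxtimes> Ide V Z) =
      (flat t Z \<cdot> LUnit V (obj t \<otimes> Z)) \<cdot> Assoc V \<one> (obj t) Z"
    using assms by (simp add: LUnit_TensO)
  also have "flat t Z \<cdot> LUnit V (obj t \<otimes> Z) = LUnit V (stack t Z) \<cdot> (Ide V \<one> \<boxtimes> flat t Z)"
    using assms LUnit_nat[of "flat t Z"] by simp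
  finally show ?thesis
    using assms by simp
qed

text \<open>The counterpart for the right unitor is the triangle axiom itself.\<close>

lemma flat_RUnit:
  assumes "leaves_in t" "Z \<in> Obj V"
  shows "flat t Z \<cdot> (RUnit V (obj t) \<boxtimes> Ide V Z) = flat (Node t Nul) Z"
  using assms triangle[of "obj t" Z] by simp

text \<open>Spares separate coherence arguments for the inverse constraints \<open>AscI\<close>,
  \<open>LUI\<close> and \<open>RUI\<close>.\<close>

lemma flat_inverse:
  assumes "iso V f" "leaves_in t" "Z \<in> Obj V"
    and eq: "flat t Z \<cdot> (f \<boxtimes> Ide V Z) = flat s Z" and "Cod V f = obj t"
  shows "flat s Z \<cdot> (inverse_of V f \<boxtimes> Ide V Z) = flat t Z"
proof -
  have "flat s Z \<cdot> (inverse_of V f \<boxtimes> Ide V Z) =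
      flat t Z \<cdot> (f \<boxtimes> Ide V Z) \<cdot> (inverse_of V f \<boxtimes> Ide V Z)"
    using assms(1-3,5) by (simp add: iso_Mor Mor_inverse_of Cod_inverse_of flip: eq)
  also have "\<dots> = flat t Z"
    using assms by (simp add: TensM_Cmp' iso_Mor Mor_inverse_of Cod_inverse_of Dom_inverse_of Cmp_inverse_of)
  finally show ?thesis .
qed

text \<open>The two semantics agree up to flattening. The cases of the constraints are the coherence
  lemmas above, and only the parallel composite needs work.\<close>

lemma interp_flat:
  "well_typed d \<Longrightarrow> Z \<in> Obj V \<Longrightarrow>
    interp d Z \<cdot> flat (src d) Z = flat (tgt d) Z \<cdot> (eval d \<boxtimes> Ide V Z)"
proof (induction d arbitrary: Z)
  case (Box s f t)
  then show ?case
    by (simp add: hat_flat)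
next
  case (Seq g f)
  have "interp (g \<bullet> f) Z \<cdot> flat (src f) Z = interp g Z \<cdot> (flat (tgt f) Z \<cdot> (eval f \<boxtimes> Ide V Z))"
    using Seq.prems by (simp add: Seq.IH)
  also have "\<dots> = (interp g Z \<cdot> flat (src g) Z) \<cdot> (eval f \<boxtimes> Ide V Z)"
    using Seq.prems by simp
  also have "\<dots> = flat (tgt g) Z \<cdot> (eval (g \<bullet> f) \<boxtimes> Ide V Z)"
    using Seq.prems by (subst Seq.IH) (simp_all add: Ide_TensM_Cmp)
  finally show ?case
    by simp
next
  case (Par f g)
  let ?S = "obj (src f)" and ?S' = "obj (tgt f)" and ?T = "obj (src g)" and ?T' = "obj (tgt g)"
    and ?W = "stack (tgt g) Z"
  \<comment> \<open>\<open>flat_natural\<close> carries the action of \<open>g\<close> past the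
    flattening of \<open>src f\<close>. Now both induction hypotheses apply, and
    \<open>Assoc_nat\<close> finally moves the associator to the other side.\<close>
  have "interp (f \<parallel> g) Z \<cdot> flat (src (f \<parallel> g)) Z = interp f ?W \<cdot>
      (stackM (src f) (interp g Z) \<cdot> flat (src f) (stack (src g) Z)) \<cdot> (Ide V ?S \<boxtimes> flat (src g) Z) \<cdot>
      Assoc V ?S ?T Z"
    using Par.prems by simp
  also have "stackM (src f) (interp g Z) \<cdot> flat (src f) (stack (src g) Z) =
      flat (src f) ?W \<cdot> (Ide V ?S \<boxtimes> interp g Z)"
    using Par.prems flat_natural[of "src f" "interp g Z"] by simp
  also have "interp f ?W \<cdot> (flat (src f) ?W \<cdot> (Ide V ?S \<boxtimes> interp g Z)) \<cdot>
        (Ide V ?S \<boxtimes> flat (src g) Z) \<cdot> Assoc V ?S ?T Z =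
      (interp f ?W \<cdot> flat (src f) ?W) \<cdot> (Ide V ?S \<boxtimes> (interp g Z \<cdot> flat (src g) Z)) \<cdot> Assoc V ?S ?T Z"
    using Par.prems by (simp add: Ide_TensM_Cmp)
  also have "\<dots> = (flat (tgt f) ?W \<cdot> (eval f \<boxtimes> Ide V ?W)) \<cdot>
      (Ide V ?S \<boxtimes> (flat (tgt g) Z \<cdot> (eval g \<boxtimes> Ide V Z))) \<cdot> Assoc V ?S ?T Z"
    using Par.prems by (simp only: Par.IH well_typed_simps stack_in well_typed.simps)
  also have "\<dots> = flat (tgt f) ?W \<cdot> (eval f \<boxtimes> (flat (tgt g) Z \<cdot> (eval g \<boxtimes> Ide V Z))) \<cdot> Assoc V ?S ?T Z"
    using Par.prems by (simp add: Cmp_eq[OF TensM_Cmp'])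
  also have "eval f \<boxtimes> (flat (tgt g) Z \<cdot> (eval g \<boxtimes> Ide V Z)) =
      (Ide V ?S' \<boxtimes> flat (tgt g) Z) \<cdot> (eval f \<boxtimes> (eval g \<boxtimes> Ide V Z))"
    using Par.prems by (simp add: TensM_Cmp')
  also have "flat (tgt f) ?W \<cdot> ((Ide V ?S' \<boxtimes> flat (tgt g) Z) \<cdot> (eval f \<boxtimes> (eval g \<boxtimes> Ide V Z))) \<cdot>
        Assoc V ?S ?T Z =
      flat (tgt f) ?W \<cdot> (Ide V ?S' \<boxtimes> flat (tgt g) Z) \<cdot> ((eval f \<boxtimes> (eval g \<boxtimes> Ide V Z)) \<cdot> Assoc V ?S ?T Z)"
    using Par.prems by simp
  also have "(eval f \<boxtimes> (eval g \<boxtimes> Ide V Z)) \<cdot> Assoc V ?S ?T Z =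
      Assoc V ?S' ?T' Z \<cdot> ((eval f \<boxtimes> eval g) \<boxtimes> Ide V Z)"
    using Par.prems Assoc_nat[of "eval f" "eval g" "Ide V Z"] by simp
  finally show ?case
    using Par.prems by simp
next
  case (Asc s t u)
  then show ?case
    using flat_Assoc[of s t u Z] by simp
next
  case (AscI s t u)
  then show ?case
    using flat_inverse[OF Assoc_iso _ _ flat_Assoc[of s t u Z]] by simp
next
  case (LU t)
  then show ?case
    using flat_LUnit[of t Z] by simp
next
  case (LUI t)
  then show ?case
    using flat_inverse[OF LUnit_iso _ _ flat_LUnit[of t Z]] by simp
next
  case (RU t)
  then show ?case
    using flat_RUnit[of t Z] by simp
next
  case (RUI t)
  then show ?case
    using flat_inverse[OF RUnit_iso _ _ flat_RUnit[of t Z]] by simp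
qed auto

text \<open>Flattening is invertible, so by \<open>interp_flat\<close> each semantics can be
  cancelled against the other. From strict to actual equations the single tail \<one> suffices,
  since tensoring with \<one> is faithful.\<close>

theorem eval_eq_iff:
  assumes "well_typed d" "well_typed e" "src d = src e" "tgt d = tgt e"
  shows "eval d = eval e \<longleftrightarrow> (\<forall>Z \<in> Obj V. interp d Z = interp e Z)"
proof
  assume *: "eval d = eval e"
  show "\<forall>Z \<in> Obj V. interp d Z = interp e Z"
  proof
    fix Z assume Z: "Z \<in> Obj V"
    have "interp d Z \<cdot> flat (src d) Z = interp e Z \<cdot> flat (src d) Z"
      using interp_flat[OF assms(1) Z] interp_flat[OF assms(2) Z] * assms(3,4) by simp
    then show "interp d Z = interp e Z"
      by (rule iso_cancel_right[rotated -1]) (use assms Z in simp_all)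
  qed
next
  assume *: "\<forall>Z \<in> Obj V. interp d Z = interp e Z"
  have "flat (tgt d) \<one> \<cdot> (eval d \<boxtimes> Ide V \<one>) = flat (tgt d) \<one> \<cdot> (eval e \<boxtimes> Ide V \<one>)"
    using interp_flat[OF assms(1) Unit_in] interp_flat[OF assms(2) Unit_in] * assms(3,4) by simp
  then have "eval d \<boxtimes> Ide V \<one> = eval e \<boxtimes> Ide V \<one>"
    by (rule iso_cancel_left[rotated -1]) (use assms in simp_all)
  then show "eval d = eval e"
    by (rule TensM_Ide_Unit_cancel(2)[rotated -1]) (use assms in simp_all)
qed

text \<open>The interchange law in the strict picture: an arrow on the front factors commutes with
  an arrow on the tail. Nearly every manipulation of strict composites below is an instance.\<close>

lemma hat_natural:
  assumes s: "leaves_in s" and t: "leaves_in t" and f: "f \<in> hom V (obj s) (obj t)" and h: "h \<in> Mor V"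
  shows "hat s f t (Cod V h) \<cdot> stackM s h = stackM t h \<cdot> hat s f t (Dom V h)"
proof -
  have "(hat s f t (Cod V h) \<cdot> stackM s h) \<cdot> flat s (Dom V h) =
      hat s f t (Cod V h) \<cdot> (flat s (Cod V h) \<cdot> (Ide V (obj s) \<boxtimes> h))"
    using assms by (simp add: flat_natural)
  also have "\<dots> = (hat s f t (Cod V h) \<cdot> flat s (Cod V h)) \<cdot> (Ide V (obj s) \<boxtimes> h)"
    using assms by simp
  also have "\<dots> = flat t (Cod V h) \<cdot> (f \<boxtimes> Ide V (Cod V h)) \<cdot> (Ide V (obj s) \<boxtimes> h)"
    using assms by (subst hat_flat) (simp_all add: hom_iff)
  also have "\<dots> = (flat t (Cod V h) \<cdot> (Ide V (obj t) \<boxtimes> h)) \<cdot> (f \<boxtimes> Ide V (Dom V h))"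
    using assms by (simp add: hom_iff TensM_Cmp')
  also have "\<dots> = stackM t h \<cdot> (hat s f t (Dom V h) \<cdot> flat s (Dom V h))"
    using assms by (simp add: hom_iff hat_flat flat_natural)
  finally have "(hat s f t (Cod V h) \<cdot> stackM s h) \<cdot> flat s (Dom V h) =
      (stackM t h \<cdot> hat s f t (Dom V h)) \<cdot> flat s (Dom V h)"
    using assms by simp
  then show ?thesis
    by (rule iso_cancel_right[rotated -1]) (use assms in simp_all)
qed

text \<open>Computes the strict action of a composite arrow: any diagram that evaluates to
  \<open>f\<close> with the same boundary trees gives the same action.\<close>

lemma hat_eqI:
  assumes "well_typed d" "src d = s" "tgt d = t" "eval d = f" "Z \<in> Obj V"
  shows "hat s f t Z = interp d Z"
proof -
  have "eval (Box s f t) = eval d"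
    using assms by simp
  then have "\<forall>Z\<in>Obj V. interp (Box s f t) Z = interp d Z"
    by (subst (asm) eval_eq_iff) (use assms in \<open>auto simp: hom_iff\<close>)
  then show ?thesis
    using assms by simp
qed

section \<open>The braiding on flattened tensor products\<close>

definition braid_hat :: "'o tree \<Rightarrow> 'o tree \<Rightarrow> 'o \<Rightarrow> 'm" where
  "braid_hat s t Z = hat (s \<odot> t) (Braid V (obj s) (obj t)) (t \<odot> s) Z"

lemma braid_hat_simps [simp]:
  assumes "leaves_in s" "leaves_in t" "Z \<in> Obj V"
  shows "braid_hat s t Z \<in> Mor V" "Dom V (braid_hat s t Z) = stack s (stack t Z)"
    "Cod V (braid_hat s t Z) = stack t (stack s Z)"
  using assms by (simp_all add: braid_hat_def Braid_in)

lemma braid_hat_natural: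
  assumes "leaves_in s" "leaves_in t" "h \<in> Mor V"
  shows "braid_hat s t (Cod V h) \<cdot> stackM s (stackM t h) = stackM t (stackM s h) \<cdot> braid_hat s t (Dom V h)"
  using assms hat_natural[of "s \<odot> t" "t \<odot> s" "Braid V (obj s) (obj t)" h]
  by (simp add: braid_hat_def Braid_in)

text \<open>Naturality in the two braided factors, as opposed to naturality in the tail.\<close>

lemma braid_hat_hat:
  assumes "leaves_in s" "leaves_in s'" "leaves_in t" "leaves_in t'" "Z \<in> Obj V"
    and f: "f \<in> hom V (obj s) (obj s')" and g: "g \<in> hom V (obj t) (obj t')"
  shows "braid_hat s' t' Z \<cdot> hat s f s' (stack t' Z) \<cdot> stackM s (hat t g t' Z) =
    hat t g t' (stack s' Z) \<cdot> stackM t (hat s f s' Z) \<cdot> braid_hat s t Z"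
proof -
  let ?c = "\<lambda>s t. Box (s \<odot> t) (Braid V (obj s) (obj t)) (t \<odot> s)"
  have "eval (?c s' t' \<bullet> (Box s f s' \<parallel> Box t g t')) = eval ((Box t g t' \<parallel> Box s f s') \<bullet> ?c s t)"
    using assms by (simp add: Braid_nat hom_iff)
  then have "interp (?c s' t' \<bullet> (Box s f s' \<parallel> Box t g t')) Z =
      interp ((Box t g t' \<parallel> Box s f s') \<bullet> ?c s t) Z"
    by (subst (asm) eval_eq_iff) (use assms in \<open>auto simp: Braid_in\<close>)
  then show ?thesis
    using assms by (simp add: braid_hat_def Braid_in)
qed

text \<open>The first hexagon without its associators: \<open>s\<close> crosses
  \<open>t \<odot> u\<close> one factor at a time, \<open>t\<close> first.\<close>

lemma braid_hat_Node_right: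
  assumes "leaves_in s" "leaves_in t" "leaves_in u" "Z \<in> Obj V"
  shows "braid_hat s (t \<odot> u) Z = stackM t (braid_hat s u Z) \<cdot> braid_hat s t (stack u Z)"
proof -
  let ?c = "\<lambda>s t. Box (s \<odot> t) (Braid V (obj s) (obj t)) (t \<odot> s)"
  have "eval (Asc t u s \<bullet> ?c s (t \<odot> u) \<bullet> Asc s t u) =
      eval ((Id t \<parallel> ?c s u) \<bullet> Asc t s u \<bullet> (?c s t \<parallel> Id u))"
    using assms by (simp add: hexagon1)
  then have "interp (Asc t u s \<bullet> ?c s (t \<odot> u) \<bullet> Asc s t u) Z =
      interp ((Id t \<parallel> ?c s u) \<bullet> Asc t s u \<bullet> (?c s t \<parallel> Id u)) Z"
    by (subst (asm) eval_eq_iff) (use assms in \<open>auto simp: Braid_in\<close>)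
  then show ?thesis
    using assms by (simp add: braid_hat_def Braid_in)
qed

text \<open>The second hexagon likewise: of the two factors of \<open>s \<odot> t\<close>, the one
  nearer to \<open>u\<close> crosses first.\<close>

lemma braid_hat_Node_left:
  assumes "leaves_in s" "leaves_in t" "leaves_in u" "Z \<in> Obj V"
  shows "braid_hat (s \<odot> t) u Z = braid_hat s u (stack t Z) \<cdot> stackM s (braid_hat t u Z)"
proof -
  let ?c = "\<lambda>s t. Box (s \<odot> t) (Braid V (obj s) (obj t)) (t \<odot> s)"
  have "eval (AscI u s t \<bullet> ?c (s \<odot> t) u \<bullet> AscI s t u) =
      eval ((?c s u \<parallel> Id t) \<bullet> AscI s u t \<bullet> (Id s \<parallel> ?c t u))"
    using assms by (simp add: hexagon2)
  then have "interp (AscI u s t \<bullet> ?c (s \<odot> t) u \<bullet> AscI s t u) Z =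
      interp ((?c s u \<parallel> Id t) \<bullet> AscI s u t \<bullet> (Id s \<parallel> ?c t u)) Z"
    by (subst (asm) eval_eq_iff) (use assms in \<open>auto simp: Braid_in\<close>)
  then show ?thesis
    using assms by (simp add: braid_hat_def Braid_in)
qed

lemma iso_hat:
  assumes "leaves_in s" "leaves_in t" "f \<in> hom V (obj s) (obj t)" "iso V f" "Z \<in> Obj V"
  shows "iso V (hat s f t Z)"
proof -
  have "is_inverse V (inverse_of V (flat s Z)) (flat s Z)"
    using assms by (simp add: is_inverse_def hom_iff)
  then have "iso V (inverse_of V (flat s Z))"
    using assms by (auto simp: iso_def)
  then show ?thesis
    using assms by (simp add: hat_def hom_iff iso_Cmp iso_TensM_Ide)
qed

lemma iso_idem:
  assumes "iso V f" "Cod V f = Dom V f" "f \<cdot> f = f"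
  shows "f = Ide V (Dom V f)"
  by (rule iso_cancel_left[OF assms(1)]) (use assms in \<open>simp_all add: iso_Mor\<close>)

lemma hat_LUnit_Unit: "Z \<in> Obj V \<Longrightarrow> hat (Nul \<odot> Nul) (LUnit V \<one>) Nul Z = Ide V Z"
  using hat_eqI[of "LU Nul"] by simp

text \<open>By the hexagon and naturality along \<open>\<one> \<otimes> \<one> \<cong> \<one>\<close> the braiding with \<open>\<one>\<close> is idempotent; being
  invertible, it is trivial.\<close>

lemma braid_hat_Nul_right [simp]:
  assumes "leaves_in s" "Z \<in> Obj V"
  shows "braid_hat s Nul Z = Ide V (stack s Z)"
proof -
  have "braid_hat s Nul Z = braid_hat s (Nul \<odot> Nul) Z"
    using assms braid_hat_hat[of s s "Nul \<odot> Nul" Nul Z "Ide V (obj s)" "LUnit V \<one>"]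
      hat_eqI[of "Id s" s s "Ide V (obj s)"] by (simp add: LUnit_in Ide_in hat_LUnit_Unit)
  also have "\<dots> = braid_hat s Nul Z \<cdot> braid_hat s Nul Z"
    using assms by (simp add: braid_hat_Node_right)
  finally show ?thesis
    using assms iso_idem[of "braid_hat s Nul Z"] iso_hat[of "s \<odot> Nul" "Nul \<odot> s"]
    by (simp add: braid_hat_def Braid_in Braid_iso)
qed

lemma braid_hat_Nul_left [simp]:
  assumes "leaves_in s" "Z \<in> Obj V"
  shows "braid_hat Nul s Z = Ide V (stack s Z)"
proof -
  have "braid_hat Nul s Z = braid_hat (Nul \<odot> Nul) s Z"
    using assms braid_hat_hat[of "Nul \<odot> Nul" Nul s s Z "LUnit V \<one>" "Ide V (obj s)"]
      hat_eqI[of "Id s" s s "Ide V (obj s)"] by (simp add: LUnit_in Ide_in hat_LUnit_Unit)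
  also have "\<dots> = braid_hat Nul s Z \<cdot> braid_hat Nul s Z"
    using assms by (simp add: braid_hat_Node_left)
  finally show ?thesis
    using assms iso_idem[of "braid_hat Nul s Z"] iso_hat[of "Nul \<odot> s" "s \<odot> Nul"]
    by (simp add: braid_hat_def Braid_in Braid_iso)
qed

abbreviation "braid_box s t \<equiv> Box (s \<odot> t) (Braid V (obj s) (obj t)) (t \<odot> s)"

lemma hat_Ide:
  assumes "leaves_in s" "Z \<in> Obj V"
  shows "hat s (Ide V (obj s)) s Z = Ide V (stack s Z)"
  using assms hat_eqI[of "Id s" s s "Ide V (obj s)" Z] by simp

lemma braid_hat_left:
  assumes "leaves_in s" "leaves_in s'" "leaves_in t" "Z \<in> Obj V" "f \<in> hom V (obj s) (obj s')"
  shows "braid_hat s' t Z \<cdot> hat s f s' (stack t Z) = stackM t (hat s f s' Z) \<cdot> braid_hat s t Z"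
  using assms braid_hat_hat[of s s' t t Z f "Ide V (obj t)"] by (simp add: Ide_in hat_Ide)

lemma braid_hat_right:
  assumes "leaves_in s" "leaves_in t" "leaves_in t'" "Z \<in> Obj V" "g \<in> hom V (obj t) (obj t')"
  shows "braid_hat s t' Z \<cdot> stackM s (hat t g t' Z) = hat t g t' (stack s Z) \<cdot> braid_hat s t Z"
  using assms braid_hat_hat[of s s t t' Z "Ide V (obj s)" g] by (simp add: Ide_in hat_Ide)

lemma interp_eqI:
  assumes "eval d = eval e" "well_typed d" "well_typed e" "src d = src e" "tgt d = tgt e" "Z \<in> Obj V"
  shows "interp d Z = interp e Z"
  using assms eval_eq_iff by blast

end

section \<open>The Kleisli category\<close>

context braided_monoidal_closed
begin

section \<open>Monoids and twisted actions on flattened tensor products\<close>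

definition mul_hat :: "('o, 'm) mon \<Rightarrow> 'o \<Rightarrow> 'm" where
  "mul_hat A Z = hat (\<langle>MCar A\<rangle> \<odot> \<langle>MCar A\<rangle>) (Mul A) \<langle>MCar A\<rangle> Z"

definition uni_hat :: "('o, 'm) mon \<Rightarrow> 'o \<Rightarrow> 'm" where
  "uni_hat A Z = hat Nul (Uni A) \<langle>MCar A\<rangle> Z"

lemma monoid_in_simps [simp]:
  assumes "monoid_in V A"
  shows "MCar A \<in> Obj V" "Mul A \<in> hom V (MCar A \<otimes> MCar A) (MCar A)" "Uni A \<in> hom V \<one> (MCar A)"
    "Mul A \<in> Mor V" "Dom V (Mul A) = MCar A \<otimes> MCar A" "Cod V (Mul A) = MCar A"
    "Uni A \<in> Mor V" "Dom V (Uni A) = \<one>" "Cod V (Uni A) = MCar A"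
  using assms by (auto simp: monoid_in_def hom_iff)

lemma mul_hat_simps [simp]:
  assumes "monoid_in V A" "Z \<in> Obj V"
  shows "mul_hat A Z \<in> Mor V" "Dom V (mul_hat A Z) = MCar A \<otimes> MCar A \<otimes> Z"
    "Cod V (mul_hat A Z) = MCar A \<otimes> Z"
    "uni_hat A Z \<in> Mor V" "Dom V (uni_hat A Z) = Z" "Cod V (uni_hat A Z) = MCar A \<otimes> Z"
  using assms by (simp_all add: mul_hat_def uni_hat_def)

lemma mul_hat_natural:
  assumes "monoid_in V A" "h \<in> Mor V" "Z = Cod V h"
  shows "mul_hat A Z \<cdot> (Ide V (MCar A) \<boxtimes> (Ide V (MCar A) \<boxtimes> h)) =
    (Ide V (MCar A) \<boxtimes> h) \<cdot> mul_hat A (Dom V h)"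
  using assms hat_natural[of "\<langle>MCar A\<rangle> \<odot> \<langle>MCar A\<rangle>" "\<langle>MCar A\<rangle>" "Mul A" h]
  by (simp add: mul_hat_def)

lemma uni_hat_natural:
  assumes "monoid_in V A" "h \<in> Mor V" "Z = Cod V h"
  shows "uni_hat A Z \<cdot> h = (Ide V (MCar A) \<boxtimes> h) \<cdot> uni_hat A (Dom V h)"
  using assms hat_natural[of Nul "\<langle>MCar A\<rangle>" "Uni A" h] by (simp add: uni_hat_def)

text \<open>The monoid axioms with associators and unitors gone. They hold at every tail, so they
  apply to two adjacent factors anywhere in a stack.\<close>

lemma mul_hat_laws:
  assumes A: "monoid_in V A" and Z: "Z \<in> Obj V"
  shows "mul_hat A Z \<cdot> mul_hat A (MCar A \<otimes> Z) = mul_hat A Z \<cdot> (Ide V (MCar A) \<boxtimes> mul_hat A Z)"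
    and "mul_hat A Z \<cdot> uni_hat A (MCar A \<otimes> Z) = Ide V (MCar A \<otimes> Z)"
    and "mul_hat A Z \<cdot> (Ide V (MCar A) \<boxtimes> uni_hat A Z) = Ide V (MCar A \<otimes> Z)"
proof -
  let ?a = "\<langle>MCar A\<rangle>"
  let ?m = "Box (?a \<odot> ?a) (Mul A) ?a" and ?u = "Box Nul (Uni A) ?a"
  have *: "Mul A \<cdot> (Mul A \<boxtimes> Ide V (MCar A)) =
       Mul A \<cdot> (Ide V (MCar A) \<boxtimes> Mul A) \<cdot> Assoc V (MCar A) (MCar A) (MCar A)"
    "Mul A \<cdot> (Uni A \<boxtimes> Ide V (MCar A)) = LUnit V (MCar A)"
    "Mul A \<cdot> (Ide V (MCar A) \<boxtimes> Uni A) = RUnit V (MCar A)"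
    using A unfolding monoid_in_def by blast+
  have "interp (?m \<bullet> (?m \<parallel> Id ?a)) Z = interp (?m \<bullet> (Id ?a \<parallel> ?m) \<bullet> Asc ?a ?a ?a) Z"
    by (rule interp_eqI) (use A Z in \<open>simp_all add: *\<close>)
  then show "mul_hat A Z \<cdot> mul_hat A (MCar A \<otimes> Z) = mul_hat A Z \<cdot> (Ide V (MCar A) \<boxtimes> mul_hat A Z)"
    using A Z by (simp add: mul_hat_def)
  have "interp (?m \<bullet> (?u \<parallel> Id ?a)) Z = interp (LU ?a) Z"
    by (rule interp_eqI) (use A Z in \<open>simp_all add: *\<close>)
  then show "mul_hat A Z \<cdot> uni_hat A (MCar A \<otimes> Z) = Ide V (MCar A \<otimes> Z)"
    using A Z by (simp add: mul_hat_def uni_hat_def)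
  have "interp (?m \<bullet> (Id ?a \<parallel> ?u)) Z = interp (RU ?a) Z"
    by (rule interp_eqI) (use A Z in \<open>simp_all add: *\<close>)
  then show "mul_hat A Z \<cdot> (Ide V (MCar A) \<boxtimes> uni_hat A Z) = Ide V (MCar A \<otimes> Z)"
    using A Z by (simp add: mul_hat_def uni_hat_def)
qed

definition twist_hat :: "('o, 'm) mon \<Rightarrow> ('o, 'm) mon \<Rightarrow> 'o \<Rightarrow> 'm \<Rightarrow> 'o \<Rightarrow> 'm" where
  "twist_hat A B X \<psi> Z = hat (\<langle>MCar A\<rangle> \<odot> \<langle>X\<rangle>) \<psi> (\<langle>X\<rangle> \<odot> \<langle>MCar B\<rangle>) Z"

lemma twist_hat_simps [simp]:
  assumes "\<psi> \<in> hom V (MCar A \<otimes> X) (X \<otimes> MCar B)" "monoid_in V A" "monoid_in V B" "X \<in> Obj V" "Z \<in> Obj V"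
  shows "twist_hat A B X \<psi> Z \<in> Mor V" "Dom V (twist_hat A B X \<psi> Z) = MCar A \<otimes> X \<otimes> Z"
    "Cod V (twist_hat A B X \<psi> Z) = X \<otimes> MCar B \<otimes> Z"
  using assms by (simp_all add: twist_hat_def)

lemma twist_hat_natural:
  assumes "\<psi> \<in> hom V (MCar A \<otimes> X) (X \<otimes> MCar B)" "monoid_in V A" "monoid_in V B" "X \<in> Obj V"
    "h \<in> Mor V" "Z = Cod V h"
  shows "twist_hat A B X \<psi> Z \<cdot> (Ide V (MCar A) \<boxtimes> (Ide V X \<boxtimes> h)) =
    (Ide V X \<boxtimes> (Ide V (MCar B) \<boxtimes> h)) \<cdot> twist_hat A B X \<psi> (Dom V h)"
  using assms hat_natural[of "\<langle>MCar A\<rangle> \<odot> \<langle>X\<rangle>" "\<langle>X\<rangle> \<odot> \<langle>MCar B\<rangle>" \<psi> h]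
  by (simp add: twist_hat_def)

text \<open>The strict form in which the axioms on \<psi> are compared with bimodule structures on
  the free module and with measurings.\<close>

lemma twisted_actions_iff:
  assumes A: "monoid_in V A" and B: "monoid_in V B" and X: "X \<in> Obj V"
  shows "\<psi> \<in> twisted_actions V A B X \<longleftrightarrow> \<psi> \<in> hom V (MCar A \<otimes> X) (X \<otimes> MCar B) \<and>
    (\<forall>Z\<in>Obj V. (Ide V X \<boxtimes> mul_hat B Z) \<cdot> twist_hat A B X \<psi> (MCar B \<otimes> Z) \<cdot>
        (Ide V (MCar A) \<boxtimes> twist_hat A B X \<psi> Z) = twist_hat A B X \<psi> Z \<cdot> mul_hat A (X \<otimes> Z)) \<and>
    (\<forall>Z\<in>Obj V. twist_hat A B X \<psi> Z \<cdot> uni_hat A (X \<otimes> Z) = Ide V X \<boxtimes> uni_hat B Z)"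
proof (cases "\<psi> \<in> hom V (MCar A \<otimes> X) (X \<otimes> MCar B)")
  case \<psi>: True
  let ?a = "\<langle>MCar A\<rangle>" and ?b = "\<langle>MCar B\<rangle>" and ?x = "\<langle>X\<rangle>"
  let ?p = "Box (?a \<odot> ?x) \<psi> (?x \<odot> ?b)"
  let ?L = "(Id ?x \<parallel> Box (?b \<odot> ?b) (Mul B) ?b) \<bullet> Asc ?x ?b ?b \<bullet> (?p \<parallel> Id ?b) \<bullet> AscI ?a ?x ?b \<bullet>
    (Id ?a \<parallel> ?p) \<bullet> Asc ?a ?a ?x"
  have "(\<forall>Z\<in>Obj V. interp ?L Z = interp (?p \<bullet> (Box (?a \<odot> ?a) (Mul A) ?a \<parallel> Id ?x)) Z) \<longleftrightarrow>
      eval ?L = eval (?p \<bullet> (Box (?a \<odot> ?a) (Mul A) ?a \<parallel> Id ?x))"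
    by (rule eval_eq_iff[symmetric]) (use A B X \<psi> in simp_all)
  moreover have "(\<forall>Z\<in>Obj V. interp (?p \<bullet> (Box Nul (Uni A) ?a \<parallel> Id ?x) \<bullet> LUI ?x) Z =
      interp ((Id ?x \<parallel> Box Nul (Uni B) ?b) \<bullet> RUI ?x) Z) \<longleftrightarrow>
      eval (?p \<bullet> (Box Nul (Uni A) ?a \<parallel> Id ?x) \<bullet> LUI ?x) = eval ((Id ?x \<parallel> Box Nul (Uni B) ?b) \<bullet> RUI ?x)"
    by (rule eval_eq_iff[symmetric]) (use A B X \<psi> in simp_all)
  ultimately show ?thesis
    using A B X \<psi> by (simp add: twisted_actions_def mul_hat_def uni_hat_def twist_hat_def)
qed (simp add: twisted_actions_def)

section \<open>Transposition and the Kleisli description\<close>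

lemma
  assumes "X \<in> Obj V" "Y \<in> Obj V" "Z \<in> Obj V" "f \<in> hom V (Z \<otimes> X) Y"
  shows curry_arrow_in: "curry_arrow V Z X Y f \<in> hom V Z (IHom V X Y)"
    and Ev_curry_arrow: "Ev V X Y \<cdot> (curry_arrow V Z X Y f \<boxtimes> Ide V X) = f"
  using theI'[OF Ev_universal[OF assms]] by (auto simp: curry_arrow_def)

lemma curry_arrow_simps [simp]:
  assumes "X \<in> Obj V" "Y \<in> Obj V" "Z \<in> Obj V" "f \<in> hom V (Z \<otimes> X) Y"
  shows "curry_arrow V Z X Y f \<in> Mor V" "Dom V (curry_arrow V Z X Y f) = Z"
    "Cod V (curry_arrow V Z X Y f) = IHom V X Y"
  using curry_arrow_in[OF assms] by (simp_all add: hom_iff)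

text \<open>Uniqueness of transposes, used as an extensionality principle: equations between arrows
  into an internal hom are tested after evaluation.\<close>

lemma Ev_cancel:
  assumes "X \<in> Obj V" "Y \<in> Obj V" "g \<in> hom V Z (IHom V X Y)" "h \<in> hom V Z (IHom V X Y)"
    and "Ev V X Y \<cdot> (g \<boxtimes> Ide V X) = Ev V X Y \<cdot> (h \<boxtimes> Ide V X)"
  shows "g = h"
proof -
  have "Z \<in> Obj V"
    using assms(3) Dom_in by (auto simp: hom_iff)
  moreover have "Ev V X Y \<cdot> (h \<boxtimes> Ide V X) \<in> hom V (Z \<otimes> X) Y"
    using assms by (auto simp: hom_iff)
  ultimately show ?thesis
    using Ev_universal[of X Y Z "Ev V X Y \<cdot> (h \<boxtimes> Ide V X)"] assms by blast
qed

lemma bij_curry_arrow: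
  assumes "X \<in> Obj V" "Y \<in> Obj V" "Z \<in> Obj V"
  shows "bij_betw (curry_arrow V Z X Y) (hom V (Z \<otimes> X) Y) (hom V Z (IHom V X Y))"
proof (rule bij_betw_byWitness[where f' = "\<lambda>g. Ev V X Y \<cdot> (g \<boxtimes> Ide V X)"])
  show "\<forall>g\<in>hom V Z (IHom V X Y). curry_arrow V Z X Y (Ev V X Y \<cdot> (g \<boxtimes> Ide V X)) = g"
  proof
    fix g assume g: "g \<in> hom V Z (IHom V X Y)"
    then have h: "Ev V X Y \<cdot> (g \<boxtimes> Ide V X) \<in> hom V (Z \<otimes> X) Y"
      using assms by (simp add: hom_iff)
    show "curry_arrow V Z X Y (Ev V X Y \<cdot> (g \<boxtimes> Ide V X)) = g"
      by (rule Ev_cancel[OF assms(1,2) curry_arrow_in[OF assms h] g Ev_curry_arrow[OF assms h]])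
  qed
qed (use assms in \<open>auto simp: curry_arrow_in Ev_curry_arrow intro!: Cmp_in TensM_in Ev_in Ide_in\<close>)

lemma AssocI_nat:
  assumes "f \<in> Mor V" "g \<in> Mor V" "h \<in> Mor V" "X = Cod V f" "Y = Cod V g" "Z = Cod V h"
  shows "AssocI X Y Z \<cdot> (f \<boxtimes> (g \<boxtimes> h)) =
    ((f \<boxtimes> g) \<boxtimes> h) \<cdot> AssocI (Dom V f) (Dom V g) (Dom V h)"
proof (rule iso_cancel_right)
  let ?a = "Assoc V (Dom V f) (Dom V g) (Dom V h)" and ?b = "AssocI X Y Z"
  show "iso V ?a"
    using assms by (simp add: Assoc_iso)
  have "(?b \<cdot> (f \<boxtimes> (g \<boxtimes> h))) \<cdot> ?a = ?b \<cdot> (Assoc V X Y Z \<cdot> ((f \<boxtimes> g) \<boxtimes> h))"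
    using assms by (simp add: Assoc_nat)
  also have "\<dots> = (?b \<cdot> Assoc V X Y Z) \<cdot> ((f \<boxtimes> g) \<boxtimes> h)"
    using assms by (subst Cmp_Cmp) simp_all
  also have "\<dots> = (((f \<boxtimes> g) \<boxtimes> h) \<cdot> AssocI (Dom V f) (Dom V g) (Dom V h)) \<cdot> ?a"
    using assms by simp
  finally show "(?b \<cdot> (f \<boxtimes> (g \<boxtimes> h))) \<cdot> ?a = \<dots>" .
qed (use assms in simp_all)

text \<open>Composing with a pure arrow in the Kleisli category is composing in \<open>V\<close>.\<close>

lemma Cmp_kleisli_free:
  assumes B: "monoid_in V B" and X: "X \<in> Obj V" and f: "f \<in> hom V Y (X \<otimes> MCar B)" and g: "g \<in> hom V W Y"
  shows "(Ide V X \<boxtimes> Mul B) \<cdot> Assoc V X (MCar B) (MCar B) \<cdot> (f \<boxtimes> Ide V (MCar B)) \<cdot>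
    (Ide V Y \<boxtimes> Uni B) \<cdot> RUnitI Y \<cdot> g = f \<cdot> g"
proof -
  let ?b = "\<langle>MCar B\<rangle>" and ?x = "\<langle>X\<rangle>" and ?y = "\<langle>Y\<rangle>" and ?w = "\<langle>W\<rangle>"
  let ?f = "Box ?y f (?x \<odot> ?b)" and ?g = "Box ?w g ?y"
  let ?L = "(Id ?x \<parallel> Box (?b \<odot> ?b) (Mul B) ?b) \<bullet> Asc ?x ?b ?b \<bullet> (?f \<parallel> Id ?b) \<bullet>
    (Id ?y \<parallel> Box Nul (Uni B) ?b) \<bullet> RUI ?y \<bullet> ?g"
  have o [simp]: "Y \<in> Obj V" "W \<in> Obj V"
    using f g by (auto simp: hom_iff)
  have "eval ?L = eval (?f \<bullet> ?g)"
  proof (rule eval_eq_iff[THEN iffD2], safe)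
    fix Z assume Z: "Z \<in> Obj V"
    have "interp ?L Z = (Ide V X \<boxtimes> mul_hat B Z) \<cdot> (hat ?y f (?x \<odot> ?b) (MCar B \<otimes> Z) \<cdot>
        (Ide V Y \<boxtimes> uni_hat B Z)) \<cdot> hat ?w g ?y Z"
      using B X f g Z by (simp add: mul_hat_def uni_hat_def)
    \<comment> \<open>The unit inserted behind Y belongs to the tail of \<open>f\<close>, so it
      passes to the far side of \<open>f\<close>, where \<open>Mul B\<close> absorbs it by the right
      unit law.\<close>
    also have "hat ?y f (?x \<odot> ?b) (MCar B \<otimes> Z) \<cdot> (Ide V Y \<boxtimes> uni_hat B Z) =
        (Ide V X \<boxtimes> (Ide V (MCar B) \<boxtimes> uni_hat B Z)) \<cdot> hat ?y f (?x \<odot> ?b) Z"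
      using B X f Z hat_natural[of ?y "?x \<odot> ?b" f "uni_hat B Z"] by simp
    also have "(Ide V X \<boxtimes> mul_hat B Z) \<cdot> ((Ide V X \<boxtimes> (Ide V (MCar B) \<boxtimes> uni_hat B Z)) \<cdot>
        hat ?y f (?x \<odot> ?b) Z) \<cdot> hat ?w g ?y Z =
        (Ide V X \<boxtimes> (mul_hat B Z \<cdot> (Ide V (MCar B) \<boxtimes> uni_hat B Z))) \<cdot>
        hat ?y f (?x \<odot> ?b) Z \<cdot> hat ?w g ?y Z"
      using B X f g Z by (simp add: Ide_TensM_Cmp)
    finally show "interp ?L Z = interp (?f \<bullet> ?g) Z"
      using B X f g Z by (simp add: mul_hat_laws)
  qed (use B X f g in simp_all)
  then show ?thesis
    by simp
qed

text \<open>The unit and multiplication of the monad on the Kleisli category are images of arrows of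
  V, so by \<open>Cmp_kleisli_free\<close> composing with them is composing in V. Only the position
  of an associator then separates the algebra equations from the twisted axioms.\<close>

lemma bij_kleisli_algebras:
  assumes A: "monoid_in V A" and B: "monoid_in V B" and X: "X \<in> Obj V"
  shows "bij_betw (\<lambda>\<psi>. (MCar A \<otimes> X, \<psi>, X)) (twisted_actions V A B X)
    (algebra_structures (kleisli V B) (kleisli_monad V A B) X)"
proof -
  let ?a = "MCar A" and ?b = "MCar B"
  have iff: "(MCar A \<otimes> X, \<psi>, X) \<in> algebra_structures (kleisli V B) (kleisli_monad V A B) X \<longleftrightarrow>
      \<psi> \<in> twisted_actions V A B X" if \<psi>: "\<psi> \<in> hom V (?a \<otimes> X) (X \<otimes> ?b)" for \<psi>
  proof -
    have \<psi>' [simp]: "\<psi> \<in> Mor V" "Dom V \<psi> = ?a \<otimes> X" "Cod V \<psi> = X \<otimes> ?b"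
      using \<psi> by (auto simp: hom_iff)
    let ?P = "(Ide V X \<boxtimes> Mul B) \<cdot> Assoc V X ?b ?b \<cdot> (\<psi> \<boxtimes> Ide V ?b) \<cdot> AssocI ?a X ?b \<cdot> (Ide V ?a \<boxtimes> \<psi>)"
    \<comment> \<open>The associator stands beside the iterated action in
      \<open>twisted_actions\<close>, while its inverse belongs to the multiplication of the
      monad.\<close>
    have 1: "(?P \<cdot> Assoc V ?a ?a X = \<psi> \<cdot> (Mul A \<boxtimes> Ide V X)) \<longleftrightarrow>
        (\<psi> \<cdot> (Mul A \<boxtimes> Ide V X) \<cdot> AssocI ?a ?a X = ?P)"
    proof
      assume *: "?P \<cdot> Assoc V ?a ?a X = \<psi> \<cdot> (Mul A \<boxtimes> Ide V X)"
      have "\<psi> \<cdot> (Mul A \<boxtimes> Ide V X) \<cdot> AssocI ?a ?a X = (\<psi> \<cdot> (Mul A \<boxtimes> Ide V X)) \<cdot> AssocI ?a ?a X"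
        using A B X by simp
      also have "\<dots> = ?P"
        unfolding *[symmetric] using A B X by simp
      finally show "\<psi> \<cdot> (Mul A \<boxtimes> Ide V X) \<cdot> AssocI ?a ?a X = ?P" .
    next
      assume *: "\<psi> \<cdot> (Mul A \<boxtimes> Ide V X) \<cdot> AssocI ?a ?a X = ?P"
      show "?P \<cdot> Assoc V ?a ?a X = \<psi> \<cdot> (Mul A \<boxtimes> Ide V X)"
        unfolding *[symmetric] using A B X by simp
    qed
    have 2: "(MCar A \<otimes> X, \<psi>, X) \<in> algebra_structures (kleisli V B) (kleisli_monad V A B) X \<longleftrightarrow>
        \<psi> \<cdot> (Mul A \<boxtimes> Ide V X) \<cdot> AssocI ?a ?a X = ?P \<and>
        \<psi> \<cdot> (Uni A \<boxtimes> Ide V X) \<cdot> LUnitI X = (Ide V X \<boxtimes> Uni B) \<cdot> RUnitI X"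
      using A B X Cmp_kleisli_free[OF B X \<psi>, of "(Mul A \<boxtimes> Ide V X) \<cdot> AssocI ?a ?a X" "?a \<otimes> (?a \<otimes> X)"]
        Cmp_kleisli_free[OF B X \<psi>, of "(Uni A \<boxtimes> Ide V X) \<cdot> LUnitI X" X]
      by (simp add: algebra_structures_def kleisli_def kleisli_monad_def kleisli_free_def hom_iff hom_def)
    show ?thesis
      using 1 A B X \<psi> unfolding 2 twisted_actions_def by simp
  qed
  have "bij_betw (\<lambda>\<psi>. (?a \<otimes> X, \<psi>, X)) (hom V (?a \<otimes> X) (X \<otimes> ?b)) (hom (kleisli V B) (?a \<otimes> X) X)"
    using A B X by (intro bij_betw_byWitness[where f' = "\<lambda>(Y, \<psi>, Z). \<psi>"]) (auto simp: hom_def kleisli_def)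
  then show ?thesis
    by (rule bij_betw_restrict)
      (use iff in \<open>auto simp: algebra_structures_def kleisli_monad_def twisted_actions_def\<close>)
qed

text \<open>Enriched Kleisli composition of generalised elements \<open>f\<close> and
  \<open>g\<close>, defined at P and Q, is transposed to ordinary Kleisli composition with P and Q
  carried along as parameters. It is applied with both elements equal to the transpose of
  \<psi>.\<close>

lemma Ev_kleisli_icomp:
  assumes B: "monoid_in V B" and X: "X \<in> Obj V" "Y \<in> Obj V" "Z \<in> Obj V"
    and f: "f \<in> hom V P (kleisli_ihom V B Y Z)" and g: "g \<in> hom V Q (kleisli_ihom V B X Y)"
  shows "Ev V X (Z \<otimes> MCar B) \<cdot> ((kleisli_icomp V B X Y Z \<cdot> (f \<boxtimes> g)) \<boxtimes> Ide V X) =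
    (Ide V Z \<boxtimes> Mul B) \<cdot> Assoc V Z (MCar B) (MCar B) \<cdot>
    ((Ev V Y (Z \<otimes> MCar B) \<cdot> (f \<boxtimes> Ide V Y)) \<boxtimes> Ide V (MCar B)) \<cdot> AssocI P Y (MCar B) \<cdot>
    (Ide V P \<boxtimes> (Ev V X (Y \<otimes> MCar B) \<cdot> (g \<boxtimes> Ide V X))) \<cdot> Assoc V P Q X"
  (is "_ = ?m \<cdot> ?al \<cdot> (?F \<boxtimes> _) \<cdot> _ \<cdot> (_ \<boxtimes> ?G) \<cdot> _")
proof -
  let ?b = "MCar B" and ?H = "kleisli_ihom V B Y Z" and ?K = "kleisli_ihom V B X Y"
  have fg [simp]: "f \<in> Mor V" "Dom V f = P" "Cod V f = ?H" "g \<in> Mor V" "Dom V g = Q" "Cod V g = ?K"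
    using f g by (auto simp: hom_iff)
  have o [simp]: "P \<in> Obj V" "Q \<in> Obj V" "?H \<in> Obj V" "?K \<in> Obj V" "IHom V Y (Z \<otimes> ?b) = ?H"
    "IHom V X (Y \<otimes> ?b) = ?K"
    using Obj_Dom[of f] Obj_Dom[of g] B X by (auto simp: kleisli_ihom_def)
  let ?big = "?m \<cdot> ?al \<cdot> (Ev V Y (Z \<otimes> ?b) \<boxtimes> Ide V ?b) \<cdot> AssocI ?H Y ?b \<cdot>
        (Ide V ?H \<boxtimes> Ev V X (Y \<otimes> ?b)) \<cdot> Assoc V ?H ?K X"
  have big: "?big \<in> hom V ((?H \<otimes> ?K) \<otimes> X) (Z \<otimes> ?b)"
    using B X by (simp add: hom_iff)
  have c: "kleisli_icomp V B X Y Z = curry_arrow V (?H \<otimes> ?K) X (Z \<otimes> ?b) ?big"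
    by (simp add: kleisli_icomp_def Let_def)
  have "Ev V X (Z \<otimes> ?b) \<cdot> ((kleisli_icomp V B X Y Z \<cdot> (f \<boxtimes> g)) \<boxtimes> Ide V X) =
      (Ev V X (Z \<otimes> ?b) \<cdot> (kleisli_icomp V B X Y Z \<boxtimes> Ide V X)) \<cdot> ((f \<boxtimes> g) \<boxtimes> Ide V X)"
    unfolding c using B X big by (simp add: Ide_TensM_Cmp)
  also have "\<dots> = ?big \<cdot> ((f \<boxtimes> g) \<boxtimes> Ide V X)"
    unfolding c using B X big by (subst Ev_curry_arrow) simp_all
  also have "\<dots> = ?m \<cdot> ?al \<cdot> (Ev V Y (Z \<otimes> ?b) \<boxtimes> Ide V ?b) \<cdot> AssocI ?H Y ?b \<cdot>
      (Ide V ?H \<boxtimes> Ev V X (Y \<otimes> ?b)) \<cdot> (f \<boxtimes> (g \<boxtimes> Ide V X)) \<cdot> Assoc V P Q X"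
    using B X by (simp add: Assoc_nat)
  also have "\<dots> = ?m \<cdot> ?al \<cdot> (Ev V Y (Z \<otimes> ?b) \<boxtimes> Ide V ?b) \<cdot> AssocI ?H Y ?b \<cdot>
      (f \<boxtimes> ?G) \<cdot> Assoc V P Q X"
    using B X by (simp add: Cmp_eq[OF TensM_Cmp'])
  also have "f \<boxtimes> ?G = (f \<boxtimes> (Ide V Y \<boxtimes> Ide V ?b)) \<cdot> (Ide V P \<boxtimes> ?G)"
    using B X by (simp add: TensM_Cmp')
  also have "?m \<cdot> ?al \<cdot> (Ev V Y (Z \<otimes> ?b) \<boxtimes> Ide V ?b) \<cdot> AssocI ?H Y ?b \<cdot>
      ((f \<boxtimes> (Ide V Y \<boxtimes> Ide V ?b)) \<cdot> (Ide V P \<boxtimes> ?G)) \<cdot> Assoc V P Q X =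
      ?m \<cdot> ?al \<cdot> (Ev V Y (Z \<otimes> ?b) \<boxtimes> Ide V ?b) \<cdot>
      (AssocI ?H Y ?b \<cdot> (f \<boxtimes> (Ide V Y \<boxtimes> Ide V ?b))) \<cdot> (Ide V P \<boxtimes> ?G) \<cdot> Assoc V P Q X"
    using B X by simp
  also have "AssocI ?H Y ?b \<cdot> (f \<boxtimes> (Ide V Y \<boxtimes> Ide V ?b)) = ((f \<boxtimes> Ide V Y) \<boxtimes> Ide V ?b) \<cdot> AssocI P Y ?b"
    using B X by (subst AssocI_nat) simp_all
  finally show ?thesis
    using B X by (simp add: Ide_TensM_Cmp)
qed

text \<open>Both axioms of a monoid morphism are equations into [X, X \<otimes> B]. After
  evaluation, \<open>Ev_kleisli_icomp\<close> turns the product of two transposes into the iterated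
  action of \<psi>.\<close>

lemma bij_kleisli_endo:
  assumes A: "monoid_in V A" and B: "monoid_in V B" and X: "X \<in> Obj V"
  shows "bij_betw (curry_arrow V (MCar A) X (X \<otimes> MCar B)) (twisted_actions V A B X)
    (monoid_hom V A (kleisli_endo V B X))"
proof (rule bij_betw_restrict[OF bij_curry_arrow])
  let ?a = "MCar A" and ?b = "MCar B"
  let ?H = "IHom V X (X \<otimes> ?b)" and ?ev = "Ev V X (X \<otimes> ?b)"
  fix \<psi> assume \<psi>: "\<psi> \<in> hom V (?a \<otimes> X) (X \<otimes> ?b)"
  define f where "f = curry_arrow V ?a X (X \<otimes> ?b) \<psi>"
  have [simp]: "\<psi> \<in> Mor V" "Dom V \<psi> = ?a \<otimes> X" "Cod V \<psi> = X \<otimes> ?b"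
    using \<psi> by (auto simp: hom_iff)
  have f: "f \<in> hom V ?a ?H" and ev: "?ev \<cdot> (f \<boxtimes> Ide V X) = \<psi>"
    using A B X \<psi> by (simp_all add: f_def curry_arrow_in Ev_curry_arrow)
  then have [simp]: "f \<in> Mor V" "Dom V f = ?a" "Cod V f = ?H"
    by (auto simp: hom_iff)
  have H: "kleisli_ihom V B X X = ?H"
    by (simp add: kleisli_ihom_def)
  let ?u = "(Ide V X \<boxtimes> Uni B) \<cdot> RUnitI X \<cdot> LUnit V X"
  have u: "?u \<in> hom V (\<one> \<otimes> X) (X \<otimes> ?b)"
    using B X by (simp add: hom_iff)
  have c: "kleisli_icomp V B X X X \<in> hom V (?H \<otimes> ?H) ?H"
    unfolding kleisli_icomp_def Let_def H
    using B X by (intro curry_arrow_in) (simp_all add: hom_iff)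
  then have [simp]: "kleisli_icomp V B X X X \<in> Mor V" "Dom V (kleisli_icomp V B X X X) = ?H \<otimes> ?H"
    "Cod V (kleisli_icomp V B X X X) = ?H"
    by (auto simp: hom_iff)
  have mul: "f \<cdot> Mul A = kleisli_icomp V B X X X \<cdot> (f \<boxtimes> f) \<longleftrightarrow>
      ?ev \<cdot> ((f \<cdot> Mul A) \<boxtimes> Ide V X) = ?ev \<cdot> ((kleisli_icomp V B X X X \<cdot> (f \<boxtimes> f)) \<boxtimes> Ide V X)"
    using Ev_cancel[of X "X \<otimes> ?b" "f \<cdot> Mul A" "?a \<otimes> ?a" "kleisli_icomp V B X X X \<cdot> (f \<boxtimes> f)"] A B X
    by (auto simp: hom_iff)
  have "?ev \<cdot> ((f \<cdot> Mul A) \<boxtimes> Ide V X) = (?ev \<cdot> (f \<boxtimes> Ide V X)) \<cdot> (Mul A \<boxtimes> Ide V X)"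
    using A B X by (simp add: Ide_TensM_Cmp)
  then have mul': "?ev \<cdot> ((f \<cdot> Mul A) \<boxtimes> Ide V X) = \<psi> \<cdot> (Mul A \<boxtimes> Ide V X)"
    unfolding ev .
  have uni: "f \<cdot> Uni A = kleisli_iident V B X \<longleftrightarrow>
      ?ev \<cdot> ((f \<cdot> Uni A) \<boxtimes> Ide V X) = ?ev \<cdot> (kleisli_iident V B X \<boxtimes> Ide V X)"
    using Ev_cancel[of X "X \<otimes> ?b" "f \<cdot> Uni A" \<one> "kleisli_iident V B X"] A B X
      curry_arrow_in[of X "X \<otimes> ?b" \<one>, OF _ _ _ u]
    by (auto simp: hom_iff kleisli_iident_def)
  have "?ev \<cdot> ((f \<cdot> Uni A) \<boxtimes> Ide V X) = (?ev \<cdot> (f \<boxtimes> Ide V X)) \<cdot> (Uni A \<boxtimes> Ide V X)"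
    using A B X by (simp add: Ide_TensM_Cmp)
  then have uni': "?ev \<cdot> ((f \<cdot> Uni A) \<boxtimes> Ide V X) = \<psi> \<cdot> (Uni A \<boxtimes> Ide V X)"
    unfolding ev .
  have uni'': "?ev \<cdot> (kleisli_iident V B X \<boxtimes> Ide V X) = ?u"
    unfolding kleisli_iident_def using B X u by (simp add: Ev_curry_arrow)
  \<comment> \<open>Evaluating the unit leaves the source \<one> \<otimes> X, whereas the twisted
    axiom starts from X; the left unitor mediates.\<close>
  have lam: "\<psi> \<cdot> (Uni A \<boxtimes> Ide V X) = ?u \<longleftrightarrow>
      \<psi> \<cdot> (Uni A \<boxtimes> Ide V X) \<cdot> LUnitI X = (Ide V X \<boxtimes> Uni B) \<cdot> RUnitI X"
  proof
    assume *: "\<psi> \<cdot> (Uni A \<boxtimes> Ide V X) = ?u"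
    have "\<psi> \<cdot> (Uni A \<boxtimes> Ide V X) \<cdot> LUnitI X = (\<psi> \<cdot> (Uni A \<boxtimes> Ide V X)) \<cdot> LUnitI X"
      using A X by simp
    then show "\<psi> \<cdot> (Uni A \<boxtimes> Ide V X) \<cdot> LUnitI X = (Ide V X \<boxtimes> Uni B) \<cdot> RUnitI X"
      unfolding * using B X by simp
  next
    assume *: "\<psi> \<cdot> (Uni A \<boxtimes> Ide V X) \<cdot> LUnitI X = (Ide V X \<boxtimes> Uni B) \<cdot> RUnitI X"
    have "?u = ((Ide V X \<boxtimes> Uni B) \<cdot> RUnitI X) \<cdot> LUnit V X"
      using B X by simp
    then show "\<psi> \<cdot> (Uni A \<boxtimes> Ide V X) = ?u"
      unfolding *[symmetric] using A X by simp
  qed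
  have comp: "?ev \<cdot> ((kleisli_icomp V B X X X \<cdot> (f \<boxtimes> f)) \<boxtimes> Ide V X) =
      (Ide V X \<boxtimes> Mul B) \<cdot> Assoc V X ?b ?b \<cdot> (\<psi> \<boxtimes> Ide V ?b) \<cdot> AssocI ?a X ?b \<cdot> (Ide V ?a \<boxtimes> \<psi>) \<cdot> Assoc V ?a ?a X"
    using Ev_kleisli_icomp[OF B X X X, of f ?a f ?a] f by (simp add: H ev)
  have "f \<in> monoid_hom V A (kleisli_endo V B X) \<longleftrightarrow>
      f \<cdot> Mul A = kleisli_icomp V B X X X \<cdot> (f \<boxtimes> f) \<and> f \<cdot> Uni A = kleisli_iident V B X"
    using f by (simp add: monoid_hom_def kleisli_endo_def kleisli_ihom_def)
  then show "f \<in> monoid_hom V A (kleisli_endo V B X) \<longleftrightarrow> \<psi> \<in> twisted_actions V A B X"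
    unfolding mul mul' uni uni' uni'' lam comp twisted_actions_def using \<psi> by auto
qed (use A B X in \<open>auto simp: twisted_actions_def monoid_hom_def kleisli_endo_def kleisli_ihom_def\<close>)

end

section \<open>Modules\<close>

context braided_monoidal_closed
begin

section \<open>Internal composition and hom-objects of modules\<close>

lemma Ev_Cmp:
  assumes "X \<in> Obj V" "Y \<in> Obj V" "f \<in> Mor V" "Cod V f = IHom V X Y" "g \<in> Mor V" "Cod V g = Dom V f"
  shows "Ev V X Y \<cdot> ((f \<cdot> g) \<boxtimes> Ide V X) = (Ev V X Y \<cdot> (f \<boxtimes> Ide V X)) \<cdot> (g \<boxtimes> Ide V X)"
  using assms by (simp add: Ide_TensM_Cmp)

lemma icomp_in:
  assumes "X \<in> Obj V" "Y \<in> Obj V" "Z \<in> Obj V"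
  shows "icomp V X Y Z \<in> hom V (IHom V Y Z \<otimes> IHom V X Y) (IHom V X Z)"
  unfolding icomp_def using assms by (intro curry_arrow_in) (simp_all add: hom_iff)

lemma iident_in: "X \<in> Obj V \<Longrightarrow> iident V X \<in> hom V \<one> (IHom V X X)"
  unfolding iident_def by (intro curry_arrow_in) (simp_all add: LUnit_in)

lemma Ev_iident: "X \<in> Obj V \<Longrightarrow> Ev V X X \<cdot> (iident V X \<boxtimes> Ide V X) = LUnit V X"
  unfolding iident_def by (intro Ev_curry_arrow) (simp_all add: LUnit_in)

lemma Ev_icomp:
  assumes o: "X \<in> Obj V" "Y \<in> Obj V" "Z \<in> Obj V"
    and f: "f \<in> hom V P (IHom V Y Z)" and g: "g \<in> hom V Q (IHom V X Y)"
  shows "Ev V X Z \<cdot> ((icomp V X Y Z \<cdot> (f \<boxtimes> g)) \<boxtimes> Ide V X) =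
    (Ev V Y Z \<cdot> (f \<boxtimes> Ide V Y)) \<cdot> (Ide V P \<boxtimes> (Ev V X Y \<cdot> (g \<boxtimes> Ide V X))) \<cdot> Assoc V P Q X"
proof -
  let ?H = "IHom V Y Z" and ?K = "IHom V X Y"
  have fg [simp]: "f \<in> Mor V" "Dom V f = P" "Cod V f = ?H" "g \<in> Mor V" "Dom V g = Q" "Cod V g = ?K"
    using f g by (auto simp: hom_iff)
  have [simp]: "P \<in> Obj V" "Q \<in> Obj V"
    using Obj_Dom[of f] Obj_Dom[of g] by auto
  let ?big = "Ev V Y Z \<cdot> (Ide V ?H \<boxtimes> Ev V X Y) \<cdot> Assoc V ?H ?K X"
  have big: "?big \<in> hom V ((?H \<otimes> ?K) \<otimes> X) Z"
    using o by (simp add: hom_iff)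
  have "Ev V X Z \<cdot> ((icomp V X Y Z \<cdot> (f \<boxtimes> g)) \<boxtimes> Ide V X) =
      (Ev V X Z \<cdot> (icomp V X Y Z \<boxtimes> Ide V X)) \<cdot> ((f \<boxtimes> g) \<boxtimes> Ide V X)"
    using o icomp_in[OF o] by (intro Ev_Cmp) (simp_all add: hom_iff)
  also have "\<dots> = ?big \<cdot> ((f \<boxtimes> g) \<boxtimes> Ide V X)"
    unfolding icomp_def using o big by (subst Ev_curry_arrow) simp_all
  also have "\<dots> = Ev V Y Z \<cdot> (Ide V ?H \<boxtimes> Ev V X Y) \<cdot> (f \<boxtimes> (g \<boxtimes> Ide V X)) \<cdot> Assoc V P Q X"
    using o by (simp add: Assoc_nat)
  also have "\<dots> = (Ev V Y Z \<cdot> (f \<boxtimes> Ide V Y)) \<cdot> (Ide V P \<boxtimes> (Ev V X Y \<cdot> (g \<boxtimes> Ide V X))) \<cdot> Assoc V P Q X"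
    using o by (simp add: Cmp_eq[OF TensM_Cmp'])
  finally show ?thesis .
qed

text \<open>Says what the equaliser selects: its generalised elements at W are transposes of module
  morphisms W \<otimes> M \<rightarrow> N, with B acting on the factor M. After evaluation at M
  \<otimes> B the two legs become the two sides of linearity.\<close>

lemma equalises_iff_module_morphism:
  assumes B: "monoid_in V B" and N: "N \<in> Obj V" and M: "M \<in> Obj V"
    and m: "m \<in> hom V (M \<otimes> MCar B) M" and n: "n \<in> hom V (N \<otimes> MCar B) N"
    and g: "g \<in> hom V W (IHom V M N)"
  defines "F \<equiv> Ev V M N \<cdot> (g \<boxtimes> Ide V M)"
  shows "precomp V m N \<cdot> g = curry_arrow V (IHom V M N) (M \<otimes> MCar B) N
          (n \<cdot> (Ev V M N \<boxtimes> Ide V (MCar B)) \<cdot> AssocI (IHom V M N) M (MCar B)) \<cdot> g \<longleftrightarrow>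
    F \<cdot> (Ide V W \<boxtimes> m) \<cdot> Assoc V W M (MCar B) = n \<cdot> (F \<boxtimes> Ide V (MCar B))"
proof -
  let ?b = "MCar B" and ?H = "IHom V M N"
  let ?q = "n \<cdot> (Ev V M N \<boxtimes> Ide V ?b) \<cdot> AssocI ?H M ?b" and ?p = "Ev V M N \<cdot> (Ide V ?H \<boxtimes> m)"
  let ?P = "precomp V m N" and ?Q = "curry_arrow V ?H (M \<otimes> ?b) N ?q"
  let ?ev = "Ev V (M \<otimes> ?b) N"
  have [simp]: "m \<in> Mor V" "Dom V m = M \<otimes> ?b" "Cod V m = M" "n \<in> Mor V" "Dom V n = N \<otimes> ?b"
    "Cod V n = N" "g \<in> Mor V" "Dom V g = W" "Cod V g = ?H"
    using m n g by (auto simp: hom_iff)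
  have [simp]: "W \<in> Obj V"
    using Obj_Dom[of g] by simp
  have P_def: "?P = curry_arrow V ?H (M \<otimes> ?b) N ?p"
    by (simp add: precomp_def)
  have p: "?p \<in> hom V (?H \<otimes> (M \<otimes> ?b)) N" and q: "?q \<in> hom V (?H \<otimes> (M \<otimes> ?b)) N"
    using B M N by (simp_all add: hom_iff)
  have F [simp]: "F \<in> Mor V" "Dom V F = W \<otimes> M" "Cod V F = N"
    using M N by (simp_all add: F_def)
  have "?P \<cdot> g = ?Q \<cdot> g \<longleftrightarrow>
      ?ev \<cdot> ((?P \<cdot> g) \<boxtimes> Ide V (M \<otimes> ?b)) = ?ev \<cdot> ((?Q \<cdot> g) \<boxtimes> Ide V (M \<otimes> ?b))"
    using Ev_cancel[of "M \<otimes> ?b" N "?P \<cdot> g" W "?Q \<cdot> g"] B M N p q by (auto simp: P_def hom_iff[of _ W])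
  also have "?ev \<cdot> ((?P \<cdot> g) \<boxtimes> Ide V (M \<otimes> ?b)) = ?p \<cdot> (g \<boxtimes> Ide V (M \<otimes> ?b))"
    unfolding P_def using B M N p by (subst Ev_Cmp) (simp_all add: Ev_curry_arrow)
  also have "\<dots> = F \<cdot> (Ide V W \<boxtimes> m)"
    unfolding F_def using B M N by (simp add: TensM_Cmp')
  also have "?ev \<cdot> ((?Q \<cdot> g) \<boxtimes> Ide V (M \<otimes> ?b)) = ?q \<cdot> (g \<boxtimes> Ide V (M \<otimes> ?b))"
    using B M N q by (subst Ev_Cmp) (simp_all add: Ev_curry_arrow)
  also have "\<dots> = n \<cdot> (Ev V M N \<boxtimes> Ide V ?b) \<cdot> (AssocI ?H M ?b \<cdot> (g \<boxtimes> (Ide V M \<boxtimes> Ide V ?b)))"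
    using B M N by simp
  also have "\<dots> = n \<cdot> (F \<boxtimes> Ide V ?b) \<cdot> AssocI W M ?b"
    using B M N by (subst AssocI_nat) (simp_all add: F_def Ide_TensM_Cmp)
  also have "F \<cdot> (Ide V W \<boxtimes> m) = n \<cdot> (F \<boxtimes> Ide V ?b) \<cdot> AssocI W M ?b \<longleftrightarrow>
      F \<cdot> (Ide V W \<boxtimes> m) \<cdot> Assoc V W M ?b = n \<cdot> (F \<boxtimes> Ide V ?b)"
  proof
    assume *: "F \<cdot> (Ide V W \<boxtimes> m) = n \<cdot> (F \<boxtimes> Ide V ?b) \<cdot> AssocI W M ?b"
    have "F \<cdot> (Ide V W \<boxtimes> m) \<cdot> Assoc V W M ?b = (F \<cdot> (Ide V W \<boxtimes> m)) \<cdot> Assoc V W M ?b"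
      using B M N by simp
    then show "F \<cdot> (Ide V W \<boxtimes> m) \<cdot> Assoc V W M ?b = n \<cdot> (F \<boxtimes> Ide V ?b)"
      unfolding * using B M N by simp
  next
    assume *: "F \<cdot> (Ide V W \<boxtimes> m) \<cdot> Assoc V W M ?b = n \<cdot> (F \<boxtimes> Ide V ?b)"
    have "n \<cdot> (F \<boxtimes> Ide V ?b) \<cdot> AssocI W M ?b = (n \<cdot> (F \<boxtimes> Ide V ?b)) \<cdot> AssocI W M ?b"
      using B M N by simp
    then show "F \<cdot> (Ide V W \<boxtimes> m) = n \<cdot> (F \<boxtimes> Ide V ?b) \<cdot> AssocI W M ?b"
      unfolding *[symmetric] using B M N by simp
  qed
  finally show ?thesis .
qed

text \<open>Applied to the transpose of the equaliser arrow \<open>e\<close>, this shows that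
  composites of elements of \<open>E\<close> are again linear, which is what the multiplication of
  \<open>module_endo\<close> needs in order to factor through \<open>e\<close>.\<close>

lemma module_morphism_Cmp:
  assumes B: "monoid_in V B" and o: "E \<in> Obj V" "M \<in> Obj V" and m: "m \<in> hom V (M \<otimes> MCar B) M"
    and f: "f \<in> hom V (E \<otimes> M) M"
    and eq: "f \<cdot> (Ide V E \<boxtimes> m) \<cdot> Assoc V E M (MCar B) = m \<cdot> (f \<boxtimes> Ide V (MCar B))"
  defines "F \<equiv> f \<cdot> (Ide V E \<boxtimes> f) \<cdot> Assoc V E E M"
  shows "F \<cdot> (Ide V (E \<otimes> E) \<boxtimes> m) \<cdot> Assoc V (E \<otimes> E) M (MCar B) = m \<cdot> (F \<boxtimes> Ide V (MCar B))"
proof -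
  let ?b = "\<langle>MCar B\<rangle>" and ?e = "\<langle>E\<rangle>" and ?n = "\<langle>M\<rangle>"
  let ?m = "Box (?n \<odot> ?b) m ?n" and ?f = "Box (?e \<odot> ?n) f ?n"
  let ?F = "?f \<bullet> (Id ?e \<parallel> ?f) \<bullet> Asc ?e ?e ?n"
  let ?fh = "hat (?e \<odot> ?n) f ?n" and ?mh = "hat (?n \<odot> ?b) m ?n"
  have fm: "?fh Z \<cdot> (Ide V E \<boxtimes> ?mh Z) = ?mh Z \<cdot> ?fh (MCar B \<otimes> Z)" if "Z \<in> Obj V" for Z
    using interp_eqI[of "?f \<bullet> (Id ?e \<parallel> ?m) \<bullet> Asc ?e ?n ?b" "?m \<bullet> (?f \<parallel> Id ?b)" Z] B o m f eq that
    by simp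
  have "eval (?F \<bullet> (Id (?e \<odot> ?e) \<parallel> ?m) \<bullet> Asc (?e \<odot> ?e) ?n ?b) = eval (?m \<bullet> (?F \<parallel> Id ?b))"
  proof (rule eval_eq_iff[THEN iffD2], safe)
    fix Z assume Z: "Z \<in> Obj V"
    have "?fh Z \<cdot> (Ide V E \<boxtimes> ?fh Z) \<cdot> (Ide V E \<boxtimes> (Ide V E \<boxtimes> ?mh Z)) =
        ?fh Z \<cdot> (Ide V E \<boxtimes> (?fh Z \<cdot> (Ide V E \<boxtimes> ?mh Z)))"
      using B o m f Z by (simp add: Ide_TensM_Cmp)
    also have "\<dots> = ?fh Z \<cdot> (Ide V E \<boxtimes> ?mh Z) \<cdot> (Ide V E \<boxtimes> ?fh (MCar B \<otimes> Z))"
      using B o m f Z by (simp add: fm Ide_TensM_Cmp)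
    also have "\<dots> = ?mh Z \<cdot> ?fh (MCar B \<otimes> Z) \<cdot> (Ide V E \<boxtimes> ?fh (MCar B \<otimes> Z))"
      using B o m f Z by (simp add: Cmp_eq[OF fm])
    finally show "interp (?F \<bullet> (Id (?e \<odot> ?e) \<parallel> ?m) \<bullet> Asc (?e \<odot> ?e) ?n ?b) Z = interp (?m \<bullet> (?F \<parallel> Id ?b)) Z"
      using B o m f Z by simp
  qed (use B o m f in simp_all)
  then show ?thesis
    using o by (simp add: F_def)
qed

text \<open>The corresponding fact for identities, needed for the unit of
  \<open>module_endo\<close>.\<close>

lemma module_morphism_LUnit:
  assumes B: "monoid_in V B" and o: "M \<in> Obj V" and m: "m \<in> hom V (M \<otimes> MCar B) M"
  shows "LUnit V M \<cdot> (Ide V \<one> \<boxtimes> m) \<cdot> Assoc V \<one> M (MCar B) = m \<cdot> (LUnit V M \<boxtimes> Ide V (MCar B))"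
proof -
  let ?b = "\<langle>MCar B\<rangle>" and ?n = "\<langle>M\<rangle>"
  let ?m = "Box (?n \<odot> ?b) m ?n"
  have "eval (LU ?n \<bullet> (Id Nul \<parallel> ?m) \<bullet> Asc Nul ?n ?b) = eval (?m \<bullet> (LU ?n \<parallel> Id ?b))"
    by (rule eval_eq_iff[THEN iffD2]) (use B o m in simp_all)
  then show ?thesis
    by simp
qed

text \<open>For a right module (M, m) these are the (A, B)-bimodule structures on M extending
  \<open>m\<close>. They are the common middle term between (3) and (4).\<close>

definition module_actions :: "('o, 'm) mon \<Rightarrow> ('o, 'm) mon \<Rightarrow> 'o \<Rightarrow> 'm \<Rightarrow> 'm set" where
  "module_actions A B M m = {\<phi> \<in> hom V (MCar A \<otimes> M) M.
     \<phi> \<cdot> (Mul A \<boxtimes> Ide V M) = \<phi> \<cdot> (Ide V (MCar A) \<boxtimes> \<phi>) \<cdot> Assoc V (MCar A) (MCar A) M \<and>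
     \<phi> \<cdot> (Uni A \<boxtimes> Ide V M) = LUnit V M \<and>
     \<phi> \<cdot> (Ide V (MCar A) \<boxtimes> m) \<cdot> Assoc V (MCar A) M (MCar B) = m \<cdot> (\<phi> \<boxtimes> Ide V (MCar B))}"

text \<open>An arrow from A into \<open>E\<close> composes with \<open>e\<close> to an arrow into
  [M, M], that is, to a transpose A \<otimes> M \<rightarrow> M. Factoring through \<open>E\<close>
  is linearity, and the monoid morphism axioms become the action axioms.\<close>

lemma bij_module_endo:
  assumes A: "monoid_in V A" and B: "monoid_in V B" and M: "M \<in> Obj V"
    and m: "m \<in> hom V (M \<otimes> MCar B) M"
    and E: "is_module_ihom V B (M, m) (M, m) E e"
  shows "bij_betw (\<lambda>\<phi>. lift_through V e (curry_arrow V (MCar A) M M \<phi>))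
    (module_actions A B M m) (monoid_hom V A (module_endo V M E e))"
proof -
  let ?a = "MCar A" and ?b = "MCar B" and ?H = "IHom V M M" and ?ev = "Ev V M M"
  define P where "P = precomp V m M"
  define Q where "Q = curry_arrow V ?H (M \<otimes> ?b) M (m \<cdot> (?ev \<boxtimes> Ide V ?b) \<cdot> AssocI ?H M ?b)"
  have [simp]: "m \<in> Mor V" "Dom V m = M \<otimes> ?b" "Cod V m = M"
    using m by (auto simp: hom_iff)
  have "?ev \<cdot> (Ide V ?H \<boxtimes> m) \<in> hom V (?H \<otimes> (M \<otimes> ?b)) M"
    "m \<cdot> (?ev \<boxtimes> Ide V ?b) \<cdot> AssocI ?H M ?b \<in> hom V (?H \<otimes> (M \<otimes> ?b)) M"
    using B M by (simp_all add: hom_iff)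
  then have PQ [simp]: "P \<in> Mor V" "Dom V P = ?H" "Q \<in> Mor V" "Dom V Q = ?H"
    using B M by (simp_all add: P_def Q_def precomp_def)
  have eq: "is_equaliser V E e P Q"
    using E by (simp add: is_module_ihom_def P_def Q_def)
  then have e [simp]: "e \<in> Mor V" "Dom V e = E" "Cod V e = ?H"
    by (auto simp: is_equaliser_def hom_iff)
  have E_in [simp]: "E \<in> Obj V"
    using Obj_Dom[of e] by simp
  have lift: "lift_through V e h \<in> hom V W E" "e \<cdot> lift_through V e h = h"
    if "W \<in> Obj V" "h \<in> hom V W ?H" "P \<cdot> h = Q \<cdot> h" for W h
    using lift_through[OF eq] that by auto
  have mono: "k = k'" if "k \<in> hom V W E" "k' \<in> hom V W E" "e \<cdot> k = e \<cdot> k'" for k k' W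
    using equaliser_mono[OF eq that] by simp
  \<comment> \<open>Equations into \<open>E\<close> are thereby moved to [M, M], where they can be
    evaluated.\<close>
  have mono_iff: "k = k' \<longleftrightarrow> e \<cdot> k = e \<cdot> k'" if "k \<in> hom V W E" "k' \<in> hom V W E" for k k' W
    using mono that by blast
  have equalises: "P \<cdot> g = Q \<cdot> g \<longleftrightarrow> ?ev \<cdot> (g \<boxtimes> Ide V M) \<cdot> (Ide V W \<boxtimes> m) \<cdot> Assoc V W M ?b =
      m \<cdot> ((?ev \<cdot> (g \<boxtimes> Ide V M)) \<boxtimes> Ide V ?b)" if g: "g \<in> hom V W ?H" for g W
  proof -
    have [simp]: "g \<in> Mor V" "Dom V g = W" "Cod V g = ?H" "W \<in> Obj V"
      using g Obj_Dom[of g] by (auto simp: hom_iff)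
    show ?thesis
      using equalises_iff_module_morphism[OF B M M m m g] B M by (simp add: P_def Q_def)
  qed
  let ?\<epsilon> = "?ev \<cdot> (e \<boxtimes> Ide V M)"
  have eps: "?\<epsilon> \<cdot> (Ide V E \<boxtimes> m) \<cdot> Assoc V E M ?b = m \<cdot> (?\<epsilon> \<boxtimes> Ide V ?b)"
    using equalises[of e E] eq B M by (simp add: is_equaliser_def hom_iff)
  have ic: "icomp V M M M \<in> hom V (?H \<otimes> ?H) ?H" "iident V M \<in> hom V \<one> ?H"
    using M by (simp_all add: icomp_in iident_in)
  then have [simp]: "icomp V M M M \<in> Mor V" "Dom V (icomp V M M M) = ?H \<otimes> ?H"
    "Cod V (icomp V M M M) = ?H" "iident V M \<in> Mor V" "Dom V (iident V M) = \<one>" "Cod V (iident V M) = ?H"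
    by (auto simp: hom_iff)
  let ?N = "module_endo V M E e"
  \<comment> \<open>\<open>lift_through\<close> means nothing until its argument is known to
    equalise the two legs, so this has to precede any use of the multiplication.\<close>
  have mul: "Mul ?N \<in> hom V (E \<otimes> E) E" "e \<cdot> Mul ?N = icomp V M M M \<cdot> (e \<boxtimes> e)"
  proof -
    let ?c = "icomp V M M M \<cdot> (e \<boxtimes> e)"
    have c: "?c \<in> hom V (E \<otimes> E) ?H"
      by (simp add: hom_iff)
    have "?ev \<cdot> (?c \<boxtimes> Ide V M) = ?\<epsilon> \<cdot> (Ide V E \<boxtimes> ?\<epsilon>) \<cdot> Assoc V E E M"
      using M by (intro Ev_icomp) (simp_all add: hom_iff)
    moreover have "?ev \<cdot> (?c \<boxtimes> Ide V M) \<cdot> (Ide V (E \<otimes> E) \<boxtimes> m) \<cdot> Assoc V (E \<otimes> E) M ?b =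
        (?ev \<cdot> (?c \<boxtimes> Ide V M)) \<cdot> (Ide V (E \<otimes> E) \<boxtimes> m) \<cdot> Assoc V (E \<otimes> E) M ?b"
      using B M by simp
    ultimately have "P \<cdot> ?c = Q \<cdot> ?c"
      using equalises[OF c] module_morphism_Cmp[OF B E_in M m _ eps] M by (simp add: hom_iff)
    then show "Mul ?N \<in> hom V (E \<otimes> E) E" "e \<cdot> Mul ?N = ?c"
      using lift[OF _ c] by (simp_all add: module_endo_def)
  qed
  have uni: "Uni ?N \<in> hom V \<one> E" "e \<cdot> Uni ?N = iident V M"
  proof -
    have "?ev \<cdot> (iident V M \<boxtimes> Ide V M) \<cdot> (Ide V \<one> \<boxtimes> m) \<cdot> Assoc V \<one> M ?b =
        (?ev \<cdot> (iident V M \<boxtimes> Ide V M)) \<cdot> (Ide V \<one> \<boxtimes> m) \<cdot> Assoc V \<one> M ?b"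
      using B M by simp
    then have "P \<cdot> iident V M = Q \<cdot> iident V M"
      using equalises[OF ic(2)] module_morphism_LUnit[OF B M m] M by (simp only: Ev_iident)
    then show "Uni ?N \<in> hom V \<one> E" "e \<cdot> Uni ?N = iident V M"
      using lift[OF _ ic(2)] by (simp_all add: module_endo_def)
  qed
  have [simp]: "Mul ?N \<in> Mor V" "Dom V (Mul ?N) = E \<otimes> E" "Cod V (Mul ?N) = E"
    "Uni ?N \<in> Mor V" "Dom V (Uni ?N) = \<one>" "Cod V (Uni ?N) = E" "MCar ?N = E"
    using mul uni by (auto simp: hom_iff module_endo_def)
  have key: "k \<in> monoid_hom V A ?N \<longleftrightarrow> ?ev \<cdot> ((e \<cdot> k) \<boxtimes> Ide V M) \<in> module_actions A B M m"
    if k: "k \<in> hom V ?a E" for k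
  proof -
    have [simp]: "k \<in> Mor V" "Dom V k = ?a" "Cod V k = E"
      using k by (auto simp: hom_iff)
    define \<phi> where "\<phi> = ?ev \<cdot> ((e \<cdot> k) \<boxtimes> Ide V M)"
    have ek: "e \<cdot> k \<in> hom V ?a ?H"
      by (simp add: hom_iff)
    have \<phi>: "\<phi> \<in> hom V (?a \<otimes> M) M"
      using A M by (simp add: \<phi>_def hom_iff)
    then have [simp]: "\<phi> \<in> Mor V" "Dom V \<phi> = ?a \<otimes> M" "Cod V \<phi> = M"
      by (auto simp: hom_iff)
    have "k \<cdot> Mul A = Mul ?N \<cdot> (k \<boxtimes> k) \<longleftrightarrow> e \<cdot> (k \<cdot> Mul A) = e \<cdot> (Mul ?N \<cdot> (k \<boxtimes> k))"
      using A by (intro mono_iff) (simp_all add: hom_iff)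
    also have "e \<cdot> (Mul ?N \<cdot> (k \<boxtimes> k)) = (icomp V M M M \<cdot> (e \<boxtimes> e)) \<cdot> (k \<boxtimes> k)"
      using A by (subst mul(2)[symmetric]) simp
    also have "\<dots> = icomp V M M M \<cdot> ((e \<cdot> k) \<boxtimes> (e \<cdot> k))"
      using A by (simp add: TensM_Cmp')
    also have "e \<cdot> (k \<cdot> Mul A) = (e \<cdot> k) \<cdot> Mul A"
      using A by simp
    also have "(e \<cdot> k) \<cdot> Mul A = icomp V M M M \<cdot> ((e \<cdot> k) \<boxtimes> (e \<cdot> k)) \<longleftrightarrow>
        ?ev \<cdot> (((e \<cdot> k) \<cdot> Mul A) \<boxtimes> Ide V M) = ?ev \<cdot> ((icomp V M M M \<cdot> ((e \<cdot> k) \<boxtimes> (e \<cdot> k))) \<boxtimes> Ide V M)"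
      using Ev_cancel[of M M "(e \<cdot> k) \<cdot> Mul A" "?a \<otimes> ?a" "icomp V M M M \<cdot> ((e \<cdot> k) \<boxtimes> (e \<cdot> k))"] A M
      by (auto simp: hom_iff)
    also have "?ev \<cdot> (((e \<cdot> k) \<cdot> Mul A) \<boxtimes> Ide V M) = \<phi> \<cdot> (Mul A \<boxtimes> Ide V M)"
      unfolding \<phi>_def using A M by (intro Ev_Cmp) simp_all
    also have "?ev \<cdot> ((icomp V M M M \<cdot> ((e \<cdot> k) \<boxtimes> (e \<cdot> k))) \<boxtimes> Ide V M) =
        \<phi> \<cdot> (Ide V ?a \<boxtimes> \<phi>) \<cdot> Assoc V ?a ?a M"
      unfolding \<phi>_def using M ek by (intro Ev_icomp) simp_all
    finally have 1: "k \<cdot> Mul A = Mul ?N \<cdot> (k \<boxtimes> k) \<longleftrightarrow>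
        \<phi> \<cdot> (Mul A \<boxtimes> Ide V M) = \<phi> \<cdot> (Ide V ?a \<boxtimes> \<phi>) \<cdot> Assoc V ?a ?a M" .
    have "k \<cdot> Uni A = Uni ?N \<longleftrightarrow> e \<cdot> (k \<cdot> Uni A) = e \<cdot> Uni ?N"
      using A by (intro mono_iff) (simp_all add: hom_iff)
    also have "e \<cdot> Uni ?N = iident V M"
      by (rule uni)
    also have "e \<cdot> (k \<cdot> Uni A) = (e \<cdot> k) \<cdot> Uni A"
      using A by simp
    also have "(e \<cdot> k) \<cdot> Uni A = iident V M \<longleftrightarrow>
        ?ev \<cdot> (((e \<cdot> k) \<cdot> Uni A) \<boxtimes> Ide V M) = ?ev \<cdot> (iident V M \<boxtimes> Ide V M)"
      using Ev_cancel[of M M "(e \<cdot> k) \<cdot> Uni A" \<one> "iident V M"] A M by (auto simp: hom_iff)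
    also have "?ev \<cdot> (((e \<cdot> k) \<cdot> Uni A) \<boxtimes> Ide V M) = \<phi> \<cdot> (Uni A \<boxtimes> Ide V M)"
      unfolding \<phi>_def using A M by (intro Ev_Cmp) simp_all
    also have "?ev \<cdot> (iident V M \<boxtimes> Ide V M) = LUnit V M"
      using M by (rule Ev_iident)
    finally have 2: "k \<cdot> Uni A = Uni ?N \<longleftrightarrow> \<phi> \<cdot> (Uni A \<boxtimes> Ide V M) = LUnit V M" .
    \<comment> \<open>Linearity comes from the mere fact that the arrow factors through
      \<open>e\<close>, before any axiom on \<open>k\<close>.\<close>
    have "P \<cdot> (e \<cdot> k) = Q \<cdot> (e \<cdot> k)"
      using equaliser_Cmp[OF eq k] by simp
    then have "?ev \<cdot> ((e \<cdot> k) \<boxtimes> Ide V M) \<cdot> (Ide V ?a \<boxtimes> m) \<cdot> Assoc V ?a M ?b = m \<cdot> (\<phi> \<boxtimes> Ide V ?b)"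
      unfolding equalises[OF ek] \<phi>_def .
    moreover have "?ev \<cdot> ((e \<cdot> k) \<boxtimes> Ide V M) \<cdot> (Ide V ?a \<boxtimes> m) \<cdot> Assoc V ?a M ?b =
        \<phi> \<cdot> (Ide V ?a \<boxtimes> m) \<cdot> Assoc V ?a M ?b"
      unfolding \<phi>_def using A B M by simp
    ultimately have 3: "\<phi> \<cdot> (Ide V ?a \<boxtimes> m) \<cdot> Assoc V ?a M ?b = m \<cdot> (\<phi> \<boxtimes> Ide V ?b)"
      by simp
    show ?thesis
      using 1 2 3 k \<phi> by (simp add: monoid_hom_def module_actions_def flip: \<phi>_def)
  qed
  have lift_curry: "lift_through V e (curry_arrow V ?a M M \<phi>) \<in> hom V ?a E"
    "e \<cdot> lift_through V e (curry_arrow V ?a M M \<phi>) = curry_arrow V ?a M M \<phi>"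
    "?ev \<cdot> ((e \<cdot> lift_through V e (curry_arrow V ?a M M \<phi>)) \<boxtimes> Ide V M) = \<phi>"
    if "\<phi> \<in> module_actions A B M m" for \<phi>
  proof -
    let ?c = "curry_arrow V ?a M M \<phi>"
    have \<phi>: "\<phi> \<in> hom V (?a \<otimes> M) M"
      "\<phi> \<cdot> (Ide V (MCar A) \<boxtimes> m) \<cdot> Assoc V (MCar A) M (MCar B) = m \<cdot> (\<phi> \<boxtimes> Ide V (MCar B))"
      using that by (auto simp: module_actions_def)
    have c: "?c \<in> hom V ?a ?H" "?ev \<cdot> (?c \<boxtimes> Ide V M) = \<phi>"
      using A M \<phi> by (simp_all add: curry_arrow_in Ev_curry_arrow)
    have [simp]: "?c \<in> Mor V" "Dom V ?c = ?a" "Cod V ?c = ?H"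
      using c by (auto simp: hom_iff)
    have "(?ev \<cdot> (?c \<boxtimes> Ide V M)) \<cdot> (Ide V ?a \<boxtimes> m) \<cdot> Assoc V ?a M ?b =
      ?ev \<cdot> (?c \<boxtimes> Ide V M) \<cdot> (Ide V ?a \<boxtimes> m) \<cdot> Assoc V ?a M ?b"
      using A B M by simp
    then have "P \<cdot> ?c = Q \<cdot> ?c"
      unfolding equalises[OF c(1)] using c(2) \<phi>(2) by simp
    then show "lift_through V e ?c \<in> hom V ?a E" "e \<cdot> lift_through V e ?c = ?c"
      using lift[OF _ c(1)] A by simp_all
    then show "?ev \<cdot> ((e \<cdot> lift_through V e ?c) \<boxtimes> Ide V M) = \<phi>"
      using c(2) by simp
  qed
  show ?thesis
  proof (rule bij_betw_byWitness[where f' = "\<lambda>k. ?ev \<cdot> ((e \<cdot> k) \<boxtimes> Ide V M)"])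
    show "\<forall>\<phi>\<in>module_actions A B M m.
        ?ev \<cdot> ((e \<cdot> lift_through V e (curry_arrow V ?a M M \<phi>)) \<boxtimes> Ide V M) = \<phi>"
      using lift_curry(3) by blast
    show "(\<lambda>\<phi>. lift_through V e (curry_arrow V ?a M M \<phi>)) ` module_actions A B M m \<subseteq> monoid_hom V A ?N"
    proof (rule image_subsetI)
      fix \<phi> assume \<phi>: "\<phi> \<in> module_actions A B M m"
      show "lift_through V e (curry_arrow V ?a M M \<phi>) \<in> monoid_hom V A ?N"
        unfolding key[OF lift_curry(1)[OF \<phi>]] lift_curry(3)[OF \<phi>] by (rule \<phi>)
    qed
    have N_hom: "k \<in> hom V ?a E" if "k \<in> monoid_hom V A ?N" for k
      using that by (simp add: monoid_hom_def)
    show "(\<lambda>k. ?ev \<cdot> ((e \<cdot> k) \<boxtimes> Ide V M)) ` monoid_hom V A ?N \<subseteq> module_actions A B M m"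
      using key N_hom by blast
    show "\<forall>k\<in>monoid_hom V A ?N.
        lift_through V e (curry_arrow V ?a M M (?ev \<cdot> ((e \<cdot> k) \<boxtimes> Ide V M))) = k"
    proof
      fix k assume k: "k \<in> monoid_hom V A ?N"
      let ?\<phi> = "?ev \<cdot> ((e \<cdot> k) \<boxtimes> Ide V M)"
      have \<phi>: "?\<phi> \<in> module_actions A B M m"
        using key[OF N_hom[OF k]] k by simp
      have kE: "k \<in> hom V ?a E"
        by (rule N_hom[OF k])
      have "e \<cdot> lift_through V e (curry_arrow V ?a M M ?\<phi>) = e \<cdot> k"
        by (rule Ev_cancel[OF M M _ _ lift_curry(3)[OF \<phi>]])
          (use kE lift_curry(1)[OF \<phi>] in \<open>simp_all add: hom_iff\<close>)
      then show "lift_through V e (curry_arrow V ?a M M ?\<phi>) = k"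
        by (rule mono[OF lift_curry(1)[OF \<phi>] kE])
    qed
  qed
qed

section \<open>Free modules and algebras for the lifted monad\<close>

lemma right_module_free:
  assumes B: "monoid_in V B" and X: "X \<in> Obj V"
  shows "right_module V B (free_module V B X)"
proof -
  let ?x = "\<langle>X\<rangle>" and ?b = "\<langle>MCar B\<rangle>"
  let ?m = "Box (?b \<odot> ?b) (Mul B) ?b" and ?u = "Box Nul (Uni B) ?b"
  let ?n = "(Id ?x \<parallel> ?m) \<bullet> Asc ?x ?b ?b"
  have mh: "hat (?b \<odot> ?b) (Mul B) ?b = mul_hat B" "hat Nul (Uni B) ?b = uni_hat B"
    by (auto simp: mul_hat_def uni_hat_def)
  have "eval (?n \<bullet> (?n \<parallel> Id ?b)) = eval (?n \<bullet> (Id (?x \<odot> ?b) \<parallel> ?m) \<bullet> Asc (?x \<odot> ?b) ?b ?b)"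
    by (rule eval_eq_iff[THEN iffD2])
      (use B X in \<open>simp_all add: mh mul_hat_laws flip: Ide_TensM_Cmp\<close>)
  moreover have "eval (?n \<bullet> (Id (?x \<odot> ?b) \<parallel> ?u)) = eval (RU (?x \<odot> ?b))"
    by (rule eval_eq_iff[THEN iffD2])
      (use B X in \<open>simp_all add: mh mul_hat_laws flip: Ide_TensM_Cmp\<close>)
  ultimately show ?thesis
    using B X by (simp add: right_module_def free_module_def hom_iff)
qed

text \<open>Needed for the lifted monad to act on modules at all. Strictly, the axioms for Y
  \<otimes> M are those for M whiskered by Y.\<close>

lemma right_module_tensor:
  assumes B: "monoid_in V B" and Y: "Y \<in> Obj V" and mod: "right_module V B (M, m)"
  shows "right_module V B (tensor_module V B Y (M, m))"
proof -
  let ?y = "\<langle>Y\<rangle>" and ?b = "\<langle>MCar B\<rangle>" and ?n = "\<langle>M\<rangle>"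
  let ?m = "Box (?n \<odot> ?b) m ?n" and ?p = "Box (?b \<odot> ?b) (Mul B) ?b" and ?u = "Box Nul (Uni B) ?b"
  have M: "M \<in> Obj V" and m: "m \<in> hom V (M \<otimes> MCar B) M"
    and eqs: "m \<cdot> (m \<boxtimes> Ide V (MCar B)) = m \<cdot> (Ide V M \<boxtimes> Mul B) \<cdot> Assoc V M (MCar B) (MCar B)"
      "m \<cdot> (Ide V M \<boxtimes> Uni B) = RUnit V M"
    using mod by (auto simp: right_module_def)
  have hats: "interp (?m \<bullet> (?m \<parallel> Id ?b)) Z = interp (?m \<bullet> (Id ?n \<parallel> ?p) \<bullet> Asc ?n ?b ?b) Z"
    "interp (?m \<bullet> (Id ?n \<parallel> ?u)) Z = interp (RU ?n) Z" if "Z \<in> Obj V" for Z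
    by (rule interp_eqI; use that B M m eqs in simp)+
  let ?t = "(Id ?y \<parallel> ?m) \<bullet> Asc ?y ?n ?b"
  have "eval (?t \<bullet> (?t \<parallel> Id ?b)) = eval (?t \<bullet> (Id (?y \<odot> ?n) \<parallel> ?p) \<bullet> Asc (?y \<odot> ?n) ?b ?b)"
    by (rule eval_eq_iff[THEN iffD2]) (use B Y M m hats in \<open>simp_all flip: Ide_TensM_Cmp\<close>)
  moreover have "eval (?t \<bullet> (Id (?y \<odot> ?n) \<parallel> ?u)) = eval (RU (?y \<odot> ?n))"
    by (rule eval_eq_iff[THEN iffD2]) (use B Y M m hats in \<open>simp_all flip: Ide_TensM_Cmp\<close>)
  ultimately show ?thesis
    using B Y M m by (simp add: right_module_def tensor_module_def hom_iff)
qed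

text \<open>Linearity is what makes \<phi> an arrow of the category of modules. The algebra
  equations are then the action axioms, up to an associator and a unitor moved across.\<close>

lemma bij_module_algebras:
  assumes A: "monoid_in V A" and B: "monoid_in V B" and mod: "right_module V B (M, m)"
  shows "bij_betw (\<lambda>\<phi>. (tensor_module V B (MCar A) (M, m), \<phi>, (M, m))) (module_actions A B M m)
    (algebra_structures (modules V B) (module_monad V A B) (M, m))"
proof -
  let ?a = "MCar A" and ?b = "MCar B" and ?T = "tensor_module V B (MCar A)"
  have M: "M \<in> Obj V" and m: "m \<in> hom V (M \<otimes> ?b) M"
    using mod by (auto simp: right_module_def)
  have [simp]: "m \<in> Mor V" "Dom V m = M \<otimes> ?b" "Cod V m = M"
    using m by (auto simp: hom_iff)
  let ?A = "algebra_structures (modules V B) (module_monad V A B) (M, m)"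
  have T: "right_module V B (?a \<otimes> M, (Ide V ?a \<boxtimes> m) \<cdot> Assoc V ?a M ?b)"
    using right_module_tensor[OF B _ mod, of ?a] A by (simp add: tensor_module_def)
  have TObj_eq: "TObj (module_monad V A B) = ?T"
    by (simp add: module_monad_def Let_def)
  have homs: "(?T (M, m), \<phi>, (M, m)) \<in> hom (modules V B) (?T (M, m)) (M, m) \<longleftrightarrow>
      \<phi> \<in> hom V (?a \<otimes> M) M \<and> \<phi> \<cdot> (Ide V ?a \<boxtimes> m) \<cdot> Assoc V ?a M ?b = m \<cdot> (\<phi> \<boxtimes> Ide V ?b)" for \<phi>
    using T mod by (auto simp: hom_def modules_def tensor_module_def)
  have iff: "(?T (M, m), \<phi>, (M, m)) \<in> ?A \<longleftrightarrow> \<phi> \<in> module_actions A B M m" for \<phi>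
  proof (cases "(?T (M, m), \<phi>, (M, m)) \<in> hom (modules V B) (?T (M, m)) (M, m)")
    case True
    then have \<phi>: "\<phi> \<in> hom V (?a \<otimes> M) M" "\<phi> \<cdot> (Ide V ?a \<boxtimes> m) \<cdot> Assoc V ?a M ?b = m \<cdot> (\<phi> \<boxtimes> Ide V ?b)"
      using homs by auto
    then have [simp]: "\<phi> \<in> Mor V" "Dom V \<phi> = ?a \<otimes> M" "Cod V \<phi> = M"
      by (auto simp: hom_iff)
    have 1: "\<phi> \<cdot> (Mul A \<boxtimes> Ide V M) \<cdot> AssocI ?a ?a M = \<phi> \<cdot> (Ide V ?a \<boxtimes> \<phi>) \<longleftrightarrow>
        \<phi> \<cdot> (Mul A \<boxtimes> Ide V M) = \<phi> \<cdot> (Ide V ?a \<boxtimes> \<phi>) \<cdot> Assoc V ?a ?a M"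
    proof
      assume *: "\<phi> \<cdot> (Mul A \<boxtimes> Ide V M) \<cdot> AssocI ?a ?a M = \<phi> \<cdot> (Ide V ?a \<boxtimes> \<phi>)"
      have "\<phi> \<cdot> (Ide V ?a \<boxtimes> \<phi>) \<cdot> Assoc V ?a ?a M = (\<phi> \<cdot> (Ide V ?a \<boxtimes> \<phi>)) \<cdot> Assoc V ?a ?a M"
        using A M by simp
      then show "\<phi> \<cdot> (Mul A \<boxtimes> Ide V M) = \<phi> \<cdot> (Ide V ?a \<boxtimes> \<phi>) \<cdot> Assoc V ?a ?a M"
        unfolding *[symmetric] using A M by simp
    next
      assume *: "\<phi> \<cdot> (Mul A \<boxtimes> Ide V M) = \<phi> \<cdot> (Ide V ?a \<boxtimes> \<phi>) \<cdot> Assoc V ?a ?a M"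
      have "\<phi> \<cdot> (Mul A \<boxtimes> Ide V M) \<cdot> AssocI ?a ?a M = (\<phi> \<cdot> (Mul A \<boxtimes> Ide V M)) \<cdot> AssocI ?a ?a M"
        using A M by simp
      then show "\<phi> \<cdot> (Mul A \<boxtimes> Ide V M) \<cdot> AssocI ?a ?a M = \<phi> \<cdot> (Ide V ?a \<boxtimes> \<phi>)"
        unfolding * using A M by simp
    qed
    have 2: "\<phi> \<cdot> (Uni A \<boxtimes> Ide V M) \<cdot> LUnitI M = Ide V M \<longleftrightarrow> \<phi> \<cdot> (Uni A \<boxtimes> Ide V M) = LUnit V M"
    proof
      assume *: "\<phi> \<cdot> (Uni A \<boxtimes> Ide V M) \<cdot> LUnitI M = Ide V M"
      have "\<phi> \<cdot> (Uni A \<boxtimes> Ide V M) = (\<phi> \<cdot> (Uni A \<boxtimes> Ide V M) \<cdot> LUnitI M) \<cdot> LUnit V M"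
        using A M by simp
      then show "\<phi> \<cdot> (Uni A \<boxtimes> Ide V M) = LUnit V M"
        unfolding * using M by simp
    next
      assume *: "\<phi> \<cdot> (Uni A \<boxtimes> Ide V M) = LUnit V M"
      have "\<phi> \<cdot> (Uni A \<boxtimes> Ide V M) \<cdot> LUnitI M = (\<phi> \<cdot> (Uni A \<boxtimes> Ide V M)) \<cdot> LUnitI M"
        using A M by simp
      then show "\<phi> \<cdot> (Uni A \<boxtimes> Ide V M) \<cdot> LUnitI M = Ide V M"
        unfolding * using M by simp
    qed
    have "(?T (M, m), \<phi>, (M, m)) \<in> ?A \<longleftrightarrow>
        \<phi> \<cdot> (Mul A \<boxtimes> Ide V M) \<cdot> AssocI ?a ?a M = \<phi> \<cdot> (Ide V ?a \<boxtimes> \<phi>) \<and>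
        \<phi> \<cdot> (Uni A \<boxtimes> Ide V M) \<cdot> LUnitI M = Ide V M"
      using True unfolding algebra_structures_def mem_Collect_eq TObj_eq
      by (simp add: module_monad_def modules_def tensor_module_def Let_def)
    then show ?thesis
      unfolding 1 2 using \<phi> by (simp add: module_actions_def)
  next
    case False
    then show ?thesis
      by (auto simp: algebra_structures_def TObj_eq module_actions_def homs)
  qed
  \<comment> \<open>Arrows of \<open>modules\<close> record their source and target, which the
    algebra type fixes; only the middle component is free.\<close>
  have "p \<in> (\<lambda>\<phi>. (?T (M, m), \<phi>, (M, m))) ` module_actions A B M m" if "p \<in> ?A" for p
  proof -
    have "p \<in> hom (modules V B) (?T (M, m)) (M, m)"
      using that by (simp add: algebra_structures_def TObj_eq)
    then obtain \<phi> where "p = (?T (M, m), \<phi>, (M, m))"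
      by (cases p) (auto simp: hom_def modules_def)
    then show ?thesis
      using that iff by blast
  qed
  then show ?thesis
    unfolding bij_betw_def using iff by (auto simp: inj_on_def)
qed

lemma extend_to_free_hat:
  assumes A: "monoid_in V A" and B: "monoid_in V B" and X: "X \<in> Obj V"
    and \<psi>: "\<psi> \<in> hom V (MCar A \<otimes> X) (X \<otimes> MCar B)" and Z: "Z \<in> Obj V"
  shows "hat (\<langle>MCar A\<rangle> \<odot> \<langle>X\<rangle> \<odot> \<langle>MCar B\<rangle>) (extend_to_free V A B X \<psi>) (\<langle>X\<rangle> \<odot> \<langle>MCar B\<rangle>) Z =
    (Ide V X \<boxtimes> mul_hat B Z) \<cdot> twist_hat A B X \<psi> (MCar B \<otimes> Z)"
proof -
  let ?a = "\<langle>MCar A\<rangle>" and ?b = "\<langle>MCar B\<rangle>" and ?x = "\<langle>X\<rangle>"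
  let ?d = "(Id ?x \<parallel> Box (?b \<odot> ?b) (Mul B) ?b) \<bullet> Asc ?x ?b ?b \<bullet>
      (Box (?a \<odot> ?x) \<psi> (?x \<odot> ?b) \<parallel> Id ?b) \<bullet> AscI ?a ?x ?b"
  have "hat (?a \<odot> ?x \<odot> ?b) (extend_to_free V A B X \<psi>) (?x \<odot> ?b) Z = interp ?d Z"
    by (rule hat_eqI) (use A B X \<psi> Z in \<open>simp_all add: extend_to_free_def\<close>)
  then show ?thesis
    using A B X \<psi> Z by (simp add: mul_hat_def twist_hat_def)
qed

lemma extend_to_free_in:
  assumes "monoid_in V A" "monoid_in V B" "X \<in> Obj V" "\<psi> \<in> hom V (MCar A \<otimes> X) (X \<otimes> MCar B)"
  shows "extend_to_free V A B X \<psi> \<in> hom V (MCar A \<otimes> (X \<otimes> MCar B)) (X \<otimes> MCar B)"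
  using assms by (simp add: extend_to_free_def hom_iff)

text \<open>Puts associativity, unit law and linearity into the strict form of
  \<open>twisted_actions_iff\<close>, so that the two can be compared tail by tail.\<close>

lemma free_module_actions_iff:
  assumes A: "monoid_in V A" and B: "monoid_in V B" and X: "X \<in> Obj V"
    and \<phi>: "\<phi> \<in> hom V (MCar A \<otimes> (X \<otimes> MCar B)) (X \<otimes> MCar B)"
  defines "h \<equiv> hat (\<langle>MCar A\<rangle> \<odot> \<langle>X\<rangle> \<odot> \<langle>MCar B\<rangle>) \<phi> (\<langle>X\<rangle> \<odot> \<langle>MCar B\<rangle>)"
  shows "\<phi> \<in> module_actions A B (X \<otimes> MCar B) ((Ide V X \<boxtimes> Mul B) \<cdot> Assoc V X (MCar B) (MCar B)) \<longleftrightarrow>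
    (\<forall>Z\<in>Obj V. h Z \<cdot> mul_hat A (X \<otimes> (MCar B \<otimes> Z)) = h Z \<cdot> (Ide V (MCar A) \<boxtimes> h Z)) \<and>
    (\<forall>Z\<in>Obj V. h Z \<cdot> uni_hat A (X \<otimes> (MCar B \<otimes> Z)) = Ide V (X \<otimes> (MCar B \<otimes> Z))) \<and>
    (\<forall>Z\<in>Obj V. h Z \<cdot> (Ide V (MCar A) \<boxtimes> (Ide V X \<boxtimes> mul_hat B Z)) =
       (Ide V X \<boxtimes> mul_hat B Z) \<cdot> h (MCar B \<otimes> Z))"
proof -
  let ?a = "\<langle>MCar A\<rangle>" and ?b = "\<langle>MCar B\<rangle>" and ?x = "\<langle>X\<rangle>"
  let ?xb = "?x \<odot> ?b"
  let ?m = "(Id ?x \<parallel> Box (?b \<odot> ?b) (Mul B) ?b) \<bullet> Asc ?x ?b ?b"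
  let ?f = "Box (?a \<odot> ?xb) \<phi> ?xb"
  have 1: "eval (?f \<bullet> (Box (?a \<odot> ?a) (Mul A) ?a \<parallel> Id ?xb)) =
      eval (?f \<bullet> (Id ?a \<parallel> ?f) \<bullet> Asc ?a ?a ?xb) \<longleftrightarrow>
      (\<forall>Z\<in>Obj V. interp (?f \<bullet> (Box (?a \<odot> ?a) (Mul A) ?a \<parallel> Id ?xb)) Z =
        interp (?f \<bullet> (Id ?a \<parallel> ?f) \<bullet> Asc ?a ?a ?xb) Z)"
    by (rule eval_eq_iff) (use A B X \<phi> in simp_all)
  have 2: "eval (?f \<bullet> (Box Nul (Uni A) ?a \<parallel> Id ?xb)) = eval (LU ?xb) \<longleftrightarrow>
      (\<forall>Z\<in>Obj V. interp (?f \<bullet> (Box Nul (Uni A) ?a \<parallel> Id ?xb)) Z = interp (LU ?xb) Z)"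
    by (rule eval_eq_iff) (use A B X \<phi> in simp_all)
  have 3: "eval (?f \<bullet> (Id ?a \<parallel> ?m) \<bullet> Asc ?a ?xb ?b) = eval (?m \<bullet> (?f \<parallel> Id ?b)) \<longleftrightarrow>
      (\<forall>Z\<in>Obj V. interp (?f \<bullet> (Id ?a \<parallel> ?m) \<bullet> Asc ?a ?xb ?b) Z = interp (?m \<bullet> (?f \<parallel> Id ?b)) Z)"
    by (rule eval_eq_iff) (use A B X \<phi> in simp_all)
  have mh: "hat (?b \<odot> ?b) (Mul B) ?b = mul_hat B" "hat (?a \<odot> ?a) (Mul A) ?a = mul_hat A"
    "hat Nul (Uni A) ?a = uni_hat A" "hat (?a \<odot> ?xb) \<phi> ?xb = h"
    by (auto simp: mul_hat_def uni_hat_def h_def)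
  have h: "h Z \<in> Mor V" "Dom V (h Z) = MCar A \<otimes> (X \<otimes> (MCar B \<otimes> Z))" "Cod V (h Z) = X \<otimes> (MCar B \<otimes> Z)"
    if "Z \<in> Obj V" for Z
    using A B X \<phi> that by (simp_all add: h_def)
  show ?thesis
    using 1 2 3 A B X \<phi> by (simp add: module_actions_def mh h)
qed

text \<open>The universal property of the free module X \<otimes> B, with A as a parameter.
  Extension is not onto all arrows A \<otimes> (X \<otimes> B) \<rightarrow> X \<otimes> B, so
  restriction is shown to invert it on the bimodule structures.\<close>

lemma bij_extend_to_free:
  assumes A: "monoid_in V A" and B: "monoid_in V B" and X: "X \<in> Obj V"
  shows "bij_betw (extend_to_free V A B X) (twisted_actions V A B X)
    (module_actions A B (X \<otimes> MCar B) ((Ide V X \<boxtimes> Mul B) \<cdot> Assoc V X (MCar B) (MCar B)))"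
    (is "bij_betw ?ext ?Tw ?Ac")
proof -
  let ?a = "MCar A" and ?b = "MCar B"
  let ?ta = "\<langle>MCar A\<rangle>" and ?tb = "\<langle>MCar B\<rangle>" and ?tx = "\<langle>X\<rangle>"
  let ?xb = "?tx \<odot> ?tb"
  define res where "res \<phi> = \<phi> \<cdot> (Ide V ?a \<boxtimes> ((Ide V X \<boxtimes> Uni B) \<cdot> RUnitI X))" for \<phi>
  have mh: "hat (?tb \<odot> ?tb) (Mul B) ?tb = mul_hat B" "hat Nul (Uni B) ?tb = uni_hat B"
    by (auto simp: mul_hat_def uni_hat_def)
  have res_in: "res \<phi> \<in> hom V (?a \<otimes> X) (X \<otimes> ?b)" if "\<phi> \<in> hom V (?a \<otimes> (X \<otimes> ?b)) (X \<otimes> ?b)" for \<phi>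
    using A B X that by (simp add: res_def hom_iff)
  have res_hat: "twist_hat A B X (res \<phi>) Z =
      hat (?ta \<odot> ?xb) \<phi> ?xb Z \<cdot> (Ide V ?a \<boxtimes> (Ide V X \<boxtimes> uni_hat B Z))"
    if \<phi>: "\<phi> \<in> hom V (?a \<otimes> (X \<otimes> ?b)) (X \<otimes> ?b)" and Z: "Z \<in> Obj V" for \<phi> Z
  proof -
    let ?d = "Box (?ta \<odot> ?xb) \<phi> ?xb \<bullet> (Id ?ta \<parallel> ((Id ?tx \<parallel> Box Nul (Uni B) ?tb) \<bullet> RUI ?tx))"
    have "twist_hat A B X (res \<phi>) Z = interp ?d Z"
      unfolding twist_hat_def by (rule hat_eqI) (use A B X \<phi> Z in \<open>simp_all add: res_def\<close>)
    then show ?thesis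
      using A B X \<phi> Z by (simp add: mh)
  qed
  have ext_in: "?ext \<psi> \<in> hom V (?a \<otimes> (X \<otimes> ?b)) (X \<otimes> ?b)" if "\<psi> \<in> hom V (?a \<otimes> X) (X \<otimes> ?b)" for \<psi>
    using extend_to_free_in[OF A B X that] .
  have res_ext: "res (?ext \<psi>) = \<psi>" if \<psi>: "\<psi> \<in> hom V (?a \<otimes> X) (X \<otimes> ?b)" for \<psi>
  proof -
    have "eval (Box (?ta \<odot> ?tx) (res (?ext \<psi>)) ?xb) = eval (Box (?ta \<odot> ?tx) \<psi> ?xb)"
    proof (rule eval_eq_iff[THEN iffD2], safe)
      fix Z assume Z: "Z \<in> Obj V"
      have "twist_hat A B X (res (?ext \<psi>)) Z = (Ide V X \<boxtimes> mul_hat B Z) \<cdot>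
          (twist_hat A B X \<psi> (?b \<otimes> Z) \<cdot> (Ide V ?a \<boxtimes> (Ide V X \<boxtimes> uni_hat B Z)))"
        using A B X \<psi> Z by (simp add: res_hat ext_in extend_to_free_hat)
      also have "\<dots> = (Ide V X \<boxtimes> (mul_hat B Z \<cdot> (Ide V ?b \<boxtimes> uni_hat B Z))) \<cdot> twist_hat A B X \<psi> Z"
        using A B X \<psi> Z by (simp add: twist_hat_natural Ide_TensM_Cmp)
      finally show "interp (Box (?ta \<odot> ?tx) (res (?ext \<psi>)) ?xb) Z = interp (Box (?ta \<odot> ?tx) \<psi> ?xb) Z"
        using A B X \<psi> Z by (simp add: mul_hat_laws twist_hat_def)
    qed (use A B X \<psi> in \<open>simp_all add: res_in ext_in\<close>)
    then show ?thesis
      by simp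
  qed
  \<comment> \<open>This direction needs linearity of \<phi>: the multiplication of B is pulled
    inside \<phi>, where it absorbs the inserted unit.\<close>
  have ext_res: "?ext (res \<phi>) = \<phi>" if ac: "\<phi> \<in> ?Ac" for \<phi>
  proof -
    have \<phi>: "\<phi> \<in> hom V (?a \<otimes> (X \<otimes> ?b)) (X \<otimes> ?b)"
      using ac by (simp add: module_actions_def)
    let ?h = "hat (?ta \<odot> ?xb) \<phi> ?xb"
    have lin: "?h Z \<cdot> (Ide V ?a \<boxtimes> (Ide V X \<boxtimes> mul_hat B Z)) = (Ide V X \<boxtimes> mul_hat B Z) \<cdot> ?h (?b \<otimes> Z)"
      if "Z \<in> Obj V" for Z
      using ac that unfolding free_module_actions_iff[OF A B X \<phi>] by blast
    have "eval (Box (?ta \<odot> ?xb) (?ext (res \<phi>)) ?xb) = eval (Box (?ta \<odot> ?xb) \<phi> ?xb)"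
    proof (rule eval_eq_iff[THEN iffD2], safe)
      fix Z assume Z: "Z \<in> Obj V"
      have "hat (?ta \<odot> ?xb) (?ext (res \<phi>)) ?xb Z =
          ((Ide V X \<boxtimes> mul_hat B Z) \<cdot> ?h (?b \<otimes> Z)) \<cdot> (Ide V ?a \<boxtimes> (Ide V X \<boxtimes> uni_hat B (?b \<otimes> Z)))"
        using A B X \<phi> Z by (simp add: res_hat res_in extend_to_free_hat)
      also have "\<dots> = ?h Z \<cdot> (Ide V ?a \<boxtimes> (Ide V X \<boxtimes> (mul_hat B Z \<cdot> uni_hat B (?b \<otimes> Z))))"
        unfolding lin[OF Z, symmetric] using A B X \<phi> Z by (simp add: Ide_TensM_Cmp)
      finally show "interp (Box (?ta \<odot> ?xb) (?ext (res \<phi>)) ?xb) Z = interp (Box (?ta \<odot> ?xb) \<phi> ?xb) Z"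
        using A B X \<phi> Z by (simp add: mul_hat_laws)
    qed (use A B X \<phi> in \<open>simp_all add: res_in ext_in\<close>)
    then show ?thesis
      by simp
  qed
  have ext_ac: "?ext \<psi> \<in> ?Ac" if tw: "\<psi> \<in> ?Tw" for \<psi>
  proof -
    have \<psi>: "\<psi> \<in> hom V (?a \<otimes> X) (X \<otimes> ?b)"
      using tw by (simp add: twisted_actions_def)
    let ?p = "twist_hat A B X \<psi>"
    have mul: "(Ide V X \<boxtimes> mul_hat B Z) \<cdot> ?p (?b \<otimes> Z) \<cdot> (Ide V ?a \<boxtimes> ?p Z) = ?p Z \<cdot> mul_hat A (X \<otimes> Z)"
      and uni: "?p Z \<cdot> uni_hat A (X \<otimes> Z) = Ide V X \<boxtimes> uni_hat B Z" if "Z \<in> Obj V" for Z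
      using tw that unfolding twisted_actions_iff[OF A B X] by blast+
    show ?thesis
      unfolding free_module_actions_iff[OF A B X ext_in[OF \<psi>]]
    proof (intro conjI ballI)
      fix Z assume Z: "Z \<in> Obj V"
      let ?m = "mul_hat B Z" and ?p' = "?p (?b \<otimes> Z)" and ?p'' = "?p (?b \<otimes> ?b \<otimes> Z)"
      have h: "hat (?ta \<odot> ?xb) (?ext \<psi>) ?xb Z = (Ide V X \<boxtimes> ?m) \<cdot> ?p'"
        "hat (?ta \<odot> ?xb) (?ext \<psi>) ?xb (?b \<otimes> Z) = (Ide V X \<boxtimes> mul_hat B (?b \<otimes> Z)) \<cdot> ?p''"
        using A B X \<psi> Z by (simp_all add: extend_to_free_hat)
      \<comment> \<open>In two successive extensions the inner multiplication lies in the tail of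
        the outer \<psi> and can pass it. With associativity of B, what remains is the twisted axiom
        at the tail B \<otimes> Z.\<close>
      have nat: "?p' \<cdot> (Ide V ?a \<boxtimes> (Ide V X \<boxtimes> ?m)) = (Ide V X \<boxtimes> (Ide V ?b \<boxtimes> ?m)) \<cdot> ?p''"
        using A B X \<psi> Z by (simp add: twist_hat_natural)
      have asc: "(Ide V X \<boxtimes> ?m) \<cdot> (Ide V X \<boxtimes> (Ide V ?b \<boxtimes> ?m)) =
          (Ide V X \<boxtimes> ?m) \<cdot> (Ide V X \<boxtimes> mul_hat B (?b \<otimes> Z))"
        using B X Z by (simp add: mul_hat_laws flip: Ide_TensM_Cmp)
      have "((Ide V X \<boxtimes> ?m) \<cdot> ?p') \<cdot> (Ide V ?a \<boxtimes> ((Ide V X \<boxtimes> ?m) \<cdot> ?p')) =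
          (Ide V X \<boxtimes> ?m) \<cdot> (?p' \<cdot> (Ide V ?a \<boxtimes> (Ide V X \<boxtimes> ?m))) \<cdot> (Ide V ?a \<boxtimes> ?p')"
        using A B X \<psi> Z by (simp add: Ide_TensM_Cmp)
      also have "\<dots> = ((Ide V X \<boxtimes> ?m) \<cdot> (Ide V X \<boxtimes> (Ide V ?b \<boxtimes> ?m))) \<cdot> ?p'' \<cdot> (Ide V ?a \<boxtimes> ?p')"
        unfolding nat using A B X \<psi> Z by simp
      also have "\<dots> = (Ide V X \<boxtimes> ?m) \<cdot> ((Ide V X \<boxtimes> mul_hat B (?b \<otimes> Z)) \<cdot> ?p'' \<cdot> (Ide V ?a \<boxtimes> ?p'))"
        unfolding asc using A B X \<psi> Z by simp
      also have "(Ide V X \<boxtimes> mul_hat B (?b \<otimes> Z)) \<cdot> ?p'' \<cdot> (Ide V ?a \<boxtimes> ?p') = ?p' \<cdot> mul_hat A (X \<otimes> (?b \<otimes> Z))"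
        using B Z by (intro mul) simp
      finally show "hat (?ta \<odot> ?xb) (?ext \<psi>) ?xb Z \<cdot> mul_hat A (X \<otimes> (?b \<otimes> Z)) =
          hat (?ta \<odot> ?xb) (?ext \<psi>) ?xb Z \<cdot> (Ide V ?a \<boxtimes> hat (?ta \<odot> ?xb) (?ext \<psi>) ?xb Z)"
        unfolding h using A B X \<psi> Z by simp
      show "hat (?ta \<odot> ?xb) (?ext \<psi>) ?xb Z \<cdot> uni_hat A (X \<otimes> (?b \<otimes> Z)) = Ide V (X \<otimes> (?b \<otimes> Z))"
        unfolding h using A B X \<psi> Z by (simp add: uni mul_hat_laws flip: Ide_TensM_Cmp)
      have "((Ide V X \<boxtimes> ?m) \<cdot> ?p') \<cdot> (Ide V ?a \<boxtimes> (Ide V X \<boxtimes> ?m)) =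
          (Ide V X \<boxtimes> ?m) \<cdot> (?p' \<cdot> (Ide V ?a \<boxtimes> (Ide V X \<boxtimes> ?m)))"
        using A B X \<psi> Z by simp
      also have "\<dots> = ((Ide V X \<boxtimes> ?m) \<cdot> (Ide V X \<boxtimes> (Ide V ?b \<boxtimes> ?m))) \<cdot> ?p''"
        unfolding nat using A B X \<psi> Z by simp
      also have "\<dots> = (Ide V X \<boxtimes> ?m) \<cdot> (Ide V X \<boxtimes> mul_hat B (?b \<otimes> Z)) \<cdot> ?p''"
        unfolding asc using A B X \<psi> Z by simp
      finally show "hat (?ta \<odot> ?xb) (?ext \<psi>) ?xb Z \<cdot> (Ide V ?a \<boxtimes> (Ide V X \<boxtimes> ?m)) =
          (Ide V X \<boxtimes> ?m) \<cdot> hat (?ta \<odot> ?xb) (?ext \<psi>) ?xb (?b \<otimes> Z)"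
        unfolding h .
    qed
  qed
  have res_tw: "res \<phi> \<in> ?Tw" if ac: "\<phi> \<in> ?Ac" for \<phi>
  proof -
    have \<phi>: "\<phi> \<in> hom V (?a \<otimes> (X \<otimes> ?b)) (X \<otimes> ?b)"
      using ac by (simp add: module_actions_def)
    let ?h = "hat (?ta \<odot> ?xb) \<phi> ?xb" and ?p = "twist_hat A B X (res \<phi>)"
    have [simp]: "?h Z \<in> Mor V" "Dom V (?h Z) = ?a \<otimes> (X \<otimes> (?b \<otimes> Z))" "Cod V (?h Z) = X \<otimes> (?b \<otimes> Z)"
      if "Z \<in> Obj V" for Z
      using A B X \<phi> that by simp_all
    have mul: "?h Z \<cdot> mul_hat A (X \<otimes> (?b \<otimes> Z)) = ?h Z \<cdot> (Ide V ?a \<boxtimes> ?h Z)"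
      and uni: "?h Z \<cdot> uni_hat A (X \<otimes> (?b \<otimes> Z)) = Ide V (X \<otimes> (?b \<otimes> Z))" if "Z \<in> Obj V" for Z
      using ac that unfolding free_module_actions_iff[OF A B X \<phi>] by blast+
    \<comment> \<open>Being the extension of its own restriction, \<phi> can be expressed through
      \<psi>; this produces the multiplication of B in the twisted axiom.\<close>
    have h: "?h Z = (Ide V X \<boxtimes> mul_hat B Z) \<cdot> ?p (?b \<otimes> Z)" if "Z \<in> Obj V" for Z
      using extend_to_free_hat[OF A B X res_in[OF \<phi>] that] ext_res[OF ac] by simp
    show ?thesis
      unfolding twisted_actions_iff[OF A B X]
    proof (intro conjI ballI res_in[OF \<phi>])
      fix Z assume Z: "Z \<in> Obj V"
      let ?u = "Ide V X \<boxtimes> uni_hat B Z"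
      have p: "?p Z = ?h Z \<cdot> (Ide V ?a \<boxtimes> ?u)"
        using \<phi> Z by (rule res_hat)
      have "?p Z \<cdot> mul_hat A (X \<otimes> Z) = ?h Z \<cdot> ((Ide V ?a \<boxtimes> ?u) \<cdot> mul_hat A (X \<otimes> Z))"
        unfolding p using A B X Z by simp
      also have "(Ide V ?a \<boxtimes> ?u) \<cdot> mul_hat A (X \<otimes> Z) =
          mul_hat A (X \<otimes> (?b \<otimes> Z)) \<cdot> (Ide V ?a \<boxtimes> (Ide V ?a \<boxtimes> ?u))"
        using A B X Z by (simp add: mul_hat_natural)
      also have "?h Z \<cdot> (mul_hat A (X \<otimes> (?b \<otimes> Z)) \<cdot> (Ide V ?a \<boxtimes> (Ide V ?a \<boxtimes> ?u))) =
          (?h Z \<cdot> mul_hat A (X \<otimes> (?b \<otimes> Z))) \<cdot> (Ide V ?a \<boxtimes> (Ide V ?a \<boxtimes> ?u))"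
        using A B X Z by simp
      also have "\<dots> = ?h Z \<cdot> (Ide V ?a \<boxtimes> ?p Z)"
        unfolding mul[OF Z] p using A B X Z by (simp add: Ide_TensM_Cmp)
      also have "\<dots> = ((Ide V X \<boxtimes> mul_hat B Z) \<cdot> ?p (?b \<otimes> Z)) \<cdot> (Ide V ?a \<boxtimes> ?p Z)"
        using h[OF Z] by simp
      finally show "(Ide V X \<boxtimes> mul_hat B Z) \<cdot> ?p (?b \<otimes> Z) \<cdot> (Ide V ?a \<boxtimes> ?p Z) = ?p Z \<cdot> mul_hat A (X \<otimes> Z)"
        using A B X Z res_in[OF \<phi>] by simp
      have "?p Z \<cdot> uni_hat A (X \<otimes> Z) = ?h Z \<cdot> ((Ide V ?a \<boxtimes> ?u) \<cdot> uni_hat A (X \<otimes> Z))"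
        unfolding p using A B X Z by simp
      also have "(Ide V ?a \<boxtimes> ?u) \<cdot> uni_hat A (X \<otimes> Z) = uni_hat A (X \<otimes> (?b \<otimes> Z)) \<cdot> ?u"
        using A B X Z by (subst uni_hat_natural) simp_all
      also have "?h Z \<cdot> (uni_hat A (X \<otimes> (?b \<otimes> Z)) \<cdot> ?u) = (?h Z \<cdot> uni_hat A (X \<otimes> (?b \<otimes> Z))) \<cdot> ?u"
        using A B X Z by simp
      also have "\<dots> = ?u"
        unfolding uni[OF Z] using A B X Z by simp
      finally show "?p Z \<cdot> uni_hat A (X \<otimes> Z) = ?u" .
    qed
  qed
  have "\<forall>\<psi>\<in>?Tw. res (?ext \<psi>) = \<psi>"
    using res_ext by (auto simp: twisted_actions_def)
  then show ?thesis
    using ext_res ext_ac res_tw by (intro bij_betw_byWitness[where f' = res]) auto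
qed

end

section \<open>Measurings and comodules\<close>

context braided_monoidal_closed
begin

text \<open>Sweedler's measurings: monoid morphisms A \<rightarrow> [C, B] in transposed form, free
  of internal homs.\<close>

definition measurings :: "('o, 'm) mon \<Rightarrow> ('o, 'm) comon \<Rightarrow> ('o, 'm) mon \<Rightarrow> 'm set" where
  "measurings A C B = {t \<in> hom V (MCar A \<otimes> CCar C) (MCar B).
     t \<cdot> (Mul A \<boxtimes> Ide V (CCar C)) = Mul B \<cdot> (t \<boxtimes> t) \<cdot>
       interchange V (MCar A) (MCar A) (CCar C) (CCar C) \<cdot> (Ide V (MCar A \<otimes> MCar A) \<boxtimes> Comul C) \<and>
     t \<cdot> (Uni A \<boxtimes> Ide V (CCar C)) = Uni B \<cdot> Couni C \<cdot> LUnit V (CCar C)}"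

lemma interchange_in:
  assumes "W \<in> Obj V" "X \<in> Obj V" "Y \<in> Obj V" "Z \<in> Obj V"
  shows "interchange V W X Y Z \<in> hom V ((W \<otimes> X) \<otimes> (Y \<otimes> Z)) ((W \<otimes> Y) \<otimes> (X \<otimes> Z))"
  using assms by (simp add: interchange_def hom_iff)

text \<open>Lets the two copies of a transpose pass the interchange in the convolution product and
  meet the evaluations. The braiding involved moves only the second factor, so naturality of
  \<open>braid_hat\<close> is used for \<open>g\<close> and naturality in the tail for
  \<open>f\<close>.\<close>

lemma interchange_natural:
  assumes f: "f \<in> hom V W W'" and g: "g \<in> hom V X X'" and o: "Y \<in> Obj V" "Z \<in> Obj V"
  shows "interchange V W' X' Y Z \<cdot> ((f \<boxtimes> g) \<boxtimes> Ide V (Y \<otimes> Z)) =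
    ((f \<boxtimes> Ide V Y) \<boxtimes> (g \<boxtimes> Ide V Z)) \<cdot> interchange V W X Y Z"
proof -
  have [simp]: "W \<in> Obj V" "W' \<in> Obj V" "X \<in> Obj V" "X' \<in> Obj V"
    using f g Dom_in Cod_in by (auto simp: hom_iff)
  let ?ic = "\<lambda>w x y z. AscI w y (x \<odot> z) \<bullet> (Id w \<parallel> (Asc y x z \<bullet> (braid_box x y \<parallel> Id z) \<bullet> AscI x y z)) \<bullet> Asc w x (y \<odot> z)"
  let ?w = "\<langle>W\<rangle>" and ?w' = "\<langle>W'\<rangle>" and ?x = "\<langle>X\<rangle>" and ?x' = "\<langle>X'\<rangle>" and ?y = "\<langle>Y\<rangle>" and ?z = "\<langle>Z\<rangle>"
  let ?f = "Box ?w f ?w'" and ?g = "Box ?x g ?x'"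
  let ?L = "?ic ?w' ?x' ?y ?z \<bullet> ((?f \<parallel> ?g) \<parallel> Id (?y \<odot> ?z))"
    and ?R = "((?f \<parallel> Id ?y) \<parallel> (?g \<parallel> Id ?z)) \<bullet> ?ic ?w ?x ?y ?z"
  have "eval ?L = eval ?R"
  proof (rule eval_eq_iff[THEN iffD2], safe)
    fix U assume U: "U \<in> Obj V"
    let ?fh = "hat ?w f ?w'" and ?gh = "hat ?x g ?x'"
    let ?c = "braid_hat ?x ?y (Z \<otimes> U)" and ?c' = "braid_hat ?x' ?y (Z \<otimes> U)"
    have "(Ide V W' \<boxtimes> ?c') \<cdot> ?fh (X' \<otimes> (Y \<otimes> (Z \<otimes> U))) \<cdot> (Ide V W \<boxtimes> ?gh (Y \<otimes> (Z \<otimes> U))) =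
        ((Ide V W' \<boxtimes> ?c') \<cdot> ?fh (X' \<otimes> (Y \<otimes> (Z \<otimes> U)))) \<cdot> (Ide V W \<boxtimes> ?gh (Y \<otimes> (Z \<otimes> U)))"
      using f g o U by simp
    also have "(Ide V W' \<boxtimes> ?c') \<cdot> ?fh (X' \<otimes> (Y \<otimes> (Z \<otimes> U))) = ?fh (Y \<otimes> (X' \<otimes> (Z \<otimes> U))) \<cdot> (Ide V W \<boxtimes> ?c')"
      using f o U hat_natural[of ?w ?w' f ?c'] by simp
    also have "(?fh (Y \<otimes> (X' \<otimes> (Z \<otimes> U))) \<cdot> (Ide V W \<boxtimes> ?c')) \<cdot> (Ide V W \<boxtimes> ?gh (Y \<otimes> (Z \<otimes> U))) =
        ?fh (Y \<otimes> (X' \<otimes> (Z \<otimes> U))) \<cdot> (Ide V W \<boxtimes> (?c' \<cdot> ?gh (Y \<otimes> (Z \<otimes> U))))"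
      using f g o U by (simp add: Ide_TensM_Cmp)
    also have "?c' \<cdot> ?gh (Y \<otimes> (Z \<otimes> U)) = (Ide V Y \<boxtimes> ?gh (Z \<otimes> U)) \<cdot> ?c"
      using g o U braid_hat_left[of ?x ?x' ?y "Z \<otimes> U" g] by simp
    finally show "interp ?L U = interp ?R U"
      using f g o U by (simp add: braid_hat_def Braid_in Ide_TensM_Cmp)
  qed (use f g o in \<open>simp_all add: Braid_in\<close>)
  then show ?thesis
    using o by (simp add: interchange_def)
qed

lemma bij_curry_measurings:
  assumes A: "monoid_in V A" and B: "monoid_in V B" and C: "comonoid_in V C"
  shows "bij_betw (curry_arrow V (MCar A) (CCar C) (MCar B)) (measurings A C B)
    (monoid_hom V A (convolution V C B))"
proof (rule bij_betw_restrict[OF bij_curry_arrow])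
  let ?a = "MCar A" and ?b = "MCar B" and ?c = "CCar C"
  let ?H = "IHom V ?c ?b" and ?ev = "Ev V ?c ?b"
  have c [simp]: "?c \<in> Obj V" and \<Delta>: "Comul C \<in> hom V ?c (?c \<otimes> ?c)" and \<epsilon>: "Couni C \<in> hom V ?c \<one>"
    using C by (auto simp: comonoid_in_def)
  have [simp]: "Comul C \<in> Mor V" "Dom V (Comul C) = ?c" "Cod V (Comul C) = ?c \<otimes> ?c"
    "Couni C \<in> Mor V" "Dom V (Couni C) = ?c" "Cod V (Couni C) = \<one>"
    using \<Delta> \<epsilon> by (auto simp: hom_iff)
  have ic [simp]: "interchange V W W ?c ?c \<in> Mor V"
    "Dom V (interchange V W W ?c ?c) = (W \<otimes> W) \<otimes> (?c \<otimes> ?c)"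
    "Cod V (interchange V W W ?c ?c) = (W \<otimes> ?c) \<otimes> (W \<otimes> ?c)" if "W \<in> Obj V" for W
    using interchange_in[of W W ?c ?c] that by (auto simp: hom_iff)
  let ?big = "Mul B \<cdot> (?ev \<boxtimes> ?ev) \<cdot> interchange V ?H ?H ?c ?c \<cdot> (Ide V (?H \<otimes> ?H) \<boxtimes> Comul C)"
  let ?u = "Uni B \<cdot> Couni C \<cdot> LUnit V ?c"
  define m where "m = curry_arrow V (?H \<otimes> ?H) ?c ?b ?big"
  define u where "u = curry_arrow V \<one> ?c ?b ?u"
  have big: "?big \<in> hom V ((?H \<otimes> ?H) \<otimes> ?c) ?b" and u': "?u \<in> hom V (\<one> \<otimes> ?c) ?b"
    using B by (simp_all add: hom_iff)
  have m: "m \<in> hom V (?H \<otimes> ?H) ?H" "?ev \<cdot> (m \<boxtimes> Ide V ?c) = ?big"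
    and u: "u \<in> hom V \<one> ?H" "?ev \<cdot> (u \<boxtimes> Ide V ?c) = ?u"
    using B big u' by (simp_all add: m_def u_def curry_arrow_in Ev_curry_arrow)
  have [simp]: "m \<in> Mor V" "Dom V m = ?H \<otimes> ?H" "Cod V m = ?H" "u \<in> Mor V" "Dom V u = \<one>" "Cod V u = ?H"
    using m u by (auto simp: hom_iff)
  have conv: "convolution V C B = \<lparr>MCar = ?H, Mul = m, Uni = u\<rparr>"
    by (simp add: convolution_def Let_def m_def u_def)
  fix t assume t: "t \<in> hom V (?a \<otimes> ?c) ?b"
  define f where "f = curry_arrow V ?a ?c ?b t"
  have f: "f \<in> hom V ?a ?H" and ev: "?ev \<cdot> (f \<boxtimes> Ide V ?c) = t"
    using A B t by (simp_all add: f_def curry_arrow_in Ev_curry_arrow)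
  have [simp]: "f \<in> Mor V" "Dom V f = ?a" "Cod V f = ?H" "t \<in> Mor V" "Dom V t = ?a \<otimes> ?c" "Cod V t = ?b"
    using f t by (auto simp: hom_iff)
  have "f \<cdot> Mul A = m \<cdot> (f \<boxtimes> f) \<longleftrightarrow>
      ?ev \<cdot> ((f \<cdot> Mul A) \<boxtimes> Ide V ?c) = ?ev \<cdot> ((m \<cdot> (f \<boxtimes> f)) \<boxtimes> Ide V ?c)"
    using Ev_cancel[of ?c ?b "f \<cdot> Mul A" "?a \<otimes> ?a" "m \<cdot> (f \<boxtimes> f)"] A B by (auto simp: hom_iff)
  also have "?ev \<cdot> ((f \<cdot> Mul A) \<boxtimes> Ide V ?c) = t \<cdot> (Mul A \<boxtimes> Ide V ?c)"
    using A B by (subst Ev_Cmp) (simp_all add: ev)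
  also have "?ev \<cdot> ((m \<cdot> (f \<boxtimes> f)) \<boxtimes> Ide V ?c) = ?big \<cdot> ((f \<boxtimes> f) \<boxtimes> Ide V ?c)"
    using B m by (subst Ev_Cmp) simp_all
  also have "\<dots> = Mul B \<cdot> (?ev \<boxtimes> ?ev) \<cdot>
      (interchange V ?H ?H ?c ?c \<cdot> ((f \<boxtimes> f) \<boxtimes> Ide V (?c \<otimes> ?c))) \<cdot> (Ide V (?a \<otimes> ?a) \<boxtimes> Comul C)"
    using A B by (simp add: TensM_Cmp')
  also have "interchange V ?H ?H ?c ?c \<cdot> ((f \<boxtimes> f) \<boxtimes> Ide V (?c \<otimes> ?c)) =
      ((f \<boxtimes> Ide V ?c) \<boxtimes> (f \<boxtimes> Ide V ?c)) \<cdot> interchange V ?a ?a ?c ?c"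
    using f by (intro interchange_natural) simp_all
  also have "Mul B \<cdot> (?ev \<boxtimes> ?ev) \<cdot> (((f \<boxtimes> Ide V ?c) \<boxtimes> (f \<boxtimes> Ide V ?c)) \<cdot> interchange V ?a ?a ?c ?c) \<cdot>
      (Ide V (?a \<otimes> ?a) \<boxtimes> Comul C) =
      Mul B \<cdot> ((?ev \<boxtimes> ?ev) \<cdot> ((f \<boxtimes> Ide V ?c) \<boxtimes> (f \<boxtimes> Ide V ?c))) \<cdot> interchange V ?a ?a ?c ?c \<cdot>
      (Ide V (?a \<otimes> ?a) \<boxtimes> Comul C)"
    using A B by simp
  also have "(?ev \<boxtimes> ?ev) \<cdot> ((f \<boxtimes> Ide V ?c) \<boxtimes> (f \<boxtimes> Ide V ?c)) = t \<boxtimes> t"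
    using A B by (subst TensM_Cmp') (simp_all add: ev)
  finally have mul: "f \<cdot> Mul A = m \<cdot> (f \<boxtimes> f) \<longleftrightarrow> t \<cdot> (Mul A \<boxtimes> Ide V ?c) =
      Mul B \<cdot> (t \<boxtimes> t) \<cdot> interchange V ?a ?a ?c ?c \<cdot> (Ide V (?a \<otimes> ?a) \<boxtimes> Comul C)" .
  have "f \<cdot> Uni A = u \<longleftrightarrow> ?ev \<cdot> ((f \<cdot> Uni A) \<boxtimes> Ide V ?c) = ?ev \<cdot> (u \<boxtimes> Ide V ?c)"
    using Ev_cancel[of ?c ?b "f \<cdot> Uni A" \<one> u] A B by (auto simp: hom_iff)
  also have "?ev \<cdot> ((f \<cdot> Uni A) \<boxtimes> Ide V ?c) = t \<cdot> (Uni A \<boxtimes> Ide V ?c)"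
    using A B by (subst Ev_Cmp) (simp_all add: ev)
  finally have uni: "f \<cdot> Uni A = u \<longleftrightarrow> t \<cdot> (Uni A \<boxtimes> Ide V ?c) = ?u"
    unfolding u .
  show "f \<in> monoid_hom V A (convolution V C B) \<longleftrightarrow> t \<in> measurings A C B"
    using f t by (simp add: monoid_hom_def conv measurings_def mul uni)
qed (use A B C in \<open>auto simp: measurings_def monoid_hom_def convolution_def Let_def comonoid_in_def\<close>)

end

section \<open>The comonoid of a dual pair and its coactions\<close>

locale dual_pair = braided_monoidal_closed V
  for V :: "('o, 'm, 'z) bmc_scheme" (structure) +
  fixes X Y :: 'o and d n :: 'm
  assumes X_in: "X \<in> Obj V" and Y_in: "Y \<in> Obj V"
    and d_in: "d \<in> hom V (Y \<otimes> X) \<one>" and n_in: "n \<in> hom V \<one> (X \<otimes> Y)"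
    and snake_X: "RUnit V X \<cdot> (Ide V X \<boxtimes> d) \<cdot> Assoc V X Y X \<cdot> (n \<boxtimes> Ide V X) \<cdot>
      inverse_of V (LUnit V X) = Ide V X"
    and snake_Y: "LUnit V Y \<cdot> (d \<boxtimes> Ide V Y) \<cdot> inverse_of V (Assoc V Y X Y) \<cdot> (Ide V Y \<boxtimes> n) \<cdot>
      inverse_of V (RUnit V Y) = Ide V Y"
begin

abbreviation "x \<equiv> \<langle>X\<rangle>"
abbreviation "y \<equiv> \<langle>Y\<rangle>"
abbreviation "dbox \<equiv> Box (y \<odot> x) d Nul"
abbreviation "nbox \<equiv> Box Nul n (x \<odot> y)"

text \<open>In a stack, \<open>dh\<close> cancels a pair Y, X standing in front of the tail, and
  \<open>nh\<close> inserts a pair X, Y there.\<close>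

definition "dh Z = hat (y \<odot> x) d Nul Z"
definition "nh Z = hat Nul n (x \<odot> y) Z"

lemmas [simp] = X_in Y_in d_in n_in

lemma dn_simps [simp]:
  "d \<in> Mor V" "Dom V d = Y \<otimes> X" "Cod V d = \<one>" "n \<in> Mor V" "Dom V n = \<one>" "Cod V n = X \<otimes> Y"
  using d_in n_in by (auto simp: hom_iff)

lemma dnh_simps [simp]:
  assumes "Z \<in> Obj V"
  shows "dh Z \<in> Mor V" "Dom V (dh Z) = Y \<otimes> (X \<otimes> Z)" "Cod V (dh Z) = Z"
    "nh Z \<in> Mor V" "Dom V (nh Z) = Z" "Cod V (nh Z) = X \<otimes> (Y \<otimes> Z)"
  using assms by (simp_all add: dh_def nh_def)

lemma dh_natural: "h \<in> Mor V \<Longrightarrow> Z = Cod V h \<Longrightarrow> dh Z \<cdot> (Ide V Y \<boxtimes> (Ide V X \<boxtimes> h)) = h \<cdot> dh (Dom V h)"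
  using hat_natural[of "y \<odot> x" Nul d h] by (simp add: dh_def)

lemma nh_natural: "h \<in> Mor V \<Longrightarrow> Z = Cod V h \<Longrightarrow> nh Z \<cdot> h = (Ide V X \<boxtimes> (Ide V Y \<boxtimes> h)) \<cdot> nh (Dom V h)"
  using hat_natural[of Nul "x \<odot> y" n h] by (simp add: nh_def)

lemma snake_X_hat [simp]:
  assumes "Z \<in> Obj V"
  shows "(Ide V X \<boxtimes> dh Z) \<cdot> nh (X \<otimes> Z) = Ide V (X \<otimes> Z)"
proof -
  have "interp (RU x \<bullet> (Id x \<parallel> dbox) \<bullet> Asc x y x \<bullet> (nbox \<parallel> Id x) \<bullet> LUI x) Z = interp (Id x) Z"
    by (rule interp_eqI) (use assms in \<open>simp_all add: snake_X\<close>)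
  then show ?thesis
    using assms by (simp add: dh_def nh_def)
qed

lemma snake_Y_hat [simp]:
  assumes "Z \<in> Obj V"
  shows "dh (Y \<otimes> Z) \<cdot> (Ide V Y \<boxtimes> nh Z) = Ide V (Y \<otimes> Z)"
proof -
  have "interp (LU y \<bullet> (dbox \<parallel> Id y) \<bullet> AscI y x y \<bullet> (Id y \<parallel> nbox) \<bullet> RUI y) Z = interp (Id y) Z"
    by (rule interp_eqI) (use assms in \<open>simp_all add: snake_Y\<close>)
  then show ?thesis
    using assms by (simp add: dh_def nh_def)
qed

text \<open>The universal coaction of Y \<otimes> X on X; its strict action is
  \<open>nh (X \<otimes> Z)\<close>.\<close>

definition "coev = Assoc V X Y X \<cdot> (n \<boxtimes> Ide V X) \<cdot> LUnitI X"

abbreviation "coev_box \<equiv> Asc x y x \<bullet> (nbox \<parallel> Id x) \<bullet> LUI x"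

lemma coev_simps [simp]:
  "coev \<in> Mor V" "Dom V coev = X" "Cod V coev = X \<otimes> (Y \<otimes> X)"
  by (simp_all add: coev_def)

text \<open>The coendomorphism comonoid of X, dual to the endomorphism monoid X \<otimes> Y:
  comultiplication inserts a pair between Y and X.\<close>

definition coend_comonoid :: "('o, 'm) comon" where
  "coend_comonoid = \<lparr>CCar = Y \<otimes> X, Comul = AssocI Y X (Y \<otimes> X) \<cdot> (Ide V Y \<boxtimes> coev), Couni = d\<rparr>"

abbreviation "yx \<equiv> y \<odot> x"
abbreviation "comul_box \<equiv> AscI y x yx \<bullet> (Id y \<parallel> coev_box)"

text \<open>Coassociativity says that two independent insertions of a pair commute, which is
  naturality of \<open>nh\<close>; the two counit laws are the two snake identities.\<close>

lemma coend_comonoid: "comonoid_in V coend_comonoid"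
proof -
  have 1: "eval (Asc yx yx yx \<bullet> (comul_box \<parallel> Id yx) \<bullet> comul_box) = eval ((Id yx \<parallel> comul_box) \<bullet> comul_box)"
  proof (rule eval_eq_iff[THEN iffD2], safe)
    fix Z assume Z: "Z \<in> Obj V"
    have "nh (X \<otimes> Y \<otimes> X \<otimes> Z) \<cdot> nh (X \<otimes> Z) = (Ide V X \<boxtimes> Ide V Y \<boxtimes> nh (X \<otimes> Z)) \<cdot> nh (X \<otimes> Z)"
      using Z by (simp add: nh_natural)
    then show "interp (Asc yx yx yx \<bullet> (comul_box \<parallel> Id yx) \<bullet> comul_box) Z =
        interp ((Id yx \<parallel> comul_box) \<bullet> comul_box) Z"
      using Z by (simp flip: nh_def Ide_TensM_Cmp)
  qed simp_all
  have 2: "eval (LU yx \<bullet> (dbox \<parallel> Id yx) \<bullet> comul_box) = eval (Id yx)"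
    by (rule eval_eq_iff[THEN iffD2]) (simp_all flip: nh_def dh_def)
  have 3: "eval (RU yx \<bullet> (Id yx \<parallel> dbox) \<bullet> comul_box) = eval (Id yx)"
    by (rule eval_eq_iff[THEN iffD2]) (simp_all flip: nh_def dh_def Ide_TensM_Cmp)
  show ?thesis
    using 1 2 3 by (simp add: comonoid_in_def coend_comonoid_def hom_iff flip: coev_def)
qed

definition coact :: "'m \<Rightarrow> 'm" where
  "coact f = (Ide V X \<boxtimes> f) \<cdot> coev"

lemma coact_in: "f \<in> hom V (Y \<otimes> X) Q \<Longrightarrow> coact f \<in> hom V X (X \<otimes> Q)"
  by (simp add: coact_def hom_iff)

lemma coact_hat:
  assumes "leaves_in q" "f \<in> hom V (Y \<otimes> X) (obj q)" "Z \<in> Obj V"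
  shows "hat x (coact f) (x \<odot> q) Z = (Ide V X \<boxtimes> hat yx f q Z) \<cdot> nh (X \<otimes> Z)"
proof -
  have "hat x (coact f) (x \<odot> q) Z = interp ((Id x \<parallel> Box yx f q) \<bullet> coev_box) Z"
    by (rule hat_eqI) (use assms in \<open>simp_all add: coact_def coev_def\<close>)
  then show ?thesis
    using assms by (simp add: nh_def)
qed

text \<open>Transposition along the duality without any braiding. The inverse applies Y \<otimes>
  \<rho> and cancels Y against X; naturality of \<open>dh\<close> or \<open>nh\<close> brings the
  insertion and the cancellation together, and one snake identity finishes each composite.\<close>

lemma bij_coact:
  assumes Q: "Q \<in> Obj V"
  shows "bij_betw coact (hom V (Y \<otimes> X) Q) (hom V X (X \<otimes> Q))"
proof -
  define fact where "fact \<rho> = LUnit V Q \<cdot> (d \<boxtimes> Ide V Q) \<cdot> AssocI Y X Q \<cdot> (Ide V Y \<boxtimes> \<rho>)" for \<rho>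
  have fact_in: "fact \<rho> \<in> hom V (Y \<otimes> X) Q" if "\<rho> \<in> hom V X (X \<otimes> Q)" for \<rho>
    using Q that by (simp add: fact_def hom_iff)
  have fact_hat: "hat yx (fact \<rho>) \<langle>Q\<rangle> Z = dh (Q \<otimes> Z) \<cdot> (Ide V Y \<boxtimes> hat x \<rho> (x \<odot> \<langle>Q\<rangle>) Z)"
    if "\<rho> \<in> hom V X (X \<otimes> Q)" "Z \<in> Obj V" for \<rho> Z
  proof -
    have "hat yx (fact \<rho>) \<langle>Q\<rangle> Z = interp (LU \<langle>Q\<rangle> \<bullet> (dbox \<parallel> Id \<langle>Q\<rangle>) \<bullet> AscI y x \<langle>Q\<rangle> \<bullet>
        (Id y \<parallel> Box x \<rho> (x \<odot> \<langle>Q\<rangle>))) Z"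
      by (rule hat_eqI) (use Q that in \<open>simp_all add: fact_def\<close>)
    then show ?thesis
      using Q that by (simp add: dh_def)
  qed
  have fact_coact: "fact (coact f) = f" if f: "f \<in> hom V (Y \<otimes> X) Q" for f
  proof -
    have "eval (Box yx (fact (coact f)) \<langle>Q\<rangle>) = eval (Box yx f \<langle>Q\<rangle>)"
    proof (rule eval_eq_iff[THEN iffD2], safe)
      fix Z assume Z: "Z \<in> Obj V"
      have "hat yx (fact (coact f)) \<langle>Q\<rangle> Z =
          (dh (Q \<otimes> Z) \<cdot> (Ide V Y \<boxtimes> (Ide V X \<boxtimes> hat yx f \<langle>Q\<rangle> Z))) \<cdot> (Ide V Y \<boxtimes> nh (X \<otimes> Z))"
        using Q f Z by (simp add: fact_hat coact_in coact_hat Ide_TensM_Cmp)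
      also have "dh (Q \<otimes> Z) \<cdot> (Ide V Y \<boxtimes> (Ide V X \<boxtimes> hat yx f \<langle>Q\<rangle> Z)) =
          hat yx f \<langle>Q\<rangle> Z \<cdot> dh (Y \<otimes> (X \<otimes> Z))"
        using Q f Z by (simp add: dh_natural)
      finally show "interp (Box yx (fact (coact f)) \<langle>Q\<rangle>) Z = interp (Box yx f \<langle>Q\<rangle>) Z"
        using Q f Z by simp
    qed (use Q f in \<open>simp_all add: fact_in coact_in\<close>)
    then show ?thesis
      by simp
  qed
  have coact_fact: "coact (fact \<rho>) = \<rho>" if \<rho>: "\<rho> \<in> hom V X (X \<otimes> Q)" for \<rho>
  proof -
    have "eval (Box x (coact (fact \<rho>)) (x \<odot> \<langle>Q\<rangle>)) = eval (Box x \<rho> (x \<odot> \<langle>Q\<rangle>))"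
    proof (rule eval_eq_iff[THEN iffD2], safe)
      fix Z assume Z: "Z \<in> Obj V"
      let ?r = "hat x \<rho> (x \<odot> \<langle>Q\<rangle>) Z"
      have "hat x (coact (fact \<rho>)) (x \<odot> \<langle>Q\<rangle>) Z =
          (Ide V X \<boxtimes> dh (Q \<otimes> Z)) \<cdot> ((Ide V X \<boxtimes> (Ide V Y \<boxtimes> ?r)) \<cdot> nh (X \<otimes> Z))"
        using Q \<rho> Z by (simp add: fact_hat fact_in coact_hat Ide_TensM_Cmp)
      also have "(Ide V X \<boxtimes> (Ide V Y \<boxtimes> ?r)) \<cdot> nh (X \<otimes> Z) = nh (X \<otimes> (Q \<otimes> Z)) \<cdot> ?r"
        using Q \<rho> Z nh_natural[of ?r] by simp
      also have "(Ide V X \<boxtimes> dh (Q \<otimes> Z)) \<cdot> (nh (X \<otimes> (Q \<otimes> Z)) \<cdot> ?r) =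
          ((Ide V X \<boxtimes> dh (Q \<otimes> Z)) \<cdot> nh (X \<otimes> (Q \<otimes> Z))) \<cdot> ?r"
        using Q \<rho> Z by (simp del: snake_X_hat)
      finally show "interp (Box x (coact (fact \<rho>)) (x \<odot> \<langle>Q\<rangle>)) Z = interp (Box x \<rho> (x \<odot> \<langle>Q\<rangle>)) Z"
        using Q \<rho> Z by simp
    qed (use Q \<rho> in \<open>simp_all add: fact_in coact_in\<close>)
    then show ?thesis
      by simp
  qed
  show ?thesis
    by (rule bij_betw_byWitness[where f' = fact]) (auto simp: fact_coact coact_fact fact_in coact_in)
qed

lemma coact_cancel:
  assumes "f \<in> hom V (Y \<otimes> X) Q" "g \<in> hom V (Y \<otimes> X) Q"
  shows "coact f = coact g \<longleftrightarrow> f = g"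
proof -
  have "Q \<in> Obj V"
    using assms(1) Cod_in by (auto simp: hom_iff)
  then show ?thesis
    using bij_coact assms by (metis bij_betw_imp_inj_on inj_onD)
qed

text \<open>\<open>coact\<close> is injective, so the equations of a comonoid morphism may be tested
  after applying it. The comultiplication of Y \<otimes> X then becomes the iterated coaction,
  because both amount to two insertions of a pair.\<close>

lemma bij_comodule_structures:
  assumes P: "comonoid_in V P"
  shows "bij_betw coact (comonoid_hom V coend_comonoid P) (comodule_structures V P X)"
proof -
  let ?p = "CCar P" and ?tp = "\<langle>CCar P\<rangle>"
  have p: "?p \<in> Obj V" and \<Delta>: "Comul P \<in> hom V ?p (?p \<otimes> ?p)" and \<epsilon>: "Couni P \<in> hom V ?p \<one>"
    using P by (auto simp: comonoid_in_def)
  have [simp]: "Comul P \<in> Mor V" "Dom V (Comul P) = ?p" "Cod V (Comul P) = ?p \<otimes> ?p"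
    "Couni P \<in> Mor V" "Dom V (Couni P) = ?p" "Cod V (Couni P) = \<one>"
    using \<Delta> \<epsilon> by (auto simp: hom_iff)
  have iff: "coact f \<in> comodule_structures V P X \<longleftrightarrow> f \<in> comonoid_hom V coend_comonoid P"
    if f: "f \<in> hom V (Y \<otimes> X) ?p" for f
  proof -
    let ?D = "Comul coend_comonoid"
    have [simp]: "f \<in> Mor V" "Dom V f = Y \<otimes> X" "Cod V f = ?p"
      using f by (auto simp: hom_iff)
    have [simp]: "?D \<in> Mor V" "Dom V ?D = Y \<otimes> X" "Cod V ?D = (Y \<otimes> X) \<otimes> (Y \<otimes> X)"
      by (simp_all add: coend_comonoid_def)
    have \<rho>: "coact f \<in> hom V X (X \<otimes> ?p)"
      using f by (rule coact_in)
    have [simp]: "coact f \<in> Mor V" "Dom V (coact f) = X" "Cod V (coact f) = X \<otimes> ?p"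
      using \<rho> by (auto simp: hom_iff)
    let ?f = "Box yx f ?tp" and ?r = "Box x (coact f) (x \<odot> ?tp)"
    have "Comul P \<cdot> f = (f \<boxtimes> f) \<cdot> ?D \<longleftrightarrow> coact (Comul P \<cdot> f) = coact ((f \<boxtimes> f) \<cdot> ?D)"
      using p by (intro coact_cancel[symmetric]) (simp_all add: hom_iff)
    also have "coact (Comul P \<cdot> f) = (Ide V X \<boxtimes> Comul P) \<cdot> coact f"
      using p by (simp add: coact_def Ide_TensM_Cmp)
    also have "coact ((f \<boxtimes> f) \<cdot> ?D) = Assoc V X ?p ?p \<cdot> (coact f \<boxtimes> Ide V ?p) \<cdot> coact f"
    proof -
      have ffD: "(f \<boxtimes> f) \<cdot> ?D \<in> hom V (Y \<otimes> X) (?p \<otimes> ?p)"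
        by (simp add: hom_iff)
      have "eval (Box x (coact ((f \<boxtimes> f) \<cdot> ?D)) (x \<odot> ?tp \<odot> ?tp)) = eval (Asc x ?tp ?tp \<bullet> (?r \<parallel> Id ?tp) \<bullet> ?r)"
      proof (rule eval_eq_iff[THEN iffD2], safe)
        fix Z assume Z: "Z \<in> Obj V"
        let ?h = "hat yx f ?tp"
        have D: "hat yx ((f \<boxtimes> f) \<cdot> ?D) (?tp \<odot> ?tp) Z =
            ?h (?p \<otimes> Z) \<cdot> (Ide V Y \<boxtimes> (Ide V X \<boxtimes> ?h Z)) \<cdot> (Ide V Y \<boxtimes> nh (X \<otimes> Z))"
        proof -
          have "hat yx ((f \<boxtimes> f) \<cdot> ?D) (?tp \<odot> ?tp) Z = interp ((?f \<parallel> ?f) \<bullet> comul_box) Z"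
            by (rule hat_eqI) (use p f Z in \<open>simp_all add: coend_comonoid_def coev_def\<close>)
          then show ?thesis
            using p f Z by (simp add: nh_def)
        qed
        have "hat x (coact f) (x \<odot> ?tp) (?p \<otimes> Z) \<cdot> hat x (coact f) (x \<odot> ?tp) Z =
            (Ide V X \<boxtimes> ?h (?p \<otimes> Z)) \<cdot> (nh (X \<otimes> (?p \<otimes> Z)) \<cdot> (Ide V X \<boxtimes> ?h Z)) \<cdot> nh (X \<otimes> Z)"
          using p f Z by (simp add: coact_hat)
        also have "nh (X \<otimes> (?p \<otimes> Z)) \<cdot> (Ide V X \<boxtimes> ?h Z) =
            (Ide V X \<boxtimes> (Ide V Y \<boxtimes> (Ide V X \<boxtimes> ?h Z))) \<cdot> nh (X \<otimes> (Y \<otimes> (X \<otimes> Z)))"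
          using p f Z nh_natural[of "Ide V X \<boxtimes> ?h Z"] by simp
        also have "(Ide V X \<boxtimes> ?h (?p \<otimes> Z)) \<cdot> ((Ide V X \<boxtimes> (Ide V Y \<boxtimes> (Ide V X \<boxtimes> ?h Z))) \<cdot>
            nh (X \<otimes> (Y \<otimes> (X \<otimes> Z)))) \<cdot> nh (X \<otimes> Z) = (Ide V X \<boxtimes> ?h (?p \<otimes> Z)) \<cdot>
            (Ide V X \<boxtimes> (Ide V Y \<boxtimes> (Ide V X \<boxtimes> ?h Z))) \<cdot> (Ide V X \<boxtimes> (Ide V Y \<boxtimes> nh (X \<otimes> Z))) \<cdot> nh (X \<otimes> Z)"
          using p f Z by (simp add: nh_natural)
        also have "\<dots> = (Ide V X \<boxtimes> (?h (?p \<otimes> Z) \<cdot> (Ide V Y \<boxtimes> (Ide V X \<boxtimes> ?h Z)) \<cdot> (Ide V Y \<boxtimes> nh (X \<otimes> Z)))) \<cdot>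
            nh (X \<otimes> Z)"
          using p f Z by (simp add: Ide_TensM_Cmp)
        finally show "interp (Box x (coact ((f \<boxtimes> f) \<cdot> ?D)) (x \<odot> ?tp \<odot> ?tp)) Z =
            interp (Asc x ?tp ?tp \<bullet> (?r \<parallel> Id ?tp) \<bullet> ?r) Z"
          using p f Z ffD \<rho> coact_hat[of "?tp \<odot> ?tp" "(f \<boxtimes> f) \<cdot> ?D" Z] by (simp add: D)
      qed (use p ffD \<rho> coact_in in simp_all)
      then show ?thesis
        by simp
    qed
    finally have 1: "Comul P \<cdot> f = (f \<boxtimes> f) \<cdot> ?D \<longleftrightarrow>
        (Ide V X \<boxtimes> Comul P) \<cdot> coact f = Assoc V X ?p ?p \<cdot> (coact f \<boxtimes> Ide V ?p) \<cdot> coact f" .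
    \<comment> \<open>The transpose of the counit is the inverse right unitor by the snake identity;
      this is where the unitor in the counit law of a comodule comes from.\<close>
    have "RUnit V X \<cdot> coact d = Ide V X"
      using snake_X by (simp add: coact_def coev_def)
    then have cd: "coact d = RUnitI X"
      using Cmp_Cmp[of "coact d" "RUnit V X" "RUnitI X"] by (simp add: coact_def)
    have "Couni P \<cdot> f = d \<longleftrightarrow> coact (Couni P \<cdot> f) = coact d"
      by (intro coact_cancel[symmetric]) (simp_all add: hom_iff)
    also have "coact (Couni P \<cdot> f) = (Ide V X \<boxtimes> Couni P) \<cdot> coact f"
      using p by (simp add: coact_def Ide_TensM_Cmp)
    also have "(Ide V X \<boxtimes> Couni P) \<cdot> coact f = coact d \<longleftrightarrow>
        RUnit V X \<cdot> (Ide V X \<boxtimes> Couni P) \<cdot> coact f = Ide V X"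
    proof
      assume "(Ide V X \<boxtimes> Couni P) \<cdot> coact f = coact d"
      then show "RUnit V X \<cdot> (Ide V X \<boxtimes> Couni P) \<cdot> coact f = Ide V X"
        using cd by simp
    next
      assume *: "RUnit V X \<cdot> (Ide V X \<boxtimes> Couni P) \<cdot> coact f = Ide V X"
      have "RUnitI X \<cdot> RUnit V X \<cdot> (Ide V X \<boxtimes> Couni P) \<cdot> coact f = RUnitI X"
        unfolding * by simp
      then show "(Ide V X \<boxtimes> Couni P) \<cdot> coact f = coact d"
        using Cmp_eq[of "RUnitI X" "RUnit V X" "Ide V (X \<otimes> \<one>)" "(Ide V X \<boxtimes> Couni P) \<cdot> coact f"] cd p by simp
    qed
    finally have 2: "Couni P \<cdot> f = d \<longleftrightarrow> RUnit V X \<cdot> (Ide V X \<boxtimes> Couni P) \<cdot> coact f = Ide V X" .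
    have 3: "CCar coend_comonoid = Y \<otimes> X" "Couni coend_comonoid = d"
      by (simp_all add: coend_comonoid_def)
    show ?thesis
      unfolding comodule_structures_def comonoid_hom_def mem_Collect_eq 1 2 3 using f \<rho> by auto
  qed
  show ?thesis
    by (rule bij_betw_restrict[OF bij_coact[OF p]])
      (use iff in \<open>auto simp: comonoid_hom_def comodule_structures_def coend_comonoid_def\<close>)
qed

section \<open>Mates along the duality\<close>

text \<open>Transposition along the duality: a pair \<open>X \<otimes> Y\<close> is created and \<open>M\<close> is pulled across \<open>X\<close>.\<close>

definition mate :: "'o \<Rightarrow> 'm \<Rightarrow> 'm" where
  "mate M t = (Ide V X \<boxtimes> t) \<cdot> Assoc V X M (Y \<otimes> X) \<cdot> (Braid V M X \<boxtimes> Ide V (Y \<otimes> X)) \<cdot>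
     AssocI M X (Y \<otimes> X) \<cdot> (Ide V M \<boxtimes> coev)"

lemma mate_in:
  "M \<in> Obj V \<Longrightarrow> t \<in> hom V (M \<otimes> (Y \<otimes> X)) B \<Longrightarrow> mate M t \<in> hom V (M \<otimes> X) (X \<otimes> B)"
  by (simp add: mate_def hom_iff)

lemma mate_hat:
  assumes "leaves_in s" "leaves_in u" "t \<in> hom V (obj s \<otimes> (Y \<otimes> X)) (obj u)" "Z \<in> Obj V"
  shows "hat (s \<odot> x) (mate (obj s) t) (x \<odot> u) Z = (Ide V X \<boxtimes> hat (s \<odot> yx) t u Z) \<cdot>
    braid_hat s x (Y \<otimes> (X \<otimes> Z)) \<cdot> stackM s (nh (X \<otimes> Z))"
proof -
  have "hat (s \<odot> x) (mate (obj s) t) (x \<odot> u) Z = interp ((Id x \<parallel> Box (s \<odot> yx) t u) \<bullet> Asc x s yx \<bullet>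
      (braid_box s x \<parallel> Id yx) \<bullet> AscI s x yx \<bullet> (Id s \<parallel> coev_box)) Z"
    by (rule hat_eqI) (use assms in \<open>simp_all add: mate_def coev_def Braid_in\<close>)
  then show ?thesis
    using assms by (simp add: Braid_in nh_def braid_hat_def)
qed

text \<open>Crossing Y and then X is crossing Y \<otimes> X by the hexagon. Naturality along
  \<open>d\<close> reduces this to crossing \<one>, which is trivial; the same argument with
  \<open>n\<close> gives \<open>braid_hat_nh\<close>.\<close>

lemma braid_hat_dh:
  assumes "leaves_in s" "Z \<in> Obj V"
  shows "dh (stack s Z) \<cdot> (Ide V Y \<boxtimes> braid_hat s x Z) \<cdot> braid_hat s y (X \<otimes> Z) = stackM s (dh Z)"
  using assms braid_hat_right[of s yx Nul Z d] braid_hat_Node_right[of s y x Z] by (simp add: dh_def)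

lemma braid_hat_nh:
  assumes "leaves_in s" "Z \<in> Obj V"
  shows "(Ide V X \<boxtimes> braid_hat s y Z) \<cdot> braid_hat s x (Y \<otimes> Z) \<cdot> stackM s (nh Z) = nh (stack s Z)"
  using assms braid_hat_right[of s Nul "x \<odot> y" Z n] braid_hat_Node_right[of s x y Z] by (simp add: nh_def)

text \<open>The inverse moves M across Y and cancels Y against X. Both directions use the braiding
  of M past the other factor and never its inverse: the crossings combine into one of a whole pair,
  which \<open>braid_hat_dh\<close> or \<open>braid_hat_nh\<close> removes, leaving a snake.\<close>

lemma bij_mate:
  assumes M: "M \<in> Obj V" and B: "B \<in> Obj V"
  shows "bij_betw (mate M) (hom V (M \<otimes> (Y \<otimes> X)) B) (hom V (M \<otimes> X) (X \<otimes> B))"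
proof -
  let ?m = "\<langle>M\<rangle>" and ?b = "\<langle>B\<rangle>"
  define mate' where "mate' g = LUnit V B \<cdot> (d \<boxtimes> Ide V B) \<cdot> AssocI Y X B \<cdot> (Ide V Y \<boxtimes> g) \<cdot>
    Assoc V Y M X \<cdot> (Braid V M Y \<boxtimes> Ide V X) \<cdot> AssocI M Y X" for g
  have mate'_in: "mate' g \<in> hom V (M \<otimes> (Y \<otimes> X)) B" if "g \<in> hom V (M \<otimes> X) (X \<otimes> B)" for g
    using M B that by (simp add: mate'_def hom_iff)
  have mate'_hat: "hat (?m \<odot> yx) (mate' g) ?b Z =
      dh (B \<otimes> Z) \<cdot> (Ide V Y \<boxtimes> hat (?m \<odot> x) g (x \<odot> ?b) Z) \<cdot> braid_hat ?m y (X \<otimes> Z)"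
    if "g \<in> hom V (M \<otimes> X) (X \<otimes> B)" "Z \<in> Obj V" for g Z
  proof -
    have "hat (?m \<odot> yx) (mate' g) ?b Z = interp (LU ?b \<bullet> (dbox \<parallel> Id ?b) \<bullet> AscI y x ?b \<bullet>
        (Id y \<parallel> Box (?m \<odot> x) g (x \<odot> ?b)) \<bullet> Asc y ?m x \<bullet> (braid_box ?m y \<parallel> Id x) \<bullet> AscI ?m y x) Z"
      by (rule hat_eqI) (use M B that in \<open>simp_all add: mate'_def Braid_in\<close>)
    then show ?thesis
      using M B that by (simp add: Braid_in dh_def braid_hat_def)
  qed
  have mate'_mate: "mate' (mate M t) = t" if t: "t \<in> hom V (M \<otimes> (Y \<otimes> X)) B" for t
  proof -
    have "eval (Box (?m \<odot> yx) (mate' (mate M t)) ?b) = eval (Box (?m \<odot> yx) t ?b)"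
    proof (rule eval_eq_iff[THEN iffD2], safe)
      fix Z assume Z: "Z \<in> Obj V"
      let ?t = "hat (?m \<odot> yx) t ?b Z" and ?n = "nh (X \<otimes> Z)" and ?W = "Y \<otimes> (X \<otimes> Z)"
      let ?c = "braid_hat ?m"
      have mh: "hat (?m \<odot> x) (mate M t) (x \<odot> ?b) Z = (Ide V X \<boxtimes> ?t) \<cdot> ?c x ?W \<cdot> (Ide V M \<boxtimes> ?n)"
        using mate_hat[of ?m ?b t Z] M B t Z by simp
      have "hat (?m \<odot> yx) (mate' (mate M t)) ?b Z = (dh (B \<otimes> Z) \<cdot> (Ide V Y \<boxtimes> (Ide V X \<boxtimes> ?t))) \<cdot>
          (Ide V Y \<boxtimes> ?c x ?W) \<cdot> ((Ide V Y \<boxtimes> (Ide V M \<boxtimes> ?n)) \<cdot> ?c y (X \<otimes> Z))"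
        using M B t Z by (simp add: mate'_hat mate_in mh Ide_TensM_Cmp)
      also have "dh (B \<otimes> Z) \<cdot> (Ide V Y \<boxtimes> (Ide V X \<boxtimes> ?t)) = ?t \<cdot> dh (M \<otimes> ?W)"
        using M B t Z by (simp add: dh_natural)
      also have "(Ide V Y \<boxtimes> (Ide V M \<boxtimes> ?n)) \<cdot> ?c y (X \<otimes> Z) = ?c y (X \<otimes> ?W) \<cdot> (Ide V M \<boxtimes> (Ide V Y \<boxtimes> ?n))"
        using M Z braid_hat_natural[of ?m y ?n] by simp
      also have "(?t \<cdot> dh (M \<otimes> ?W)) \<cdot> (Ide V Y \<boxtimes> ?c x ?W) \<cdot> (?c y (X \<otimes> ?W) \<cdot> (Ide V M \<boxtimes> (Ide V Y \<boxtimes> ?n))) =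
          ?t \<cdot> (dh (M \<otimes> ?W) \<cdot> (Ide V Y \<boxtimes> ?c x ?W) \<cdot> ?c y (X \<otimes> ?W)) \<cdot> (Ide V M \<boxtimes> (Ide V Y \<boxtimes> ?n))"
        using M B t Z by simp
      also have "dh (M \<otimes> ?W) \<cdot> (Ide V Y \<boxtimes> ?c x ?W) \<cdot> ?c y (X \<otimes> ?W) = Ide V M \<boxtimes> dh ?W"
        using M Z braid_hat_dh[of ?m ?W] by simp
      finally show "interp (Box (?m \<odot> yx) (mate' (mate M t)) ?b) Z = interp (Box (?m \<odot> yx) t ?b) Z"
        using M B t Z by (simp flip: Ide_TensM_Cmp)
    qed (use M B t in \<open>simp_all add: mate'_in mate_in\<close>)
    then show ?thesis
      by simp
  qed
  have mate_mate': "mate M (mate' g) = g" if g: "g \<in> hom V (M \<otimes> X) (X \<otimes> B)" for g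
  proof -
    have "eval (Box (?m \<odot> x) (mate M (mate' g)) (x \<odot> ?b)) = eval (Box (?m \<odot> x) g (x \<odot> ?b))"
    proof (rule eval_eq_iff[THEN iffD2], safe)
      fix Z assume Z: "Z \<in> Obj V"
      let ?g = "hat (?m \<odot> x) g (x \<odot> ?b) Z" and ?c = "braid_hat ?m"
      have "hat (?m \<odot> x) (mate M (mate' g)) (x \<odot> ?b) Z = (Ide V X \<boxtimes> dh (B \<otimes> Z)) \<cdot>
          (Ide V X \<boxtimes> (Ide V Y \<boxtimes> ?g)) \<cdot>
          ((Ide V X \<boxtimes> ?c y (X \<otimes> Z)) \<cdot> ?c x (Y \<otimes> (X \<otimes> Z)) \<cdot> (Ide V M \<boxtimes> nh (X \<otimes> Z)))"
        using mate_hat[of ?m ?b "mate' g" Z] M B g Z by (simp add: mate'_hat mate'_in Ide_TensM_Cmp)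
      also have "(Ide V X \<boxtimes> ?c y (X \<otimes> Z)) \<cdot> ?c x (Y \<otimes> (X \<otimes> Z)) \<cdot> (Ide V M \<boxtimes> nh (X \<otimes> Z)) = nh (M \<otimes> (X \<otimes> Z))"
        using M Z braid_hat_nh[of ?m "X \<otimes> Z"] by simp
      also have "(Ide V X \<boxtimes> (Ide V Y \<boxtimes> ?g)) \<cdot> nh (M \<otimes> (X \<otimes> Z)) = nh (X \<otimes> (B \<otimes> Z)) \<cdot> ?g"
        using M B g Z nh_natural[of ?g] by simp
      also have "(Ide V X \<boxtimes> dh (B \<otimes> Z)) \<cdot> (nh (X \<otimes> (B \<otimes> Z)) \<cdot> ?g) =
          ((Ide V X \<boxtimes> dh (B \<otimes> Z)) \<cdot> nh (X \<otimes> (B \<otimes> Z))) \<cdot> ?g"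
        using M B g Z by (simp del: snake_X_hat)
      finally show "interp (Box (?m \<odot> x) (mate M (mate' g)) (x \<odot> ?b)) Z = interp (Box (?m \<odot> x) g (x \<odot> ?b)) Z"
        using M B g Z by simp
    qed (use M B g in \<open>simp_all add: mate'_in mate_in\<close>)
    then show ?thesis
      by simp
  qed
  show ?thesis
    using M by (intro bij_betw_byWitness[where f' = mate']) (auto simp: mate'_mate mate_mate' mate'_in mate_in)
qed

lemma mate_cancel:
  assumes "M \<in> Obj V" "f \<in> hom V (M \<otimes> (Y \<otimes> X)) B" "g \<in> hom V (M \<otimes> (Y \<otimes> X)) B"
  shows "f = g \<longleftrightarrow> mate M f = mate M g"
proof -
  have "B \<in> Obj V"
    using assms(2) Cod_in by (auto simp: hom_iff)
  then show ?thesis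
    using bij_mate assms by (metis bij_betw_imp_inj_on inj_onD)
qed

text \<open>Crossing a freshly created pair costs nothing, so only the crossing of the original X
  remains. This absorbs the braiding hidden in the interchange of the convolution product.\<close>

lemma braid_hat_slide:
  assumes s: "leaves_in s" and Z: "Z \<in> Obj V"
  shows "(Ide V X \<boxtimes> braid_hat s yx Z) \<cdot> braid_hat s x (Y \<otimes> (X \<otimes> Z)) \<cdot> stackM s (nh (X \<otimes> Z)) =
    nh (X \<otimes> stack s Z) \<cdot> braid_hat s x Z"
proof -
  have "(Ide V X \<boxtimes> braid_hat s yx Z) \<cdot> braid_hat s x (Y \<otimes> (X \<otimes> Z)) \<cdot> stackM s (nh (X \<otimes> Z)) =
      (Ide V X \<boxtimes> (Ide V Y \<boxtimes> braid_hat s x Z)) \<cdot>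
      ((Ide V X \<boxtimes> braid_hat s y (X \<otimes> Z)) \<cdot> braid_hat s x (Y \<otimes> (X \<otimes> Z)) \<cdot> stackM s (nh (X \<otimes> Z)))"
    using s Z by (simp add: braid_hat_Node_right Ide_TensM_Cmp)
  also have "(Ide V X \<boxtimes> braid_hat s y (X \<otimes> Z)) \<cdot> braid_hat s x (Y \<otimes> (X \<otimes> Z)) \<cdot> stackM s (nh (X \<otimes> Z)) =
      nh (stack s (X \<otimes> Z))"
    using s Z by (intro braid_hat_nh) simp_all
  also have "(Ide V X \<boxtimes> (Ide V Y \<boxtimes> braid_hat s x Z)) \<cdot> nh (stack s (X \<otimes> Z)) =
      nh (X \<otimes> stack s Z) \<cdot> braid_hat s x Z"
    using s Z by (simp add: nh_natural)
  finally show ?thesis .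
qed

lemma mate_twist_hat:
  assumes A: "monoid_in V A" and B: "monoid_in V B" and t: "t \<in> hom V (MCar A \<otimes> (Y \<otimes> X)) (MCar B)"
    and Z: "Z \<in> Obj V"
  shows "twist_hat A B X (mate (MCar A) t) Z =
    (Ide V X \<boxtimes> hat (\<langle>MCar A\<rangle> \<odot> yx) t \<langle>MCar B\<rangle> Z) \<cdot> braid_hat \<langle>MCar A\<rangle> x (Y \<otimes> (X \<otimes> Z)) \<cdot>
    (Ide V (MCar A) \<boxtimes> nh (X \<otimes> Z))"
  using mate_hat[of "\<langle>MCar A\<rangle>" "\<langle>MCar B\<rangle>" t Z] A B t Z by (simp add: twist_hat_def)

lemma coend_comonoid_simps [simp]:
  "CCar coend_comonoid = Y \<otimes> X" "Couni coend_comonoid = d"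
  "Comul coend_comonoid \<in> hom V (Y \<otimes> X) ((Y \<otimes> X) \<otimes> (Y \<otimes> X))"
  by (simp_all add: coend_comonoid_def hom_iff)

text \<open>The two axioms of a measuring are compared with those of a twisted action by taking mates, over
  \<open>A \<otimes> A\<close> for the multiplication and over \<open>\<one>\<close> for the unit.\<close>

lemma mate_mul_iff:
  assumes A: "monoid_in V A" and B: "monoid_in V B" and t: "t \<in> hom V (MCar A \<otimes> (Y \<otimes> X)) (MCar B)"
  shows "t \<cdot> (Mul A \<boxtimes> Ide V (Y \<otimes> X)) = Mul B \<cdot> (t \<boxtimes> t) \<cdot>
      interchange V (MCar A) (MCar A) (Y \<otimes> X) (Y \<otimes> X) \<cdot>
      (Ide V (MCar A \<otimes> MCar A) \<boxtimes> Comul coend_comonoid) \<longleftrightarrow>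
    (\<forall>Z\<in>Obj V. (Ide V X \<boxtimes> mul_hat B Z) \<cdot> twist_hat A B X (mate (MCar A) t) (MCar B \<otimes> Z) \<cdot>
      (Ide V (MCar A) \<boxtimes> twist_hat A B X (mate (MCar A) t) Z) =
      twist_hat A B X (mate (MCar A) t) Z \<cdot> mul_hat A (X \<otimes> Z))" (is "?L = ?R \<longleftrightarrow> _")
proof -
  let ?a = "MCar A" and ?b = "MCar B" and ?ta = "\<langle>MCar A\<rangle>" and ?tb = "\<langle>MCar B\<rangle>"
  let ?aa = "?ta \<odot> ?ta"
  let ?t = "hat (?ta \<odot> yx) t ?tb" and ?\<psi> = "twist_hat A B X (mate ?a t)" and ?c = "braid_hat ?ta"
  have [simp]: "t \<in> Mor V" "Dom V t = ?a \<otimes> (Y \<otimes> X)" "Cod V t = ?b"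
    using t by (auto simp: hom_iff)
  have \<psi>: "mate ?a t \<in> hom V (?a \<otimes> X) (X \<otimes> ?b)"
    using A t by (simp add: mate_in)
  have L: "?L \<in> hom V ((?a \<otimes> ?a) \<otimes> (Y \<otimes> X)) ?b"
    using A by (simp add: hom_iff)
  have R: "?R \<in> hom V ((?a \<otimes> ?a) \<otimes> (Y \<otimes> X)) ?b"
    using A B interchange_in[of ?a ?a "Y \<otimes> X" "Y \<otimes> X"] coend_comonoid_simps(3) by (simp add: hom_iff)
  have Lh: "hat (?aa \<odot> x) (mate (?a \<otimes> ?a) ?L) (x \<odot> ?tb) Z = ?\<psi> Z \<cdot> mul_hat A (X \<otimes> Z)"
    if Z: "Z \<in> Obj V" for Z
  proof -
    let ?W = "Y \<otimes> (X \<otimes> Z)"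
    have "hat (?aa \<odot> yx) ?L ?tb Z = interp (Box (?ta \<odot> yx) t ?tb \<bullet> (Box ?aa (Mul A) ?ta \<parallel> Id yx)) Z"
      by (rule hat_eqI) (use A B t Z in simp_all)
    then have h: "hat (?aa \<odot> yx) ?L ?tb Z = ?t Z \<cdot> mul_hat A ?W"
      using A B t Z by (simp add: mul_hat_def)
    have "hat (?aa \<odot> x) (mate (?a \<otimes> ?a) ?L) (x \<odot> ?tb) Z =
        (Ide V X \<boxtimes> ?t Z) \<cdot> ((Ide V X \<boxtimes> mul_hat A ?W) \<cdot> braid_hat ?aa x ?W) \<cdot>
        (Ide V ?a \<boxtimes> (Ide V ?a \<boxtimes> nh (X \<otimes> Z)))"
      using mate_hat[of ?aa ?tb ?L Z] A B t L Z by (simp add: h Ide_TensM_Cmp)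
    \<comment> \<open>Naturality of the braiding along \<open>Mul A\<close>: A \<otimes> A may be
      multiplied before or after crossing X.\<close>
    also have "(Ide V X \<boxtimes> mul_hat A ?W) \<cdot> braid_hat ?aa x ?W = ?c x ?W \<cdot> mul_hat A (X \<otimes> ?W)"
      using A Z braid_hat_left[of ?aa ?ta x ?W "Mul A"] by (simp add: mul_hat_def)
    also have "(Ide V X \<boxtimes> ?t Z) \<cdot> (?c x ?W \<cdot> mul_hat A (X \<otimes> ?W)) \<cdot>
        (Ide V ?a \<boxtimes> (Ide V ?a \<boxtimes> nh (X \<otimes> Z))) =
        (Ide V X \<boxtimes> ?t Z) \<cdot> ?c x ?W \<cdot> (mul_hat A (X \<otimes> ?W) \<cdot> (Ide V ?a \<boxtimes> (Ide V ?a \<boxtimes> nh (X \<otimes> Z))))"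
      using A B t Z by simp
    also have "mul_hat A (X \<otimes> ?W) \<cdot> (Ide V ?a \<boxtimes> (Ide V ?a \<boxtimes> nh (X \<otimes> Z))) =
        (Ide V ?a \<boxtimes> nh (X \<otimes> Z)) \<cdot> mul_hat A (X \<otimes> Z)"
      using A Z by (simp add: mul_hat_natural)
    finally show ?thesis
      using A B t Z by (simp add: mate_twist_hat)
  qed
  \<comment> \<open>In this mate the second copy of A crosses X and then, because of the
    interchange, the first pair Y \<otimes> X. The aim is to untangle the composite into one mate
    acting in the tail of another.\<close>
  have Rh: "hat (?aa \<odot> x) (mate (?a \<otimes> ?a) ?R) (x \<odot> ?tb) Z =
      (Ide V X \<boxtimes> mul_hat B Z) \<cdot> ?\<psi> (?b \<otimes> Z) \<cdot> (Ide V ?a \<boxtimes> ?\<psi> Z)" if Z: "Z \<in> Obj V" for Z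
  proof -
    let ?W = "Y \<otimes> (X \<otimes> Z)" and ?i = "\<lambda>f. Ide V ?a \<boxtimes> f"
    let ?n = "nh (X \<otimes> Z)"
    let ?F = "(Ide V X \<boxtimes> mul_hat B Z) \<cdot> (Ide V X \<boxtimes> ?t (?b \<otimes> Z))"
    let ?yxt = "Ide V Y \<boxtimes> (Ide V X \<boxtimes> ?t Z)"
    let ?T = "Box (?ta \<odot> yx) t ?tb"
    let ?ic = "AscI ?ta yx (?ta \<odot> yx) \<bullet>
      (Id ?ta \<parallel> (Asc yx ?ta yx \<bullet> (braid_box ?ta yx \<parallel> Id yx) \<bullet> AscI ?ta yx yx)) \<bullet> Asc ?ta ?ta (yx \<odot> yx)"
    have "hat (?aa \<odot> yx) ?R ?tb Z =
        interp (Box (?tb \<odot> ?tb) (Mul B) ?tb \<bullet> (?T \<parallel> ?T) \<bullet> ?ic \<bullet> (Id ?aa \<parallel> comul_box)) Z"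
      by (rule hat_eqI) (use A B t Z in \<open>simp_all add: Braid_in coend_comonoid_def coev_def interchange_def\<close>)
    then have h: "hat (?aa \<odot> yx) ?R ?tb Z = mul_hat B Z \<cdot> ?t (?b \<otimes> Z) \<cdot> ?i ?yxt \<cdot>
        ?i (?c yx ?W) \<cdot> ?i (?i (Ide V Y \<boxtimes> ?n))"
      using A B t Z by (simp add: Braid_in mul_hat_def braid_hat_def nh_def)
    have "hat (?aa \<odot> x) (mate (?a \<otimes> ?a) ?R) (x \<odot> ?tb) Z =
        ?F \<cdot> (Ide V X \<boxtimes> ?i ?yxt) \<cdot> (Ide V X \<boxtimes> ?i (?c yx ?W)) \<cdot>
        ((Ide V X \<boxtimes> ?i (?i (Ide V Y \<boxtimes> ?n))) \<cdot> braid_hat ?aa x ?W) \<cdot> ?i (?i ?n)"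
      using mate_hat[of ?aa ?tb ?R Z] A B t R Z by (simp add: h Ide_TensM_Cmp)
    also have "(Ide V X \<boxtimes> ?i (?i (Ide V Y \<boxtimes> ?n))) \<cdot> braid_hat ?aa x ?W =
        braid_hat ?aa x (Y \<otimes> (X \<otimes> ?W)) \<cdot> ?i (?i (Ide V X \<boxtimes> (Ide V Y \<boxtimes> ?n)))"
      using A Z braid_hat_natural[of ?aa x "Ide V Y \<boxtimes> ?n"] by simp
    also have "?F \<cdot> (Ide V X \<boxtimes> ?i ?yxt) \<cdot> (Ide V X \<boxtimes> ?i (?c yx ?W)) \<cdot>
        (braid_hat ?aa x (Y \<otimes> (X \<otimes> ?W)) \<cdot> ?i (?i (Ide V X \<boxtimes> (Ide V Y \<boxtimes> ?n)))) \<cdot> ?i (?i ?n) =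
        ?F \<cdot> (Ide V X \<boxtimes> ?i ?yxt) \<cdot> (Ide V X \<boxtimes> ?i (?c yx ?W)) \<cdot> braid_hat ?aa x (Y \<otimes> (X \<otimes> ?W)) \<cdot>
        ?i (?i ((Ide V X \<boxtimes> (Ide V Y \<boxtimes> ?n)) \<cdot> ?n))"
      using A B t Z by (simp add: Ide_TensM_Cmp)
    \<comment> \<open>The pairs inserted by the comultiplication and by \<open>mate\<close> are
      independent; exchanging them assigns one pair to each of the two nested mates.\<close>
    also have "(Ide V X \<boxtimes> (Ide V Y \<boxtimes> ?n)) \<cdot> ?n = nh (X \<otimes> ?W) \<cdot> ?n"
      using Z by (simp add: nh_natural)
    also have "braid_hat ?aa x (Y \<otimes> (X \<otimes> ?W)) =
        ?c x (?a \<otimes> (Y \<otimes> (X \<otimes> ?W))) \<cdot> ?i (?c x (Y \<otimes> (X \<otimes> ?W)))"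
      using A Z by (simp add: braid_hat_Node_left)
    also have "?F \<cdot> (Ide V X \<boxtimes> ?i ?yxt) \<cdot> (Ide V X \<boxtimes> ?i (?c yx ?W)) \<cdot>
        (?c x (?a \<otimes> (Y \<otimes> (X \<otimes> ?W))) \<cdot> ?i (?c x (Y \<otimes> (X \<otimes> ?W)))) \<cdot> ?i (?i (nh (X \<otimes> ?W) \<cdot> ?n)) =
        ?F \<cdot> (Ide V X \<boxtimes> ?i ?yxt) \<cdot> ((Ide V X \<boxtimes> ?i (?c yx ?W)) \<cdot> ?c x (?a \<otimes> (Y \<otimes> (X \<otimes> ?W)))) \<cdot>
        ?i (?c x (Y \<otimes> (X \<otimes> ?W)) \<cdot> ?i (nh (X \<otimes> ?W))) \<cdot> ?i (?i ?n)"
      using A B t Z by (simp add: Ide_TensM_Cmp)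
    also have "(Ide V X \<boxtimes> ?i (?c yx ?W)) \<cdot> ?c x (?a \<otimes> (Y \<otimes> (X \<otimes> ?W))) =
        ?c x (Y \<otimes> (X \<otimes> (?a \<otimes> ?W))) \<cdot> ?i (Ide V X \<boxtimes> ?c yx ?W)"
      using A Z braid_hat_natural[of ?ta x "?c yx ?W"] by simp
    also have "?F \<cdot> (Ide V X \<boxtimes> ?i ?yxt) \<cdot> (?c x (Y \<otimes> (X \<otimes> (?a \<otimes> ?W))) \<cdot> ?i (Ide V X \<boxtimes> ?c yx ?W)) \<cdot>
        ?i (?c x (Y \<otimes> (X \<otimes> ?W)) \<cdot> ?i (nh (X \<otimes> ?W))) \<cdot> ?i (?i ?n) =
        ?F \<cdot> (Ide V X \<boxtimes> ?i ?yxt) \<cdot> ?c x (Y \<otimes> (X \<otimes> (?a \<otimes> ?W))) \<cdot>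
        ?i ((Ide V X \<boxtimes> ?c yx ?W) \<cdot> ?c x (Y \<otimes> (X \<otimes> ?W)) \<cdot> ?i (nh (X \<otimes> ?W))) \<cdot> ?i (?i ?n)"
      using A B t Z by (simp add: Ide_TensM_Cmp)
    \<comment> \<open>After the slide the second copy of A crosses only one X, as the inner twisted
      action requires.\<close>
    also have "(Ide V X \<boxtimes> ?c yx ?W) \<cdot> ?c x (Y \<otimes> (X \<otimes> ?W)) \<cdot> ?i (nh (X \<otimes> ?W)) =
        nh (X \<otimes> (?a \<otimes> ?W)) \<cdot> ?c x ?W"
      using A Z braid_hat_slide[of ?ta ?W] by simp
    also have "?F \<cdot> (Ide V X \<boxtimes> ?i ?yxt) \<cdot> ?c x (Y \<otimes> (X \<otimes> (?a \<otimes> ?W))) \<cdot>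
        ?i (nh (X \<otimes> (?a \<otimes> ?W)) \<cdot> ?c x ?W) \<cdot> ?i (?i ?n) =
        ?F \<cdot> ((Ide V X \<boxtimes> ?i ?yxt) \<cdot> ?c x (Y \<otimes> (X \<otimes> (?a \<otimes> ?W)))) \<cdot>
        ?i (nh (X \<otimes> (?a \<otimes> ?W))) \<cdot> ?i (?c x ?W) \<cdot> ?i (?i ?n)"
      using A B t Z by (simp add: Ide_TensM_Cmp)
    also have "(Ide V X \<boxtimes> ?i ?yxt) \<cdot> ?c x (Y \<otimes> (X \<otimes> (?a \<otimes> ?W))) =
        ?c x (Y \<otimes> (X \<otimes> (?b \<otimes> Z))) \<cdot> ?i (Ide V X \<boxtimes> ?yxt)"
      using A B t Z braid_hat_natural[of ?ta x ?yxt] by simp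
    also have "?F \<cdot> (?c x (Y \<otimes> (X \<otimes> (?b \<otimes> Z))) \<cdot> ?i (Ide V X \<boxtimes> ?yxt)) \<cdot>
        ?i (nh (X \<otimes> (?a \<otimes> ?W))) \<cdot> ?i (?c x ?W) \<cdot> ?i (?i ?n) =
        ?F \<cdot> ?c x (Y \<otimes> (X \<otimes> (?b \<otimes> Z))) \<cdot> ?i ((Ide V X \<boxtimes> ?yxt) \<cdot> nh (X \<otimes> (?a \<otimes> ?W))) \<cdot>
        ?i (?c x ?W) \<cdot> ?i (?i ?n)"
      using A B t Z by (simp add: Ide_TensM_Cmp)
    also have "(Ide V X \<boxtimes> ?yxt) \<cdot> nh (X \<otimes> (?a \<otimes> ?W)) = nh (X \<otimes> (?b \<otimes> Z)) \<cdot> (Ide V X \<boxtimes> ?t Z)"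
      using A B t Z nh_natural[of "Ide V X \<boxtimes> ?t Z"] by simp
    finally show ?thesis
      using A B t Z by (simp add: mate_twist_hat Ide_TensM_Cmp)
  qed
  have "?L = ?R \<longleftrightarrow> mate (?a \<otimes> ?a) ?L = mate (?a \<otimes> ?a) ?R"
    using A L R by (intro mate_cancel) simp_all
  also have "\<dots> \<longleftrightarrow> eval (Box (?aa \<odot> x) (mate (?a \<otimes> ?a) ?L) (x \<odot> ?tb)) =
      eval (Box (?aa \<odot> x) (mate (?a \<otimes> ?a) ?R) (x \<odot> ?tb))"
    by simp
  also have "\<dots> \<longleftrightarrow> (\<forall>Z\<in>Obj V. hat (?aa \<odot> x) (mate (?a \<otimes> ?a) ?L) (x \<odot> ?tb) Z =
      hat (?aa \<odot> x) (mate (?a \<otimes> ?a) ?R) (x \<odot> ?tb) Z)"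
    by (subst eval_eq_iff) (use A B L R in \<open>simp_all add: mate_in\<close>)
  finally show ?thesis
    using Lh Rh by (auto simp: eq_commute)
qed

lemma mate_uni_iff:
  assumes A: "monoid_in V A" and B: "monoid_in V B" and t: "t \<in> hom V (MCar A \<otimes> (Y \<otimes> X)) (MCar B)"
  shows "t \<cdot> (Uni A \<boxtimes> Ide V (Y \<otimes> X)) = Uni B \<cdot> d \<cdot> LUnit V (Y \<otimes> X) \<longleftrightarrow>
    (\<forall>Z\<in>Obj V. twist_hat A B X (mate (MCar A) t) Z \<cdot> uni_hat A (X \<otimes> Z) = Ide V X \<boxtimes> uni_hat B Z)"
    (is "?L = ?R \<longleftrightarrow> _")
proof -
  let ?a = "MCar A" and ?b = "MCar B" and ?ta = "\<langle>MCar A\<rangle>" and ?tb = "\<langle>MCar B\<rangle>"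
  let ?t = "hat (?ta \<odot> yx) t ?tb" and ?\<psi> = "twist_hat A B X (mate ?a t)" and ?c = "braid_hat ?ta"
  have [simp]: "t \<in> Mor V" "Dom V t = ?a \<otimes> (Y \<otimes> X)" "Cod V t = ?b"
    using t by (auto simp: hom_iff)
  have L: "?L \<in> hom V (\<one> \<otimes> (Y \<otimes> X)) ?b" and R: "?R \<in> hom V (\<one> \<otimes> (Y \<otimes> X)) ?b"
    using A B by (simp_all add: hom_iff)
  have Lh: "hat (Nul \<odot> x) (mate \<one> ?L) (x \<odot> ?tb) Z = ?\<psi> Z \<cdot> uni_hat A (X \<otimes> Z)" if Z: "Z \<in> Obj V" for Z
  proof -
    let ?W = "Y \<otimes> (X \<otimes> Z)"
    have "hat (Nul \<odot> yx) ?L ?tb Z = interp (Box (?ta \<odot> yx) t ?tb \<bullet> (Box Nul (Uni A) ?ta \<parallel> Id yx)) Z"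
      by (rule hat_eqI) (use A B t Z in simp_all)
    then have h: "hat (Nul \<odot> yx) ?L ?tb Z = ?t Z \<cdot> uni_hat A ?W"
      using A B t Z by (simp add: uni_hat_def)
    have "hat (Nul \<odot> x) (mate \<one> ?L) (x \<odot> ?tb) Z =
        (Ide V X \<boxtimes> ?t Z) \<cdot> (Ide V X \<boxtimes> uni_hat A ?W) \<cdot> nh (X \<otimes> Z)"
      using mate_hat[of Nul ?tb ?L Z] A B t L Z by (simp add: h Ide_TensM_Cmp)
    \<comment> \<open>The braiding with \<one> is trivial, so the unit of A may be inserted behind
      X, or before X and then moved across.\<close>
    also have "Ide V X \<boxtimes> uni_hat A ?W = ?c x ?W \<cdot> uni_hat A (X \<otimes> ?W)"
      using A Z braid_hat_left[of Nul ?ta x ?W "Uni A"] by (simp add: uni_hat_def)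
    also have "(Ide V X \<boxtimes> ?t Z) \<cdot> (?c x ?W \<cdot> uni_hat A (X \<otimes> ?W)) \<cdot> nh (X \<otimes> Z) =
        (Ide V X \<boxtimes> ?t Z) \<cdot> ?c x ?W \<cdot> (uni_hat A (X \<otimes> ?W) \<cdot> nh (X \<otimes> Z))"
      using A B t Z by simp
    also have "uni_hat A (X \<otimes> ?W) \<cdot> nh (X \<otimes> Z) = (Ide V ?a \<boxtimes> nh (X \<otimes> Z)) \<cdot> uni_hat A (X \<otimes> Z)"
      using A Z by (simp add: uni_hat_natural)
    finally show ?thesis
      using A B t Z by (simp add: mate_twist_hat)
  qed
  have Rh: "hat (Nul \<odot> x) (mate \<one> ?R) (x \<odot> ?tb) Z = Ide V X \<boxtimes> uni_hat B Z" if Z: "Z \<in> Obj V" for Z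
  proof -
    have "hat (Nul \<odot> yx) ?R ?tb Z = interp (Box Nul (Uni B) ?tb \<bullet> dbox \<bullet> LU yx) Z"
      by (rule hat_eqI) (use B Z in simp_all)
    then have "hat (Nul \<odot> yx) ?R ?tb Z = uni_hat B Z \<cdot> dh Z"
      using B Z by (simp add: uni_hat_def dh_def)
    \<comment> \<open>Over \<one> the crossing disappears, and the pair created by
      \<open>mate\<close> is cancelled against \<open>d\<close> by a snake identity.\<close>
    then show ?thesis
      using mate_hat[of Nul ?tb ?R Z] B R Z by (simp add: Ide_TensM_Cmp)
  qed
  have "?L = ?R \<longleftrightarrow> mate \<one> ?L = mate \<one> ?R"
    using L R by (intro mate_cancel) simp_all
  also have "\<dots> \<longleftrightarrow> eval (Box (Nul \<odot> x) (mate \<one> ?L) (x \<odot> ?tb)) = eval (Box (Nul \<odot> x) (mate \<one> ?R) (x \<odot> ?tb))"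
    by simp
  also have "\<dots> \<longleftrightarrow> (\<forall>Z\<in>Obj V. hat (Nul \<odot> x) (mate \<one> ?L) (x \<odot> ?tb) Z =
      hat (Nul \<odot> x) (mate \<one> ?R) (x \<odot> ?tb) Z)"
    by (subst eval_eq_iff) (use A B L R in \<open>simp_all add: mate_in\<close>)
  finally show ?thesis
    using Lh Rh by auto
qed

section \<open>Coactions and the universal property\<close>

lemma bij_mate_measurings:
  assumes A: "monoid_in V A" and B: "monoid_in V B"
  shows "bij_betw (mate (MCar A)) (measurings A coend_comonoid B) (twisted_actions V A B X)"
proof (rule bij_betw_restrict[OF bij_mate])
  fix t assume t: "t \<in> hom V (MCar A \<otimes> (Y \<otimes> X)) (MCar B)"
  show "mate (MCar A) t \<in> twisted_actions V A B X \<longleftrightarrow> t \<in> measurings A coend_comonoid B"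
    using t A mate_mul_iff[OF A B t] mate_uni_iff[OF A B t]
    by (simp add: twisted_actions_iff[OF A B X_in] measurings_def mate_in)
qed (use A B in \<open>auto simp: measurings_def twisted_actions_def\<close>)

text \<open>In a coaction of the form \<open>coact f\<close>, the arrow \<open>f\<close> lies in the
  tail of the crossing of A and X. Naturality lets it act after the crossing, directly before
  \<theta>.\<close>

lemma coaction_to_twisted_coact:
  assumes A: "monoid_in V A" and B: "monoid_in V B" and P: "P \<in> Obj V" "CCar C = P"
    and \<theta>: "\<theta> \<in> hom V (MCar A \<otimes> P) (MCar B)" and f: "f \<in> hom V (Y \<otimes> X) P"
  shows "coaction_to_twisted V A C \<theta> X (coact f) = mate (MCar A) (\<theta> \<cdot> (Ide V (MCar A) \<boxtimes> f))"
proof -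
  let ?a = "\<langle>MCar A\<rangle>" and ?b = "\<langle>MCar B\<rangle>" and ?p = "\<langle>P\<rangle>"
  have t: "\<theta> \<cdot> (Ide V (MCar A) \<boxtimes> f) \<in> hom V (MCar A \<otimes> (Y \<otimes> X)) (MCar B)"
    using A \<theta> f by (simp add: hom_iff)
  have \<rho>: "coact f \<in> hom V X (X \<otimes> P)"
    using f by (rule coact_in)
  let ?L = "(Id x \<parallel> Box (?a \<odot> ?p) \<theta> ?b) \<bullet> Asc x ?a ?p \<bullet> (braid_box ?a x \<parallel> Id ?p) \<bullet> AscI ?a x ?p \<bullet>
    (Id ?a \<parallel> Box x (coact f) (x \<odot> ?p))"
  let ?R = "Box (?a \<odot> x) (mate (MCar A) (\<theta> \<cdot> (Ide V (MCar A) \<boxtimes> f))) (x \<odot> ?b)"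
  have "eval ?L = eval ?R"
  proof (rule eval_eq_iff[THEN iffD2], safe)
    fix Z assume Z: "Z \<in> Obj V"
    let ?\<theta> = "hat (?a \<odot> ?p) \<theta> ?b Z" and ?f = "hat yx f ?p Z" and ?W = "Y \<otimes> (X \<otimes> Z)"
    have "hat (?a \<odot> yx) (\<theta> \<cdot> (Ide V (MCar A) \<boxtimes> f)) ?b Z =
        interp (Box (?a \<odot> ?p) \<theta> ?b \<bullet> (Id ?a \<parallel> Box yx f ?p)) Z"
      by (rule hat_eqI) (use A B P \<theta> f Z in simp_all)
    then have h: "hat (?a \<odot> yx) (\<theta> \<cdot> (Ide V (MCar A) \<boxtimes> f)) ?b Z = ?\<theta> \<cdot> (Ide V (MCar A) \<boxtimes> ?f)"
      using A B P \<theta> f Z by simp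
    have "interp ?L Z = (Ide V X \<boxtimes> ?\<theta>) \<cdot> (braid_hat ?a x (P \<otimes> Z) \<cdot> (Ide V (MCar A) \<boxtimes> (Ide V X \<boxtimes> ?f))) \<cdot>
        (Ide V (MCar A) \<boxtimes> nh (X \<otimes> Z))"
      using A B P \<theta> f \<rho> Z by (simp add: coact_hat Ide_TensM_Cmp Braid_in braid_hat_def)
    also have "braid_hat ?a x (P \<otimes> Z) \<cdot> (Ide V (MCar A) \<boxtimes> (Ide V X \<boxtimes> ?f)) =
        (Ide V X \<boxtimes> (Ide V (MCar A) \<boxtimes> ?f)) \<cdot> braid_hat ?a x ?W"
      using A P f Z braid_hat_natural[of ?a x ?f] by simp
    finally show "interp ?L Z = interp ?R Z"
      using mate_hat[of ?a ?b "\<theta> \<cdot> (Ide V (MCar A) \<boxtimes> f)" Z] A B P \<theta> f t Z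
      by (simp add: h Ide_TensM_Cmp)
  qed (use A B P \<theta> \<rho> t in \<open>simp_all add: Braid_in mate_in\<close>)
  then show ?thesis
    using P by (simp add: coaction_to_twisted_def)
qed

text \<open>A Yoneda argument at the comonoid Y \<otimes> X: the bijection supplied by \<Phi>,
  followed by uncurrying and mates, is computed on a comonoid morphism \<open>f\<close> and found to
  be the comparison map applied to \<open>coact f\<close>.\<close>

lemma bij_coaction_to_twisted:
  assumes A: "monoid_in V A" and B: "monoid_in V B" and U: "universal_measuring V A B P \<Phi>"
  shows "bij_betw (coaction_to_twisted V A P (measuring V B P \<Phi>) X) (comodule_structures V P X)
    (twisted_actions V A B X)"
proof -
  let ?a = "MCar A" and ?b = "MCar B" and ?p = "CCar P" and ?C = coend_comonoid
  let ?H = "IHom V ?p ?b" and ?K = "IHom V (Y \<otimes> X) ?b"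
  let ?ev = "Ev V ?p ?b" and ?ev' = "Ev V (Y \<otimes> X) ?b"
  have P: "comonoid_in V P"
    and bij: "\<And>C. comonoid_in V C \<Longrightarrow> bij_betw (\<Phi> C) (comonoid_hom V C P) (monoid_hom V A (convolution V C B))"
    and nat: "\<And>C C' f g. comonoid_in V C \<Longrightarrow> comonoid_in V C' \<Longrightarrow> f \<in> comonoid_hom V C P \<Longrightarrow>
      g \<in> comonoid_hom V C' C \<Longrightarrow> \<Phi> C' (f \<cdot> g) = precomp V g ?b \<cdot> \<Phi> C f"
    using U unfolding universal_measuring_def by blast+
  have p [simp]: "?p \<in> Obj V" and "Comul P \<in> hom V ?p (?p \<otimes> ?p)" "Couni P \<in> hom V ?p \<one>"
    using P by (auto simp: comonoid_in_def)
  then have id: "Ide V ?p \<in> comonoid_hom V P P"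
    by (simp add: comonoid_hom_def hom_iff)
  \<comment> \<open>By naturality, \<open>\<Phi>\<close> is determined by the universal measuring.\<close>
  define \<phi> where "\<phi> = \<Phi> P (Ide V ?p)"
  have \<phi>: "\<phi> \<in> hom V ?a ?H"
    using bij_betwE[OF bij[OF P]] id by (auto simp: \<phi>_def monoid_hom_def convolution_def Let_def)
  then have [simp]: "\<phi> \<in> Mor V" "Dom V \<phi> = ?a" "Cod V \<phi> = ?H"
    by (auto simp: hom_iff)
  define \<theta> where "\<theta> = measuring V B P \<Phi>"
  have \<theta>: "\<theta> = ?ev \<cdot> (\<phi> \<boxtimes> Ide V ?p)"
    by (simp add: \<theta>_def measuring_def \<phi>_def)
  have \<theta>_in: "\<theta> \<in> hom V (?a \<otimes> ?p) ?b"
    unfolding \<theta> using A B by (simp add: hom_iff)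
  let ?unc = "\<lambda>g. ?ev' \<cdot> (g \<boxtimes> Ide V (Y \<otimes> X))"
  \<comment> \<open>Writing \<open>f\<close> as the identity of P composed with \<open>f\<close>,
    naturality gives \<Phi> at \<open>f\<close> as a precomposition; uncurrying makes that the
    universal measuring precomposed with A \<otimes> \<open>f\<close>.\<close>
  have key: "?unc (\<Phi> ?C f) = \<theta> \<cdot> (Ide V ?a \<boxtimes> f)" if f: "f \<in> comonoid_hom V ?C P" for f
  proof -
    have f': "f \<in> hom V (Y \<otimes> X) ?p"
      using f by (simp add: comonoid_hom_def)
    then have [simp]: "f \<in> Mor V" "Dom V f = Y \<otimes> X" "Cod V f = ?p"
      by (auto simp: hom_iff)
    have "\<Phi> ?C f = precomp V f ?b \<cdot> \<phi>"
      using nat[OF P coend_comonoid id f] by (simp add: \<phi>_def)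
    moreover have e: "?ev \<cdot> (Ide V ?H \<boxtimes> f) \<in> hom V (?H \<otimes> (Y \<otimes> X)) ?b"
      using B by (simp add: hom_iff)
    have pc: "precomp V f ?b = curry_arrow V ?H (Y \<otimes> X) ?b (?ev \<cdot> (Ide V ?H \<boxtimes> f))"
      by (simp add: precomp_def Let_def)
    ultimately have "?unc (\<Phi> ?C f) = (?ev \<cdot> (Ide V ?H \<boxtimes> f)) \<cdot> (\<phi> \<boxtimes> Ide V (Y \<otimes> X))"
      using B e by (simp only: pc, subst Ev_Cmp) (simp_all add: Ev_curry_arrow)
    also have "\<dots> = \<theta> \<cdot> (Ide V ?a \<boxtimes> f)"
      unfolding \<theta> using A B by (simp add: TensM_Cmp')
    finally show ?thesis .
  qed
  have bij_unc: "bij_betw (mate ?a \<circ> ?unc) (monoid_hom V A (convolution V ?C B)) (twisted_actions V A B X)"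
  proof -
    have c: "bij_betw (curry_arrow V ?a (Y \<otimes> X) ?b) (measurings A ?C B) (monoid_hom V A (convolution V ?C B))"
      using bij_curry_measurings[OF A B coend_comonoid] by simp
    have "bij_betw ((mate ?a \<circ> ?unc) \<circ> curry_arrow V ?a (Y \<otimes> X) ?b) (measurings A ?C B) (twisted_actions V A B X)
        \<longleftrightarrow> bij_betw (mate ?a) (measurings A ?C B) (twisted_actions V A B X)"
      by (rule bij_betw_cong) (use A B in \<open>simp add: measurings_def Ev_curry_arrow\<close>)
    then show ?thesis
      using bij_betw_comp_iff[OF c] bij_mate_measurings[OF A B] by blast
  qed
  \<comment> \<open>This composite agrees with the comparison map after \<open>coact\<close>; since
    \<open>coact\<close> is itself a bijection onto the comodule structures, it can be
    cancelled.\<close>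
  have "bij_betw ((mate ?a \<circ> ?unc) \<circ> \<Phi> ?C) (comonoid_hom V ?C P) (twisted_actions V A B X)"
    by (rule bij_betw_trans[OF bij[OF coend_comonoid] bij_unc])
  moreover have "bij_betw ((mate ?a \<circ> ?unc) \<circ> \<Phi> ?C) (comonoid_hom V ?C P) (twisted_actions V A B X) \<longleftrightarrow>
      bij_betw (coaction_to_twisted V A P \<theta> X \<circ> coact) (comonoid_hom V ?C P) (twisted_actions V A B X)"
    by (rule bij_betw_cong)
      (simp add: key coaction_to_twisted_coact[OF A B p refl \<theta>_in] comonoid_hom_def)
  ultimately show ?thesis
    using bij_betw_comp_iff[OF bij_comodule_structures[OF P]] unfolding \<theta>_def by blast
qed

end

text \<open>The explicit form of (1) serves as the hub, with which every other description is
  compared by a concrete map. Hom-objects of modules and P(A, B) are determined only up to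
  isomorphism; hence (4) is asserted for every equaliser and (5) for every universal measuring
  comonoid.\<close>

theorem proposition6p3:
  fixes \<kappa> :: "'k rel"
    and V :: "('o, 'm) bmc" (structure)
    and A B :: "('o, 'm) mon"
    and X :: 'o
  assumes "universe_cardinal \<kappa>"
    and "braided_monoidal_closed V"
    and "locally_presentable \<kappa> V"
    and "monoid_in V A"
    and "monoid_in V B"
    and "X \<in> Obj V"
  shows
    "bij_betw (\<lambda>\<psi>. (MCar A \<otimes> X, \<psi>, X))
       (twisted_actions V A B X)
       (algebra_structures (kleisli V B) (kleisli_monad V A B) X)
     \<and>
     bij_betw (curry_arrow V (MCar A) X (X \<otimes> MCar B))
       (twisted_actions V A B X)
       (monoid_hom V A (kleisli_endo V B X))
     \<and>
     bij_betw (\<lambda>\<psi>. (tensor_module V B (MCar A) (free_module V B X),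
                     extend_to_free V A B X \<psi>,
                     free_module V B X))
       (twisted_actions V A B X)
       (algebra_structures (modules V B) (module_monad V A B) (free_module V B X))
     \<and>
     (\<forall>E e. is_module_ihom V B (free_module V B X) (free_module V B X) E e \<longrightarrow>
       bij_betw (\<lambda>\<psi>. lift_through V e
                   (curry_arrow V (MCar A) (X \<otimes> MCar B) (X \<otimes> MCar B) (extend_to_free V A B X \<psi>)))
         (twisted_actions V A B X)
         (monoid_hom V A (module_endo V (X \<otimes> MCar B) E e)))
     \<and>
     (has_dual V X \<longrightarrow>
       (\<forall>P \<Phi>. universal_measuring V A B P \<Phi> \<longrightarrow>
         bij_betw (coaction_to_twisted V A P (measuring V B P \<Phi>) X)
           (comodule_structures V P X)
           (twisted_actions V A B X)))"
proof (intro conjI allI impI)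
  interpret braided_monoidal_closed V
    by fact
  note A = \<open>monoid_in V A\<close> and B = \<open>monoid_in V B\<close> and X = \<open>X \<in> Obj V\<close>
  let ?m = "(Ide V X \<boxtimes> Mul B) \<cdot> Assoc V X (MCar B) (MCar B)"
  have free: "free_module V B X = (X \<otimes> MCar B, ?m)"
    by (simp add: free_module_def)
  have m: "?m \<in> hom V ((X \<otimes> MCar B) \<otimes> MCar B) (X \<otimes> MCar B)"
    using B X by (simp add: hom_iff)
  note ext = bij_extend_to_free[OF A B X]
  show "bij_betw (\<lambda>\<psi>. (MCar A \<otimes> X, \<psi>, X)) (twisted_actions V A B X)
      (algebra_structures (kleisli V B) (kleisli_monad V A B) X)"
    by (rule bij_kleisli_algebras[OF A B X])
  show "bij_betw (curry_arrow V (MCar A) X (X \<otimes> MCar B)) (twisted_actions V A B X)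
      (monoid_hom V A (kleisli_endo V B X))"
    by (rule bij_kleisli_endo[OF A B X])
  show "bij_betw (\<lambda>\<psi>. (tensor_module V B (MCar A) (free_module V B X), extend_to_free V A B X \<psi>,
        free_module V B X)) (twisted_actions V A B X)
      (algebra_structures (modules V B) (module_monad V A B) (free_module V B X))"
    \<comment> \<open>Both (3) and (4) factor through the bimodule structures on the free module, so
      the extension bijection is shared.\<close>
    using bij_betw_trans[OF ext bij_module_algebras[OF A B]] right_module_free[OF B X]
    by (simp add: free comp_def)
  show "bij_betw (\<lambda>\<psi>. lift_through V e
        (curry_arrow V (MCar A) (X \<otimes> MCar B) (X \<otimes> MCar B) (extend_to_free V A B X \<psi>)))
      (twisted_actions V A B X) (monoid_hom V A (module_endo V (X \<otimes> MCar B) E e))"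
    if "is_module_ihom V B (free_module V B X) (free_module V B X) E e" for E e
    using bij_betw_trans[OF ext bij_module_endo[OF A B _ m]] B X that by (simp add: free comp_def)
  show "bij_betw (coaction_to_twisted V A P (measuring V B P \<Phi>) X) (comodule_structures V P X)
      (twisted_actions V A B X)"
    if "has_dual V X" "universal_measuring V A B P \<Phi>" for P \<Phi>
  proof -
    from \<open>has_dual V X\<close> obtain Y d n where "dual_pair V X Y d n"
      using X unfolding has_dual_def dual_pair_def dual_pair_axioms_def
      using braided_monoidal_closed_axioms by blast
    then show ?thesis
      by (rule dual_pair.bij_coaction_to_twisted) (use A B that in auto)
  qed
qed

end
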